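(* Let $Z$ be an offspring distribution with $1<\mathbb{E}(Z)<\infty$ and $\mathbb{P}(Z=0)=0$, and let $(T,\rho)$ be either the Galton–Watson tree $(T_{\mathrm{GW}},\rho)$ or the unimodular Galton–Watson tree $(T_{\mathrm{UGW}},\rho)$ with offspring distribution $Z$, with $T=(V,E)$. Put i.i.d. Exponential$(1)$ weights on $\vec E$. Then almost surely the wired MSA limit exists, the limit has infinitely many infinite components, and each component is one-ended.
   Context: $(T_{\mathrm{GW}},\rho)$ is the Galton–Watson tree rooted at its ancestor. The augmented Galton–Watson tree is obtained by giving the root $Z+1$ children each independently generating a Galton–Watson tree; $(T_{\mathrm{UGW}},\rho)$ is its law biased by $1/\deg(\rho)$ (normalized). $\vec E$: both orientations of each edge. MSA: for a finite graph with boundary vertex $\partial$, a spanning arborescence is a set of oriented edges with no oriented cycle, each vertex except $\partial$ having exactly one outgoing edge and $\partial$ none; the MSA has minimal total weight. Wired MSA limit: for an exhaustion $G_1\subset G_2\subset\cdots$ by finite subgraphs, let $G_i^{\mathsf w}$ be the graph with all vertices outside $G_i$ identified to one vertex $\partial_i$ and self-loops erased, $T_i$ its MSA; the limit exists if for every vertex $v$ a.s. the outgoing edge of $v$ in $T_i$ is eventually constant and the limit does not depend on the exhaustion. For an infinite arborescence, the future of $v$ is the oriented path followed from $v$; $u,v$ are in the same component if their futures intersect; a component is one-ended if the undirected tree of its edges contains an infinite path but no two disjoint infinite paths. *)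

theory Defs
  imports "HOL-Probability.Probability"
begin

text \<open>A graph is given by a vertex set V and a symmetric adjacency relation adj
 (adj only relates vertices of V).  For a finite vertex set S (the finite subgraph
 G_i, induced), the wired graph G_i^w has vertex set S plus a boundary vertex,
 and an oriented edge (v,w) of the original graph with v in S is an edge of
 G_i^w leading to w if w is in S and to the boundary otherwise (multi-edges to
 the boundary are kept, distinguished by their original endpoint w; self-loops at
 the boundary are erased).  A spanning arborescence chooses for each v in S
 exactly one outgoing edge (v, c v); the boundary has no outgoing edge; there is
 no oriented cycle, i.e. following the chosen edges from any v in S one
 eventually leaves S (reaches the boundary).\<close>

definition spanning_arb :: "('a \<Rightarrow> 'a \<Rightarrow> bool) \<Rightarrow> 'a set \<Rightarrow> ('a \<Rightarrow> 'a) \<Rightarrow> bool" where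
  "spanning_arb adj S c \<longleftrightarrow>
     (\<forall>v\<in>S. adj v (c v)) \<and> (\<forall>v\<in>S. \<exists>n. (c ^^ n) v \<notin> S)"

definition arb_weight :: "('a \<times> 'a \<Rightarrow> real) \<Rightarrow> 'a set \<Rightarrow> ('a \<Rightarrow> 'a) \<Rightarrow> real" where
  "arb_weight W S c = (\<Sum>v\<in>S. W (v, c v))"

definition is_MSA :: "('a \<Rightarrow> 'a \<Rightarrow> bool) \<Rightarrow> ('a \<times> 'a \<Rightarrow> real) \<Rightarrow> 'a set \<Rightarrow> ('a \<Rightarrow> 'a) \<Rightarrow> bool" where
  "is_MSA adj W S c \<longleftrightarrow> spanning_arb adj S c \<and>
     (\<forall>c'. spanning_arb adj S c' \<longrightarrow> arb_weight W S c \<le> arb_weight W S c')"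

definition exhaustion :: "'a set \<Rightarrow> (nat \<Rightarrow> 'a set) \<Rightarrow> bool" where
  "exhaustion V G \<longleftrightarrow> (\<forall>i. finite (G i) \<and> G i \<subseteq> V \<and> G i \<subseteq> G (Suc i)) \<and> (\<Union>i. G i) = V"

definition wired_MSA_limit ::
  "'a set \<Rightarrow> ('a \<Rightarrow> 'a \<Rightarrow> bool) \<Rightarrow> ('a \<times> 'a \<Rightarrow> real) \<Rightarrow> ('a \<Rightarrow> 'a) \<Rightarrow> bool" where
  "wired_MSA_limit V adj W F \<longleftrightarrow>
     (\<forall>G T. exhaustion V G \<longrightarrow> (\<forall>i. is_MSA adj W (G i) (T i)) \<longrightarrow>
        (\<forall>v\<in>V. eventually (\<lambda>i. v \<in> G i \<and> T i v = F v) sequentially))"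

definition same_comp :: "('a \<Rightarrow> 'a) \<Rightarrow> 'a \<Rightarrow> 'a \<Rightarrow> bool" where
  "same_comp F u v \<longleftrightarrow> (\<exists>m n. (F ^^ m) u = (F ^^ n) v)"

definition arb_components :: "'a set \<Rightarrow> ('a \<Rightarrow> 'a) \<Rightarrow> 'a set set" where
  "arb_components V F = {{u \<in> V. same_comp F v u} | v. v \<in> V}"

definition comp_edge :: "('a \<Rightarrow> 'a) \<Rightarrow> 'a set \<Rightarrow> 'a \<Rightarrow> 'a \<Rightarrow> bool" where
  "comp_edge F C x y \<longleftrightarrow> (x \<in> C \<and> y = F x) \<or> (y \<in> C \<and> x = F y)"

definition inf_path :: "('a \<Rightarrow> 'a \<Rightarrow> bool) \<Rightarrow> (nat \<Rightarrow> 'a) \<Rightarrow> bool" where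
  "inf_path R p \<longleftrightarrow> inj p \<and> (\<forall>n. R (p n) (p (Suc n)))"

definition one_ended :: "('a \<Rightarrow> 'a) \<Rightarrow> 'a set \<Rightarrow> bool" where
  "one_ended F C \<longleftrightarrow> (\<exists>p. inf_path (comp_edge F C) p) \<and>
     (\<forall>p q. inf_path (comp_edge F C) p \<longrightarrow> inf_path (comp_edge F C) q \<longrightarrow> range p \<inter> range q \<noteq> {})"

text \<open>Vertices are lists of naturals; the root is [] and the i-th child of v is i # v.
 Z v is the number of children of v (for the augmented tree the root has Z [] + 1
 children).\<close>
definition nchildren :: "bool \<Rightarrow> (nat list \<Rightarrow> nat) \<Rightarrow> nat list \<Rightarrow> nat" where
  "nchildren aug Z v = (if aug \<and> v = [] then Z v + 1 else Z v)"

inductive_set tverts :: "bool \<Rightarrow> (nat list \<Rightarrow> nat) \<Rightarrow> nat list set" for aug Z where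
  root: "[] \<in> tverts aug Z"
| child: "v \<in> tverts aug Z \<Longrightarrow> i < nchildren aug Z v \<Longrightarrow> i # v \<in> tverts aug Z"

definition tree_adj :: "nat list set \<Rightarrow> nat list \<Rightarrow> nat list \<Rightarrow> bool" where
  "tree_adj V u v \<longleftrightarrow> u \<in> V \<and> v \<in> V \<and> ((v \<noteq> [] \<and> tl v = u) \<or> (u \<noteq> [] \<and> tl u = v))"

text \<open>Base probability space: i.i.d. offspring numbers Z v ~ mu for all labels v,
 independent of i.i.d. Exponential(1) weights W (u,v) for all ordered pairs (only
 those that are oriented edges of the tree matter).\<close>
definition base_space :: "nat pmf \<Rightarrow> ((nat list \<Rightarrow> nat) \<times> (nat list \<times> nat list \<Rightarrow> real)) measure" where
  "base_space \<mu> =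
     (PiM UNIV (\<lambda>_::nat list. measure_pmf \<mu>)) \<Otimes>\<^sub>M
     (PiM UNIV (\<lambda>_::nat list \<times> nat list. density lborel (\<lambda>x. ennreal (exponential_density 1 x))))"

text \<open>Law of the tree with weights: ugw = False gives the Galton--Watson tree
 (T_GW, root); ugw = True gives the augmented Galton--Watson tree biased by
 1 / deg(root) = 1 / (Z [] + 1), normalised, i.e. (T_UGW, root).\<close>
definition tree_law :: "nat pmf \<Rightarrow> bool \<Rightarrow> ((nat list \<Rightarrow> nat) \<times> (nat list \<times> nat list \<Rightarrow> real)) measure" where
  "tree_law \<mu> ugw =
     (if ugw then
        density (base_space \<mu>)
          (\<lambda>\<omega>. ennreal ((1 / (real (fst \<omega> []) + 1)) /
                  measure_pmf.expectation \<mu> (\<lambda>k. 1 / (real k + 1))))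
      else base_space \<mu>)"

end

theory Submission
  imports Defs "HOL-Library.Sublist"
begin

text \<open>On a finite part of a tree an arborescence is a choice of neighbours without 2-cycles, so the minimal one is
  found by dynamic programming.  Let \<open>d(x|v)\<close> be the extra cost of forbidding \<open>x\<close> to point to its neighbour \<open>v\<close>,
  computed in the branch of \<open>x\<close> away from \<open>v\<close>.  Then \<open>d(x|v)\<close> is the positive part of
  \<open>min (W(x,y) + d(y|x)) - W(x,v)\<close> over the neighbours \<open>y \<noteq> v\<close> of \<open>x\<close>, and \<open>v\<close> points to the neighbour minimising
  \<open>W(v,x) + d(x|v)\<close>.  Under wired boundary conditions \<open>d\<close> increases to a limit along every exhaustion, so the
  limit forest exists once the limits are finite and the minimisers unique; ties are null events because
  \<open>d(x|v)\<close> does not involve the weights of the edges leaving \<open>v\<close>.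

  Write \<open>psi(h)\<close> for the expectation of \<open>h^(Z+1) / (Z+1)\<close>.  Join two independent branches by an edge.  By
  exchangeability each endpoint chooses that edge with probability \<open>psi(1)\<close>, whence \<open>P(d = 0)\<^sup>2 \<ge> 1 - 2 psi(1) > 0\<close>;
  with the zero-one law \<open>q \<le> E(q^Z) \<Longrightarrow> q \<in> {0, 1}\<close> this gives \<open>d < \<infinity>\<close>.  A backward path of the forest eventually
  descends along vertices with \<open>d > 0\<close>.  If \<open>h\<close> is the probability that a branch does not start such an infinite
  ray, the same argument gives \<open>h\<^sup>2 - 2 psi(h) \<ge> 1 - 2 psi(1)\<close>, and strict monotonicity forces \<open>h = 1\<close>: all components
  are one-ended.  Finally edges unused in both directions separate components, and by the zero-one law
  they occur below every vertex.\<close>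

section \<open>Minimal arborescences on trees\<close>

text \<open>The joining argument is run twice, because exchangeability of the exits needs costs
  whose sums with the weights have no atoms, hence finite costs. At the outset only the truncated
  costs are known to be finite. The first run uses them and yields a bound uniform in the truncation
  level; its limit makes cost 0 possible, hence infinite cost null. The second run uses the limit
  itself, with an event attached to each branch: the three disjoint cases (both costs 0, one branch
  exits into the other, the reverse) all lie inside the event that both branches are free of rays,
  of probability \<open>h^2\<close>. Both runs must produce the same constant
  \<open>1 - 2 psi(1)\<close>, since only then does strict monotonicity leave no room for
  \<open>h < 1\<close>. Its positivity is the same strict inequality at \<open>h = 0\<close>, and
  strictness itself comes from \<open>Z >= 2\<close> having positive probability. Variables are
  attached to all labels, inside the tree or not. Two independent branches at \<open>[0]\<close> and
  \<open>[1]\<close> are thus always available, and the weights of their edges to the root serve as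
  the two weights of the edge joining them.\<close>

fun detour :: "('a \<Rightarrow> 'a \<Rightarrow> 'a set) \<Rightarrow> ('a \<times> 'a \<Rightarrow> real) \<Rightarrow> nat \<Rightarrow> 'a \<Rightarrow> 'a \<Rightarrow> ennreal" where
  "detour N W 0 x v = 0"
| "detour N W (Suc k) x v =
     (INF y\<in>N x v. ennreal (W (x, y)) + detour N W k y x) - ennreal (W (x, v))"

definition detour_lim :: "('a \<Rightarrow> 'a \<Rightarrow> 'a set) \<Rightarrow> ('a \<times> 'a \<Rightarrow> real) \<Rightarrow> 'a \<Rightarrow> 'a \<Rightarrow> ennreal" where
  "detour_lim N W x v = (SUP k. detour N W k x v)"

text \<open>Cost 0 at level 0 is the wired boundary condition. Looking one level deeper replaces
  these zeros by nonnegative costs, and the recursion is monotone in them. Subtraction in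
  \<open>ennreal\<close> truncates at 0, hence is the positive part, and an empty infimum is
  infinite: a dead end cannot avoid \<open>v\<close>.\<close>

lemma detour_le_Suc: "detour N W k x v \<le> detour N W (Suc k) x v"
proof (induction k arbitrary: x v)
  case (Suc k)
  show ?case
    by (subst (1 2) detour.simps(2)) (intro ennreal_minus_mono INF_mono' add_mono Suc.IH order_refl)
qed simp

lemma detour_mono: "k \<le> l \<Longrightarrow> detour N W k x v \<le> detour N W l x v"
  by (rule lift_Suc_mono_le[of "\<lambda>k. detour N W k x v"]) (rule detour_le_Suc)

lemma tendsto_detour: "(\<lambda>k. detour N W k x v) \<longlonglongrightarrow> detour_lim N W x v"
  unfolding detour_lim_def by (rule LIMSEQ_SUP) (simp add: incseq_def detour_mono)

lemma tendsto_INF_finite: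
  fixes f :: "nat \<Rightarrow> 'a \<Rightarrow> ennreal"
  assumes "finite I" "\<And>i. i \<in> I \<Longrightarrow> (\<lambda>k. f k i) \<longlonglongrightarrow> g i"
  shows "(\<lambda>k. INF i\<in>I. f k i) \<longlonglongrightarrow> (INF i\<in>I. g i)"
  using assms
proof (induction I)
  case (insert a I)
  then have "(\<lambda>k. min (f k a) (INF i\<in>I. f k i)) \<longlonglongrightarrow> min (g a) (INF i\<in>I. g i)"
    by (intro tendsto_min) auto
  then show ?case by (simp add: inf_min)
qed simp

text \<open>Finiteness of \<open>N x v\<close> lets the increasing limit pass through the
  infimum.\<close>

lemma detour_lim_rec:
  assumes "finite (N x v)"
  shows "detour_lim N W x v =
    (INF y\<in>N x v. ennreal (W (x, y)) + detour_lim N W y x) - ennreal (W (x, v))"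
proof -
  have "(\<lambda>k. detour N W (Suc k) x v) \<longlonglongrightarrow>
      (INF y\<in>N x v. ennreal (W (x, y)) + detour_lim N W y x) - ennreal (W (x, v))"
    unfolding detour.simps
    by (intro tendsto_diff_ennreal_general tendsto_INF_finite assms tendsto_add tendsto_const
        tendsto_detour) simp
  moreover have "(\<lambda>k. detour N W (Suc k) x v) \<longlonglongrightarrow> detour_lim N W x v"
    using tendsto_detour by (rule LIMSEQ_Suc)
  ultimately show ?thesis by (rule LIMSEQ_unique[rotated])
qed

lemma ennreal_le_add_diff: "(a :: ennreal) \<le> b + (a - b)"
proof (cases "b \<le> a")
  case True
  then show ?thesis by (simp add: add_diff_inverse_ennreal)
next
  case False
  then have "a \<le> b" by simp
  also have "b \<le> b + (a - b)" by (rule add_increasing2) simp_all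
  finally show ?thesis .
qed

lemma INF_attained:
  fixes f :: "'a \<Rightarrow> ennreal"
  assumes "finite I" "I \<noteq> {}"
  obtains i where "i \<in> I" "f i = (INF i\<in>I. f i)"
proof -
  have "Min (f ` I) \<in> f ` I" using assms by (intro Min_in) auto
  moreover have "Min (f ` I) = (INF i\<in>I. f i)" using assms by (simp add: Min_Inf)
  ultimately show ?thesis using that by auto
qed

section \<open>Locality of detour costs and trees of labels\<close>

fun branch_ball :: "('a \<Rightarrow> 'a \<Rightarrow> 'a set) \<Rightarrow> nat \<Rightarrow> 'a \<Rightarrow> 'a \<Rightarrow> 'a set" where
  "branch_ball N 0 x v = {}"
| "branch_ball N (Suc k) x v = insert x (\<Union>y\<in>N x v. branch_ball N k y x)"

text \<open>Only weights of edges leaving vertices of the ball are read. Since the ball avoids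
  \<open>v\<close>, the cost at \<open>x\<close> against \<open>v\<close> is blind to the weights
  leaving \<open>v\<close>, which later excludes ties.\<close>

lemma detour_cong:
  assumes "\<And>a b. a \<in> branch_ball N k x v \<Longrightarrow> W (a, b) = W' (a, b)"
  shows "detour N W k x v = detour N W' k x v"
  using assms
proof (induction k arbitrary: x v)
  case (Suc k)
  have "detour N W k y x = detour N W' k y x" if "y \<in> N x v" for y
    using that by (intro Suc.IH Suc.prems) auto
  then show ?case using Suc.prems by auto
qed simp

definition nbrs :: "nat list set \<Rightarrow> nat list \<Rightarrow> nat list \<Rightarrow> nat list set" where
  "nbrs V x v = {y. tree_adj V x y} - {v}"

locale labelled_tree =
  fixes V :: "nat list set"
  assumes root_in: "[] \<in> V"
    and tl_in: "v \<in> V \<Longrightarrow> tl v \<in> V"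
    and fin_children: "finite {i. i # v \<in> V}"
begin

abbreviation "adj \<equiv> tree_adj V"
abbreviation "N \<equiv> nbrs V"

lemma adj_sym: "adj x y \<longleftrightarrow> adj y x"
  by (auto simp: tree_adj_def)

lemma adj_in: "adj x y \<Longrightarrow> x \<in> V \<and> y \<in> V"
  by (auto simp: tree_adj_def)

lemma adj_cases:
  assumes "adj x y"
  obtains i where "y = i # x" | i where "x = i # y"
  using assms unfolding tree_adj_def by (metis list.collapse)

lemma adj_irrefl: "adj x y \<Longrightarrow> x \<noteq> y"
  by (erule adj_cases) auto

lemma finite_adj: "finite {y. adj x y}"
proof (rule finite_subset)
  show "{y. adj x y} \<subseteq> insert (tl x) ((\<lambda>i. i # x) ` {i. i # x \<in> V})"
  proof
    fix y assume "y \<in> {y. adj x y}"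
    then have "adj x y" by simp
    then show "y \<in> insert (tl x) ((\<lambda>i. i # x) ` {i. i # x \<in> V})"
      using adj_in[OF \<open>adj x y\<close>] by (cases rule: adj_cases) auto
  qed
qed (use fin_children in auto)

lemma finite_nbrs: "finite (N x v)"
  unfolding nbrs_def using finite_adj by simp

lemma branch_ball_subset: "x \<in> V \<Longrightarrow> branch_ball N k x v \<subseteq> V"
  by (induction k arbitrary: x v) (auto simp: nbrs_def dest!: adj_in)

lemma finite_branch_ball: "finite (branch_ball N k x v)"
  by (induction k arbitrary: x v) (auto simp: finite_nbrs)

text \<open>Labels grow at the front, so \<open>suffix x z\<close> says that \<open>z\<close>
  descends from \<open>x\<close>. Cutting the edge between \<open>x\<close> and \<open>v\<close>
  leaves two sides, described according to which endpoint is the parent; a neighbour of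
  \<open>x\<close> other than \<open>v\<close> never leads back across the cut.\<close>

lemma branch_ball_side:
  assumes "adj x v"
  shows "branch_ball N k x v \<subseteq> (if x \<noteq> [] \<and> tl x = v then {z. suffix x z} else {z. \<not> suffix v z})"
  using assms
proof (induction k arbitrary: x v)
  case (Suc k)
  have IH: "branch_ball N k y x \<subseteq> (if y \<noteq> [] \<and> tl y = x then {z. suffix y z} else {z. \<not> suffix x z})"
    if "y \<in> N x v" for y
    using that by (intro Suc.IH) (auto simp: nbrs_def adj_sym)
  from Suc.prems show ?case
  proof (cases rule: adj_cases)
    case (1 i)
    have "branch_ball N k y x \<subseteq> {z. \<not> suffix v z}" if y: "y \<in> N x v" for y
    proof -
      from y have "adj x y" "y \<noteq> v" by (auto simp: nbrs_def)
      from this(1) show ?thesis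
      proof (cases rule: adj_cases)
        case (1 j)
        then have "j \<noteq> i" using \<open>y \<noteq> v\<close> \<open>v = i # x\<close> by auto
        then have "\<not> suffix v z" if "suffix y z" for z
          using that 1 \<open>v = i # x\<close> by (auto simp: suffix_def)
        then show ?thesis using IH[OF y] 1 by auto
      next
        case (2 j)
        have "suffix x z" if "suffix v z" for z
          using that \<open>v = i # x\<close> by (metis suffix_ConsD)
        moreover have "tl y \<noteq> x"
        proof
          assume "tl y = x"
          then have "length x = length y - 1" by auto
          with 2 show False by simp
        qed
        ultimately show ?thesis using IH[OF y] by auto
      qed
    qed
    moreover have "\<not> suffix v x" using 1 by (auto simp: suffix_def)
    moreover have "tl x \<noteq> v"
    proof
      assume "tl x = v"
      then have "length v = length x - 1" by auto
      with 1 show False by simp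
    qed
    ultimately show ?thesis by auto
  next
    case (2 i)
    have "branch_ball N k y x \<subseteq> {z. suffix x z}" if y: "y \<in> N x v" for y
    proof -
      from y have "adj x y" "y \<noteq> v" by (auto simp: nbrs_def)
      then obtain j where "y = j # x" using 2 by (auto elim: adj_cases)
      then show ?thesis using IH[OF y] by (auto dest: suffix_ConsD)
    qed
    then show ?thesis using 2 by auto
  qed
qed simp

lemma not_in_branch_ball: "adj x v \<Longrightarrow> v \<notin> branch_ball N k x v"
proof -
  assume a: "adj x v"
  have "\<not> suffix x v" if "x \<noteq> []" "tl x = v"
    using that by (cases x) (auto simp: suffix_def)
  with branch_ball_side[OF a, of k] show ?thesis by (auto split: if_splits)
qed

section \<open>Acyclicity on trees\<close>

definition no_2cycle :: "nat list set \<Rightarrow> (nat list \<Rightarrow> nat list) \<Rightarrow> bool" where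
  "no_2cycle A c \<longleftrightarrow> (\<forall>u\<in>A. adj u (c u) \<and> (c u \<in> A \<longrightarrow> c (c u) \<noteq> u))"

lemma no_2cycle_subset: "no_2cycle A c \<Longrightarrow> B \<subseteq> A \<Longrightarrow> no_2cycle B c"
  unfolding no_2cycle_def by blast

text \<open>Vertices outside the set count as boundary, so a vertex \<open>x\<close> taken out of it
  can be reattached to any neighbour that does not point at it.\<close>

lemma no_2cycle_upd:
  assumes "no_2cycle (A - {x}) e" "adj x y" "y \<in> A - {x} \<Longrightarrow> e y \<noteq> x"
  shows "no_2cycle A (e(x := y))"
  unfolding no_2cycle_def
proof (intro ballI conjI impI)
  fix u assume u: "u \<in> A"
  have "y \<noteq> x" using adj_irrefl[OF assms(2)] by simp
  show "adj u ((e(x := y)) u)" using assms(1,2) u by (cases "u = x") (auto simp: no_2cycle_def)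
  assume m: "(e(x := y)) u \<in> A"
  show "(e(x := y)) ((e(x := y)) u) \<noteq> u"
  proof (cases "u = x")
    case True
    then show ?thesis using m assms(3) \<open>y \<noteq> x\<close> by simp
  next
    case False
    show ?thesis
    proof (cases "e u = x")
      case True
      then show ?thesis using False assms(3) u by auto
    next
      case eu: False
      then have "e u \<in> A - {x}" using m False by simp
      then show ?thesis using assms(1) u False eu by (simp add: no_2cycle_def)
    qed
  qed
qed

lemma sum_upd:
  fixes f :: "nat list \<Rightarrow> nat list \<Rightarrow> ennreal"
  assumes "finite A" "x \<in> A"
  shows "(\<Sum>u\<in>A. f u ((e(x := y)) u)) = f x y + (\<Sum>u\<in>A - {x}. f u (e u))"
proof -
  have "(\<Sum>u\<in>A - {x}. f u ((e(x := y)) u)) = (\<Sum>u\<in>A - {x}. f u (e u))"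
    by (rule sum.cong) auto
  then show ?thesis using assms by (simp only: sum.remove[OF assms] fun_upd_same)
qed

text \<open>A step down can only be followed by a step up by turning back, and the number of steps
  up is limited by the length of the starting label.\<close>

lemma nonbacktracking_exits:
  assumes p: "\<And>n. adj (p n) (p (Suc n))" "\<And>n. p (Suc (Suc n)) \<noteq> p n"
  obtains K where "\<And>n. n \<ge> K \<Longrightarrow> \<exists>i. p (Suc n) = i # p n"
proof -
  have stay: "\<exists>i. p (Suc (Suc n)) = i # p (Suc n)" if "\<exists>i. p (Suc n) = i # p n" for n
    using p(1)[of "Suc n"] p(2)[of n] that by (auto elim!: adj_cases)
  have "\<exists>K i. p (Suc K) = i # p K"
  proof (rule ccontr)
    assume neg: "\<not> ?thesis"
    have up: "length (p (Suc n)) < length (p n)" for n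
      using p(1)[of n] neg by (metis adj_cases length_Cons lessI)
    have "length (p n) + n \<le> length (p 0)" for n
    proof (induction n)
      case (Suc n)
      then show ?case using up[of n] by simp
    qed simp
    from this[of "Suc (length (p 0))"] show False by simp
  qed
  then obtain K where K: "\<exists>i. p (Suc K) = i # p K" by blast
  have "\<exists>i. p (Suc n) = i # p n" if "n \<ge> K" for n
    using that by (induction n rule: dec_induct) (use K stay in auto)
  then show ?thesis using that by blast
qed

lemma nonbacktracking_orbit_inj:
  fixes c :: "nat list \<Rightarrow> nat list"
  assumes step: "\<And>n. adj ((c ^^ n) v) ((c ^^ Suc n) v)"
    and nb: "\<And>n. (c ^^ Suc (Suc n)) v \<noteq> (c ^^ n) v"
  shows "inj (\<lambda>n. (c ^^ n) v)"
proof -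
  obtain K where K: "\<And>n. n \<ge> K \<Longrightarrow> \<exists>i. (c ^^ Suc n) v = i # (c ^^ n) v"
    using nonbacktracking_exits[of "\<lambda>n. (c ^^ n) v"] step nb by blast
  have len: "length ((c ^^ (K + m)) v) = length ((c ^^ K) v) + m" for m
  proof (induction m)
    case (Suc m)
    then show ?case using K[of "K + m"] by auto
  qed simp
  have ne: False if "a < b" "(c ^^ a) v = (c ^^ b) v" for a b
  proof -
    have "(c ^^ (K + a)) v = (c ^^ (K + b)) v"
      using that(2) by (simp add: funpow_add)
    then show False using len[of a] len[of b] that(1) by simp
  qed
  show ?thesis
  proof (rule injI)
    fix a b assume "(c ^^ a) v = (c ^^ b) v"
    then show "a = b" using ne[of a b] ne[of b a] by (cases a b rule: linorder_cases) auto
  qed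
qed

text \<open>An orbit that never turns back is injective on a tree, so it leaves every finite
  set.\<close>

lemma spanning_arb_iff:
  assumes "finite A" "A \<subseteq> V"
  shows "spanning_arb adj A c \<longleftrightarrow> no_2cycle A c"
proof
  assume sp: "spanning_arb adj A c"
  have "c (c u) \<noteq> u" if "u \<in> A" "c u \<in> A" for u
  proof
    assume eq: "c (c u) = u"
    have "(c ^^ n) u \<in> {u, c u}" for n
      by (induction n) (use eq in auto)
    then have "(c ^^ n) u \<in> A" for n using that by (metis insertE singletonD)
    with sp that show False unfolding spanning_arb_def by blast
  qed
  with sp show "no_2cycle A c" unfolding spanning_arb_def no_2cycle_def by blast
next
  assume nc: "no_2cycle A c"
  have "\<exists>n. (c ^^ n) v \<notin> A" if "v \<in> A" for v
  proof (rule ccontr)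
    assume "\<not> ?thesis"
    then have inA: "(c ^^ n) v \<in> A" for n by blast
    have "inj (\<lambda>n. (c ^^ n) v)"
    proof (rule nonbacktracking_orbit_inj)
      show "adj ((c ^^ n) v) ((c ^^ Suc n) v)" for n
        using nc inA[of n] by (auto simp: no_2cycle_def)
      show "(c ^^ Suc (Suc n)) v \<noteq> (c ^^ n) v" for n
        using nc inA[of n] inA[of "Suc n"] by (auto simp: no_2cycle_def)
    qed
    then have "infinite (range (\<lambda>n. (c ^^ n) v))" by (simp add: range_inj_infinite)
    moreover have "range (\<lambda>n. (c ^^ n) v) \<subseteq> A" using inA by blast
    ultimately show False using assms(1) finite_subset by blast
  qed
  with nc show "spanning_arb adj A c" unfolding spanning_arb_def no_2cycle_def by blast
qed


text \<open>Lower bound of the dynamic programme: once the ball lies in \<open>A\<close>, keeping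
  \<open>x\<close> from pointing to \<open>v\<close> costs at least the truncated detour, so lifting
  the prohibition saves that much. Removing \<open>x\<close> from \<open>A\<close> makes it play for
  \<open>y = c x\<close> the part that \<open>v\<close> played for \<open>x\<close>.\<close>

lemma relax_detour:
  assumes "finite A" "no_2cycle A c" "adj x v" "branch_ball N k x v \<subseteq> A" "v \<notin> A" "x \<in> A \<Longrightarrow> c x \<noteq> v"
  obtains c' where "no_2cycle A c'"
    "(\<Sum>u\<in>A. ennreal (W (u, c' u))) + detour N W k x v \<le> (\<Sum>u\<in>A. ennreal (W (u, c u)))"
proof -
  have "\<exists>c'. no_2cycle A c' \<and>
    (\<Sum>u\<in>A. ennreal (W (u, c' u))) + detour N W k x v \<le> (\<Sum>u\<in>A. ennreal (W (u, c u)))"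
    using assms
  proof (induction k arbitrary: A c x v)
    case 0
    then show ?case by auto
  next
    case (Suc k)
    define y where "y = c x"
    define D where "D = (INF y\<in>N x v. ennreal (W (x, y)) + detour N W k y x)"
    have x: "x \<in> A" and xy: "adj x y" and "y \<noteq> v"
      using Suc.prems by (auto simp: no_2cycle_def y_def)
    then have yN: "y \<in> N x v" by (simp add: nbrs_def)
    show ?case
    proof (cases "D \<le> ennreal (W (x, v))")
      case True
      then have "detour N W (Suc k) x v = 0"
        by (simp add: D_def[symmetric] diff_eq_0_ennreal le_less_trans[OF _ ennreal_less_top])
      then show ?thesis using Suc.prems by auto
    next
      case False
      let ?B = "A - {x}"
      have yx: "adj y x" using xy adj_sym by blast
      have "\<exists>c'. no_2cycle ?B c' \<and>
        (\<Sum>u\<in>?B. ennreal (W (u, c' u))) + detour N W k y x \<le> (\<Sum>u\<in>?B. ennreal (W (u, c u)))"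
      proof (rule Suc.IH[OF _ _ yx])
        show "branch_ball N k y x \<subseteq> ?B"
          using Suc.prems(4) yN not_in_branch_ball[OF yx] by auto
        show "c y \<noteq> x" if "y \<in> ?B"
          using Suc.prems(2) x that by (auto simp: no_2cycle_def y_def)
      qed (use Suc.prems no_2cycle_subset in auto)
      then obtain e where e: "no_2cycle ?B e"
        "(\<Sum>u\<in>?B. ennreal (W (u, e u))) + detour N W k y x \<le> (\<Sum>u\<in>?B. ennreal (W (u, c u)))"
        by blast
      define c' where "c' = e(x := v)"
      have "no_2cycle A c'"
        unfolding c'_def using e(1) Suc.prems(3,5) by (intro no_2cycle_upd) auto
      moreover have "(\<Sum>u\<in>A. ennreal (W (u, c' u))) + detour N W (Suc k) x v
          \<le> (\<Sum>u\<in>A. ennreal (W (u, c u)))"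
      proof -
        have "(\<Sum>u\<in>A. ennreal (W (u, c' u))) = ennreal (W (x, v)) + (\<Sum>u\<in>?B. ennreal (W (u, e u)))"
          unfolding c'_def by (rule sum_upd) fact+
        then have "(\<Sum>u\<in>A. ennreal (W (u, c' u))) + detour N W (Suc k) x v
            = (\<Sum>u\<in>?B. ennreal (W (u, e u))) + (ennreal (W (x, v)) + (D - ennreal (W (x, v))))"
          by (simp add: D_def ac_simps)
        also have "\<dots> = (\<Sum>u\<in>?B. ennreal (W (u, e u))) + D"
          using False by (subst add_diff_inverse_ennreal) auto
        also have "\<dots> \<le> (\<Sum>u\<in>?B. ennreal (W (u, e u))) + (ennreal (W (x, y)) + detour N W k y x)"
          unfolding D_def by (intro add_left_mono INF_lower yN)
        also have "\<dots> = ennreal (W (x, y)) + ((\<Sum>u\<in>?B. ennreal (W (u, e u))) + detour N W k y x)"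
          by (simp add: ac_simps)
        also have "\<dots> \<le> ennreal (W (x, y)) + (\<Sum>u\<in>?B. ennreal (W (u, c u)))"
          by (intro add_left_mono e)
        also have "\<dots> = (\<Sum>u\<in>A. ennreal (W (u, c u)))"
          using sum.remove[OF Suc.prems(1) x, of "\<lambda>u. ennreal (W (u, c u))"] by (simp add: y_def)
        finally show ?thesis .
      qed
      ultimately show ?thesis by blast
    qed
  qed
  then show ?thesis using that by blast
qed

text \<open>Matching upper bound: imposing the prohibition costs at most the limit. Where the branch
  leaves \<open>A\<close> the constraint is vacuous, so the induction runs over the finite set
  \<open>A\<close> and stops there.\<close>

lemma restrict_detour:
  assumes "finite A" "no_2cycle A c" "adj x v" "v \<notin> A" "detour_lim N W x v < \<top>"
  obtains c' where "no_2cycle A c'" "x \<in> A \<Longrightarrow> c' x \<noteq> v"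
    "(\<Sum>u\<in>A. ennreal (W (u, c' u))) \<le> (\<Sum>u\<in>A. ennreal (W (u, c u))) + detour_lim N W x v"
proof -
  have "\<exists>c'. no_2cycle A c' \<and> (x \<in> A \<longrightarrow> c' x \<noteq> v) \<and>
    (\<Sum>u\<in>A. ennreal (W (u, c' u))) \<le> (\<Sum>u\<in>A. ennreal (W (u, c u))) + detour_lim N W x v"
    using assms
  proof (induction A arbitrary: c x v rule: finite_psubset_induct)
    case (psubset A)
    show ?case
    proof (cases "x \<in> A \<and> c x = v")
      case False
      then show ?thesis using psubset.prems by (intro exI[of _ c]) auto
    next
      case True
      define D where "D = (INF y\<in>N x v. ennreal (W (x, y)) + detour_lim N W y x)"
      have dx: "detour_lim N W x v = D - ennreal (W (x, v))"
        unfolding D_def by (rule detour_lim_rec[OF finite_nbrs])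
      have D_top: "D < \<top>"
        using psubset.prems(4) unfolding dx by (cases "D = \<top>") (auto simp: less_top[symmetric])
      then have "N x v \<noteq> {}" by (auto simp: D_def)
      then obtain y where y: "y \<in> N x v" "ennreal (W (x, y)) + detour_lim N W y x = D"
        unfolding D_def by (rule INF_attained[OF finite_nbrs])
      then have xy: "adj x y" and yx: "adj y x" and "y \<noteq> v"
        using adj_sym by (auto simp: nbrs_def)
      let ?B = "A - {x}"
      have "\<exists>c'. no_2cycle ?B c' \<and> (y \<in> ?B \<longrightarrow> c' y \<noteq> x) \<and>
        (\<Sum>u\<in>?B. ennreal (W (u, c' u))) \<le> (\<Sum>u\<in>?B. ennreal (W (u, c u))) + detour_lim N W y x"
      proof (rule psubset.IH[OF _ _ yx])
        show "detour_lim N W y x < \<top>" using y(2) D_top by auto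
        show "no_2cycle ?B c" using psubset.prems(1) by (rule no_2cycle_subset) auto
      qed (use True in auto)
      then obtain e where e: "no_2cycle ?B e" "y \<in> ?B \<longrightarrow> e y \<noteq> x"
        "(\<Sum>u\<in>?B. ennreal (W (u, e u))) \<le> (\<Sum>u\<in>?B. ennreal (W (u, c u))) + detour_lim N W y x"
        by blast
      define c' where "c' = e(x := y)"
      have "no_2cycle A c'"
        unfolding c'_def using e(1,2) xy by (intro no_2cycle_upd) auto
      moreover have "c' x \<noteq> v" using \<open>y \<noteq> v\<close> by (simp add: c'_def)
      moreover have "(\<Sum>u\<in>A. ennreal (W (u, c' u))) \<le> (\<Sum>u\<in>A. ennreal (W (u, c u))) + detour_lim N W x v"
      proof -
        have "(\<Sum>u\<in>A. ennreal (W (u, c' u))) = ennreal (W (x, y)) + (\<Sum>u\<in>?B. ennreal (W (u, e u)))"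
          unfolding c'_def using psubset.hyps True by (intro sum_upd) auto
        also have "\<dots> \<le> ennreal (W (x, y)) + ((\<Sum>u\<in>?B. ennreal (W (u, c u))) + detour_lim N W y x)"
          by (intro add_left_mono e)
        also have "\<dots> = (\<Sum>u\<in>?B. ennreal (W (u, c u))) + D"
          by (simp add: y(2)[symmetric] ac_simps)
        also have "\<dots> \<le> (\<Sum>u\<in>?B. ennreal (W (u, c u))) + (ennreal (W (x, v)) + (D - ennreal (W (x, v))))"
          by (intro add_left_mono ennreal_le_add_diff)
        also have "\<dots> = (\<Sum>u\<in>A. ennreal (W (u, c u))) + detour_lim N W x v"
          using sum.remove[OF psubset.hyps, of x "\<lambda>u. ennreal (W (u, c u))"] True
          by (simp add: dx ac_simps)
        finally show ?thesis .
      qed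
      ultimately show ?thesis by blast
    qed
  qed
  then show ?thesis using that by blast
qed

end

section \<open>Convergence of minimal arborescences to the best exits\<close>

locale weighted_tree = labelled_tree V for V +
  fixes W :: "nat list \<times> nat list \<Rightarrow> real"
  assumes W_nonneg: "W e \<ge> 0"
begin

abbreviation "d \<equiv> detour N W"
abbreviation "dl \<equiv> detour_lim N W"

text \<open>Surgery around \<open>v\<close>, which becomes boundary once taken out of
  \<open>S\<close>. As \<open>T v\<close> does not point back, that constraint is lifted (gain at
  least \<open>d k (T v) v\<close>), the constraint that \<open>x\<close> does not point to
  \<open>v\<close> is imposed (cost at most \<open>dl x v\<close>), and \<open>v\<close> is
  redirected to \<open>x\<close>. Minimality of \<open>T\<close> compares the totals; the finite
  weight of the intermediate choice \<open>c1\<close> cancels.\<close>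

lemma MSA_exchange:
  assumes S: "finite S" "S \<subseteq> V" "v \<in> S" and T: "is_MSA adj W S T"
    and ball: "branch_ball N k (T v) v \<subseteq> S" and x: "adj v x" "x \<noteq> T v"
  shows "ennreal (W (v, T v)) + d k (T v) v \<le> ennreal (W (v, x)) + dl x v"
proof (cases "dl x v < \<top>")
  case False
  then show ?thesis by (simp add: less_top[symmetric])
next
  case True
  define A where "A = S - {v}"
  have T2: "no_2cycle S T"
    using T S spanning_arb_iff by (auto simp: is_MSA_def)
  then have a: "adj v (T v)" using S(3) by (auto simp: no_2cycle_def)
  then have a': "adj (T v) v" using adj_sym by blast
  have A: "finite A" "v \<notin> A" "no_2cycle A T"
    using S T2 no_2cycle_subset by (auto simp: A_def)
  have "branch_ball N k (T v) v \<subseteq> A" using ball not_in_branch_ball[OF a'] by (auto simp: A_def)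
  moreover have "T (T v) \<noteq> v" if "T v \<in> A"
    using that T2 S(3) by (auto simp: A_def no_2cycle_def)
  ultimately obtain c1 where c1: "no_2cycle A c1"
    "(\<Sum>u\<in>A. ennreal (W (u, c1 u))) + d k (T v) v \<le> (\<Sum>u\<in>A. ennreal (W (u, T u)))"
    using relax_detour[OF A(1,3) a', of k] A(2) by blast
  obtain c2 where c2: "no_2cycle A c2" "x \<in> A \<Longrightarrow> c2 x \<noteq> v"
    "(\<Sum>u\<in>A. ennreal (W (u, c2 u))) \<le> (\<Sum>u\<in>A. ennreal (W (u, c1 u))) + dl x v"
    using restrict_detour[OF A(1) c1(1) _ A(2) True] x(1) adj_sym by blast
  define c where "c = c2(v := x)"
  have "no_2cycle S c"
    unfolding c_def using c2(1,2) x(1) by (intro no_2cycle_upd) (auto simp: A_def)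
  then have "arb_weight W S T \<le> arb_weight W S c"
    using T S spanning_arb_iff by (auto simp: is_MSA_def)
  then have "(\<Sum>u\<in>S. ennreal (W (u, T u))) \<le> (\<Sum>u\<in>S. ennreal (W (u, c u)))"
    by (simp add: arb_weight_def W_nonneg sum_nonneg)
  also have "(\<Sum>u\<in>S. ennreal (W (u, c u))) = ennreal (W (v, x)) + (\<Sum>u\<in>A. ennreal (W (u, c2 u)))"
    unfolding c_def A_def using S by (intro sum_upd) auto
  also have "\<dots> \<le> ennreal (W (v, x)) + ((\<Sum>u\<in>A. ennreal (W (u, c1 u))) + dl x v)"
    by (intro add_left_mono c2)
  also have "(\<Sum>u\<in>S. ennreal (W (u, T u))) = ennreal (W (v, T v)) + (\<Sum>u\<in>A. ennreal (W (u, T u)))"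
    using sum.remove[OF S(1,3), of "\<lambda>u. ennreal (W (u, T u))"] by (simp add: A_def)
  finally have "ennreal (W (v, T v)) + (\<Sum>u\<in>A. ennreal (W (u, T u)))
      \<le> ennreal (W (v, x)) + ((\<Sum>u\<in>A. ennreal (W (u, c1 u))) + dl x v)" .
  moreover have "ennreal (W (v, T v)) + ((\<Sum>u\<in>A. ennreal (W (u, c1 u))) + d k (T v) v)
      \<le> ennreal (W (v, T v)) + (\<Sum>u\<in>A. ennreal (W (u, T u)))"
    by (intro add_left_mono c1)
  ultimately have "ennreal (W (v, T v)) + ((\<Sum>u\<in>A. ennreal (W (u, c1 u))) + d k (T v) v)
      \<le> ennreal (W (v, x)) + ((\<Sum>u\<in>A. ennreal (W (u, c1 u))) + dl x v)"
    by (rule order_trans[rotated])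
  then have "(\<Sum>u\<in>A. ennreal (W (u, c1 u))) + (ennreal (W (v, T v)) + d k (T v) v)
      \<le> (\<Sum>u\<in>A. ennreal (W (u, c1 u))) + (ennreal (W (v, x)) + dl x v)"
    by (simp only: ac_simps)
  moreover have "(\<Sum>u\<in>A. ennreal (W (u, c1 u))) \<noteq> \<top>"
    using A(1) by (simp add: W_nonneg)
  ultimately show ?thesis
    by (simp add: ennreal_add_left_cancel_le)
qed

lemma exhaustion_eventually:
  assumes "exhaustion V G" "finite U" "U \<subseteq> V"
  shows "eventually (\<lambda>i. U \<subseteq> G i) sequentially"
proof -
  have mono: "G i \<subseteq> G j" if "i \<le> j" for i j
    using assms(1) lift_Suc_mono_le[of G, OF _ that] by (simp add: exhaustion_def)
  have "\<forall>u\<in>U. \<exists>i. u \<in> G i" using assms by (auto simp: exhaustion_def)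
  then obtain f where f: "\<And>u. u \<in> U \<Longrightarrow> u \<in> G (f u)" by metis
  have "U \<subseteq> G i" if "i \<ge> Max (f ` U)" for i
  proof
    fix u assume u: "u \<in> U"
    then have "f u \<le> i" using that assms(2) by (meson Max_ge finite_imageI imageI order_trans)
    then show "u \<in> G i" using f[OF u] mono by blast
  qed
  then show ?thesis by (auto simp: eventually_sequentially)
qed


text \<open>The limiting Bellman principle: \<open>v\<close> exits through the neighbour minimising the weight of the edge plus
  the cost of forcing that neighbour not to point back.\<close>
definition best_exit :: "nat list \<Rightarrow> nat list \<Rightarrow> bool" where
  "best_exit v a \<longleftrightarrow> adj v a \<and> ennreal (W (v, a)) + dl a v < \<top> \<and>
     (\<forall>b. adj v b \<longrightarrow> b \<noteq> a \<longrightarrow> ennreal (W (v, a)) + dl a v < ennreal (W (v, b)) + dl b v)"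

text \<open>The inequalities in \<open>best_exit\<close> are strict and \<open>v\<close> has
  finitely many neighbours, so one truncation level \<open>k\<close> already separates
  \<open>F v\<close> from all competitors. Every exhaustion eventually contains the balls of that
  level, and the exchange inequality then excludes any other choice.\<close>

lemma wired_MSA_limit_best_exit:
  assumes F: "\<And>v. v \<in> V \<Longrightarrow> best_exit v (F v)"
  shows "wired_MSA_limit V adj W F"
  unfolding wired_MSA_limit_def
proof (intro allI impI ballI)
  fix G T v
  assume ex: "exhaustion V G" and T: "\<forall>i. is_MSA adj W (G i) (T i)" and v: "v \<in> V"
  let ?a = "F v"
  have a: "adj v ?a" using F[OF v] by (simp add: best_exit_def)
  have "eventually (\<lambda>k. \<forall>b\<in>N v ?a. ennreal (W (v, ?a)) + dl ?a v < ennreal (W (v, b)) + d k b v) sequentially"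
  proof (intro eventually_ball_finite finite_nbrs ballI)
    fix b assume "b \<in> N v ?a"
    then have "ennreal (W (v, ?a)) + dl ?a v < ennreal (W (v, b)) + dl b v"
      using F[OF v] by (auto simp: best_exit_def nbrs_def)
    moreover have "(\<lambda>k. ennreal (W (v, b)) + d k b v) \<longlonglongrightarrow> ennreal (W (v, b)) + dl b v"
      by (intro tendsto_add tendsto_const tendsto_detour)
    ultimately show "eventually (\<lambda>k. ennreal (W (v, ?a)) + dl ?a v < ennreal (W (v, b)) + d k b v) sequentially"
      by (rule order_tendstoD(1)[rotated])
  qed
  then obtain k where k: "\<forall>b\<in>N v ?a. ennreal (W (v, ?a)) + dl ?a v < ennreal (W (v, b)) + d k b v"
    unfolding eventually_sequentially by blast
  define U where "U = insert v (\<Union>b\<in>{b. adj v b}. branch_ball N k b v)"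
  have "finite U" unfolding U_def using finite_adj finite_branch_ball by blast
  moreover have "U \<subseteq> V" unfolding U_def using v branch_ball_subset adj_in by blast
  ultimately have "eventually (\<lambda>i. U \<subseteq> G i) sequentially"
    by (rule exhaustion_eventually[OF ex])
  then show "eventually (\<lambda>i. v \<in> G i \<and> T i v = F v) sequentially"
  proof eventually_elim
    case (elim i)
    have G: "finite (G i)" "G i \<subseteq> V" using ex by (auto simp: exhaustion_def)
    have vG: "v \<in> G i" using elim by (auto simp: U_def)
    have MSA: "is_MSA adj W (G i) (T i)" using T by blast
    then have tv: "adj v (T i v)" using vG by (auto simp: is_MSA_def spanning_arb_def)
    have "T i v = ?a"
    proof (rule ccontr)
      assume neq: "T i v \<noteq> ?a"
      then have "T i v \<in> N v ?a" using tv by (simp add: nbrs_def)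
      moreover have "ennreal (W (v, T i v)) + d k (T i v) v \<le> ennreal (W (v, ?a)) + dl ?a v"
        using elim tv neq by (intro MSA_exchange[OF G vG MSA _ a]) (auto simp: U_def)
      ultimately show False using k by (auto simp: not_less[symmetric])
    qed
    with vG show ?case by blast
  qed
qed

lemma best_exit_detour_pos:
  assumes "best_exit v a"
  shows "dl a v < dl v a"
proof -
  have a: "adj v a" and fin: "ennreal (W (v, a)) + dl a v < \<top>"
    and min: "\<And>b. b \<in> N v a \<Longrightarrow> ennreal (W (v, a)) + dl a v < ennreal (W (v, b)) + dl b v"
    using assms by (auto simp: best_exit_def nbrs_def)
  define D where "D = (INF y\<in>N v a. ennreal (W (v, y)) + dl y v)"
  have "ennreal (W (v, a)) + dl a v < D"
  proof (cases "N v a = {}")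
    case True
    then show ?thesis using fin by (simp add: D_def)
  next
    case False
    then obtain y where "y \<in> N v a" "ennreal (W (v, y)) + dl y v = D"
      unfolding D_def by (rule INF_attained[OF finite_nbrs])
    then show ?thesis using min by metis
  qed
  then have "dl a v < D - ennreal (W (v, a))"
    by (simp add: less_diff_eq_ennreal add.commute)
  also have "\<dots> = dl v a"
    unfolding D_def by (rule detour_lim_rec[OF finite_nbrs, symmetric])
  finally show ?thesis .
qed

end

section \<open>Components and ends of the limit forest\<close>

locale best_exit_forest = weighted_tree V W for V W +
  fixes F :: "nat list \<Rightarrow> nat list"
  assumes best: "v \<in> V \<Longrightarrow> best_exit v (F v)"
    and no_ray: "\<not> (\<forall>n. p n \<in> V \<and> p (Suc n) \<noteq> [] \<and> tl (p (Suc n)) = p n \<and> 0 < dl (p (Suc n)) (p n))"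
    and unused: "infinite {y \<in> V. y \<noteq> [] \<and> dl y (tl y) = 0 \<and> dl (tl y) y = 0}"
begin

lemma F_adj: "v \<in> V \<Longrightarrow> adj v (F v)"
  using best by (simp add: best_exit_def)

lemma F_in: "v \<in> V \<Longrightarrow> F v \<in> V"
  using F_adj adj_in by blast

lemma funpow_in: "v \<in> V \<Longrightarrow> (F ^^ n) v \<in> V"
  by (induction n) (auto simp: F_in)

lemma F_no_2cycle: "v \<in> V \<Longrightarrow> F (F v) \<noteq> v"
  using best_exit_detour_pos[OF best[of v]] best_exit_detour_pos[OF best[OF F_in, of v]] by fastforce

lemma orbit_inj: "v \<in> V \<Longrightarrow> inj (\<lambda>n. (F ^^ n) v)"
  by (rule nonbacktracking_orbit_inj) (auto simp: F_adj funpow_in F_no_2cycle)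

lemma same_comp_funpow: "same_comp F ((F ^^ n) v) ((F ^^ m) v)"
proof -
  have "(F ^^ m) ((F ^^ n) v) = (F ^^ n) ((F ^^ m) v)"
    by (metis add.commute comp_apply funpow_add)
  then show ?thesis unfolding same_comp_def by blast
qed

lemma same_comp_sym: "same_comp F u v \<Longrightarrow> same_comp F v u"
  unfolding same_comp_def by metis

lemma same_comp_trans:
  assumes "same_comp F u v" "same_comp F v w"
  shows "same_comp F u w"
proof -
  obtain a b c e where 1: "(F ^^ a) u = (F ^^ b) v" and 2: "(F ^^ c) v = (F ^^ e) w"
    using assms unfolding same_comp_def by blast
  have "(F ^^ (c + a)) u = (F ^^ c) ((F ^^ b) v)" using 1 by (simp add: funpow_add)
  also have "\<dots> = (F ^^ b) ((F ^^ c) v)" by (metis add.commute comp_apply funpow_add)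
  also have "\<dots> = (F ^^ (b + e)) w" using 2 by (simp add: funpow_add)
  finally show ?thesis unfolding same_comp_def by blast
qed

lemma infinite_comp:
  assumes "C \<in> arb_components V F"
  shows "infinite C"
proof -
  obtain v where v: "v \<in> V" and C: "C = {u \<in> V. same_comp F v u}"
    using assms by (auto simp: arb_components_def)
  have "range (\<lambda>n. (F ^^ n) v) \<subseteq> C"
    using same_comp_funpow[of 0 v] v by (auto simp: C funpow_in)
  then show ?thesis using range_inj_infinite[OF orbit_inj[OF v]] finite_subset by blast
qed

text \<open>An injective backward orbit never turns back, so it eventually descends. Its edges are
  used upwards by the forest, hence have positive cost at the lower end, against
  \<open>no_ray\<close>.\<close>

lemma no_backward_ray:
  assumes V: "\<And>n. q n \<in> V" and q: "\<And>n. F (q (Suc n)) = q n" and "inj q"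
  shows False
proof -
  have adj: "adj (q n) (q (Suc n))" for n
    using F_adj[OF V[of "Suc n"]] by (simp add: q adj_sym)
  have "q (Suc (Suc n)) \<noteq> q n" for n
    using \<open>inj q\<close> by (simp add: inj_eq)
  with adj obtain K where K: "\<And>n. n \<ge> K \<Longrightarrow> \<exists>i. q (Suc n) = i # q n"
    using nonbacktracking_exits[of q] by blast
  have "\<forall>n. q (K + n) \<in> V \<and> q (K + Suc n) \<noteq> [] \<and> tl (q (K + Suc n)) = q (K + n)
      \<and> 0 < dl (q (K + Suc n)) (q (K + n))"
  proof
    fix n
    have "dl (q (K + n)) (q (K + Suc n)) < dl (q (K + Suc n)) (q (K + n))"
      using best_exit_detour_pos[OF best[OF V[of "K + Suc n"]]] by (simp add: q)
    then have "0 < dl (q (K + Suc n)) (q (K + n))"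
      by (rule le_less_trans[OF zero_le])
    then show "q (K + n) \<in> V \<and> q (K + Suc n) \<noteq> [] \<and> tl (q (K + Suc n)) = q (K + n)
      \<and> 0 < dl (q (K + Suc n)) (q (K + n))"
      using K[of "K + n"] V by auto
  qed
  then show False using no_ray[of "\<lambda>n. q (K + n)"] by blast
qed

text \<open>After one step against \<open>F\<close> the only forward continuation would return to
  the vertex just left, so an injective path keeps going backward and becomes a backward ray. Hence
  every infinite path is the future of its starting point.\<close>

lemma inf_path_forward:
  assumes "C \<in> arb_components V F" and p: "inf_path (comp_edge F C) p"
  shows "p 0 \<in> C" "p n = (F ^^ n) (p 0)"
proof -
  have CV: "C \<subseteq> V" using assms by (auto simp: arb_components_def)
  have step: "(p n \<in> C \<and> p (Suc n) = F (p n)) \<or> (p (Suc n) \<in> C \<and> p n = F (p (Suc n)))" for n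
    using p by (auto simp: inf_path_def comp_edge_def)
  have inj: "inj p" using p by (simp add: inf_path_def)
  have fwd: "p n \<in> C \<and> p (Suc n) = F (p n)" for n
  proof (rule ccontr)
    assume neg: "\<not> ?thesis"
    have bwd: "p (Suc (n + m)) \<in> C \<and> p (n + m) = F (p (Suc (n + m)))" for m
    proof (induction m)
      case 0
      then show ?case using neg step[of n] by auto
    next
      case (Suc m)
      have "p (Suc (Suc (n + m))) \<noteq> p (n + m)" using inj by (simp add: inj_eq)
      with Suc step[of "Suc (n + m)"] show ?case by auto
    qed
    show False
    proof (rule no_backward_ray)
      show "p (Suc (n + m)) \<in> V" for m using bwd CV by blast
      show "F (p (Suc (n + Suc m))) = p (Suc (n + m))" for m using bwd[of "Suc m"] by simp
      show "inj (\<lambda>m. p (Suc (n + m)))" by (rule injI) (use inj in \<open>simp add: inj_eq\<close>)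
    qed
  qed
  show "p 0 \<in> C" using fwd by blast
  show "p n = (F ^^ n) (p 0)" by (induction n) (use fwd in auto)
qed

lemma one_ended_comp:
  assumes C: "C \<in> arb_components V F"
  shows "one_ended F C"
  unfolding one_ended_def
proof (intro conjI allI impI)
  obtain v where v: "v \<in> V" and Cv: "C = {u \<in> V. same_comp F v u}"
    using C by (auto simp: arb_components_def)
  have "inf_path (comp_edge F C) (\<lambda>n. (F ^^ n) v)"
    using same_comp_funpow[of 0 v] v
    by (auto simp: inf_path_def comp_edge_def Cv funpow_in orbit_inj)
  then show "\<exists>p. inf_path (comp_edge F C) p" by blast
  fix p q assume pq: "inf_path (comp_edge F C) p" "inf_path (comp_edge F C) q"
  then have "same_comp F (p 0) (q 0)"
    using inf_path_forward(1)[OF C] same_comp_sym same_comp_trans unfolding Cv by blast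
  then obtain m n where "p m = q n"
    unfolding same_comp_def
    using inf_path_forward(2)[OF C pq(1)] inf_path_forward(2)[OF C pq(2)] by metis
  then show "range p \<inter> range q \<noteq> {}" by auto
qed

lemma infinite_components: "infinite (arb_components V F)"
proof -
  define Y where "Y = {y \<in> V. y \<noteq> [] \<and> dl y (tl y) = 0 \<and> dl (tl y) y = 0}"
  define comp where "comp y = {u \<in> V. same_comp F y u}" for y
  have out: "F y \<noteq> tl y" "F (tl y) \<noteq> y" if "y \<in> Y" for y
    using that best_exit_detour_pos[OF best[of y]] best_exit_detour_pos[OF best[OF tl_in, of y]]
    by (auto simp: Y_def)
  have below: "suffix y ((F ^^ n) y)" if y: "y \<in> Y" for y n
  proof (induction n)
    case (Suc n)
    let ?z = "(F ^^ n) y"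
    have z: "?z \<in> V" using y by (simp add: Y_def funpow_in)
    from F_adj[OF z] show ?case
    proof (cases rule: adj_cases)
      case (1 i)
      then show ?thesis using Suc by (simp add: suffix_Cons)
    next
      case (2 i)
      then have "?z \<noteq> y" using out(1)[OF y] by (metis list.sel(3))
      moreover have "suffix y (i # F ?z)" using Suc 2 by metis
      ultimately show ?thesis using 2 by (metis comp_apply funpow.simps(2) suffix_Cons)
    qed
  qed simp
  have nested: False if y: "y1 \<in> Y" "y2 \<in> Y" "y1 \<noteq> y2" "suffix y1 y2" and s: "same_comp F y1 y2" for y1 y2
  proof -
    obtain m n where "(F ^^ m) y1 = (F ^^ n) y2" using s unfolding same_comp_def by blast
    then have ex: "suffix y2 ((F ^^ m) y1)" using below[OF y(2)] by metis
    have "\<not> suffix y2 ((F ^^ k) y1)" for k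
    proof (induction k)
      case 0
      then show ?case using y(3,4) suffix_order.antisym by auto
    next
      case (Suc k)
      let ?z = "(F ^^ k) y1"
      have z: "?z \<in> V" using y(1) by (simp add: Y_def funpow_in)
      from F_adj[OF z] show ?case
      proof (cases rule: adj_cases)
        case (1 i)
        then have "F ?z \<noteq> y2" using out(2)[OF y(2)] by auto
        then show ?thesis using Suc 1 by (auto simp: suffix_Cons)
      next
        case (2 i)
        then show ?thesis using Suc by (metis funpow.simps(2) comp_apply suffix_ConsI)
      qed
    qed
    with ex show False by blast
  qed
  have sep: "\<not> same_comp F y1 y2" if "y1 \<in> Y" "y2 \<in> Y" "y1 \<noteq> y2" for y1 y2
  proof
    assume s: "same_comp F y1 y2"
    then obtain m n where "(F ^^ m) y1 = (F ^^ n) y2" unfolding same_comp_def by blast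
    \<comment> \<open>A common vertex of the two futures lies below both \<open>y1\<close> and
      \<open>y2\<close>, which are therefore comparable.\<close>
    then have "suffix y1 y2 \<or> suffix y2 y1"
      using below[OF that(1), of m] below[OF that(2), of n] suffix_same_cases by metis
    then show False
      using nested s same_comp_sym[OF s] that by metis
  qed
  have "inj_on comp Y"
  proof (rule inj_onI)
    fix y1 y2 assume y: "y1 \<in> Y" "y2 \<in> Y" "comp y1 = comp y2"
    then have "y2 \<in> comp y1" using same_comp_funpow[of 0 y2 0] by (auto simp: comp_def Y_def)
    then show "y1 = y2" using sep y(1,2) by (auto simp: comp_def)
  qed
  moreover have "infinite Y" using unused by (simp add: Y_def)
  ultimately have "infinite (comp ` Y)" by (simp add: finite_image_iff)
  moreover have "comp ` Y \<subseteq> arb_components V F"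
    by (auto simp: comp_def arb_components_def Y_def)
  ultimately show ?thesis using finite_subset by blast
qed

lemma limit_forest:
  "wired_MSA_limit V adj W F \<and> infinite {C \<in> arb_components V F. infinite C} \<and>
   (\<forall>C \<in> arb_components V F. one_ended F C)"
proof -
  have "{C \<in> arb_components V F. infinite C} = arb_components V F"
    using infinite_comp by blast
  then show ?thesis
    using wired_MSA_limit_best_exit[OF best] infinite_components one_ended_comp by simp
qed

end

section \<open>Independence and exchangeability of branches\<close>

abbreviation exp_law :: "real measure" where
  "exp_law \<equiv> density lborel (\<lambda>x. ennreal (exponential_density 1 x))"

lemma prob_space_exp_law: "prob_space exp_law"
  by (rule prob_space_exponential_density) simp

lemma AE_exp_law_pos: "AE w in exp_law. 0 < w"
proof -
  have "AE x in lborel. x \<noteq> (0::real)" by (rule AE_lborel_singleton)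
  then show ?thesis
    by (subst AE_density) (auto simp: exponential_density_def)
qed

lemma AE_exp_law_neq: "AE w in exp_law. w \<noteq> c"
  using AE_lborel_singleton[of c] by (subst AE_density) auto

lemma AE_exp_law_add_neq:
  assumes "(r :: ennreal) < \<top>"
  shows "AE w in exp_law. ennreal w + r \<noteq> t"
  using AE_exp_law_pos AE_exp_law_neq[of "enn2real (t - r)"]
proof eventually_elim
  case (elim w)
  show ?case
  proof
    assume "ennreal w + r = t"
    then have "t - r = ennreal w" using assms by auto
    then show False using elim by simp
  qed
qed

lemma emeasure_PiM_cylinder:
  assumes M: "\<And>i. prob_space (M i)" "\<And>i. space (M i) = UNIV"
    and J: "finite J" and A: "\<And>i. i \<in> J \<Longrightarrow> A i \<in> sets (M i)"
  shows "emeasure (PiM UNIV M) {x. \<forall>i\<in>J. x i \<in> A i} = (\<Prod>i\<in>J. emeasure (M i) (A i))"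
proof -
  have "{x. \<forall>i\<in>J. x i \<in> A i} = prod_emb UNIV M J (Pi\<^sub>E J A)"
    using M(2) by (auto simp: prod_emb_def PiE_iff extensional_def space_PiM restrict_def)
  then show ?thesis using emeasure_PiM_emb[of UNIV M J A] assms by simp
qed

text \<open>The pair \<open>([], [])\<close> is never an edge of the tree, so its weight is free to
  stand for the edge from the root of a branch to its parent.\<close>

definition shift_edge :: "nat list \<Rightarrow> nat list \<times> nat list \<Rightarrow> nat list \<times> nat list" where
  "shift_edge v e = (if e = ([], []) then (v, tl v) else (fst e @ v, snd e @ v))"

type_synonym config = "(nat list \<Rightarrow> nat) \<times> (nat list \<times> nat list \<Rightarrow> real)"

definition shift :: "nat list \<Rightarrow> config \<Rightarrow> config" where
  "shift v \<omega> = (\<lambda>u. fst \<omega> (u @ v), \<lambda>e. snd \<omega> (shift_edge v e))"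

lemma inj_shift_edge: "inj (shift_edge v)"
proof (rule injI)
  fix e f assume eq: "shift_edge v e = shift_edge v f"
  \<comment> \<open>The two clauses can only collide for \<open>v = []\<close>, and then only at the
    pair itself.\<close>
  have "x = ([], [])" if "(fst x @ v, snd x @ v) = (v, tl v)" for x
  proof -
    have "length (snd x) + length v = length v - 1"
      using that by (metis length_append length_tl snd_conv)
    then have "v = []" "snd x = []" by (cases v; simp)+
    then show ?thesis using that by (auto simp: prod_eq_iff)
  qed
  from this[of e] this[of f] eq show "e = f"
    by (auto simp: shift_edge_def prod_eq_iff split: if_splits)
qed

text \<open>Offspring numbers and weights form one real-valued family over a sum type, so that
  disjoint index sets give independent functionals whatever mixture of the two they read. The floor
  in \<open>decode\<close> recovers the natural numbers.\<close>

fun coord :: "nat list + nat list \<times> nat list \<Rightarrow> config \<Rightarrow> real" where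
  "coord (Inl v) \<omega> = real (fst \<omega> v)"
| "coord (Inr e) \<omega> = snd \<omega> e"

definition subtree_coords :: "nat list \<Rightarrow> (nat list + nat list \<times> nat list) set" where
  "subtree_coords v = Inl ` range (\<lambda>u. u @ v) \<union> Inr ` range (shift_edge v)"

definition decode :: "nat list \<Rightarrow> (nat list + nat list \<times> nat list \<Rightarrow> real) \<Rightarrow> config" where
  "decode v y = (\<lambda>u. nat \<lfloor>y (Inl (u @ v))\<rfloor>, \<lambda>e. y (Inr (shift_edge v e)))"

lemma decode_coord: "subtree_coords v \<subseteq> K \<Longrightarrow> decode v (restrict (\<lambda>i. coord i \<omega>) K) = shift v \<omega>"
  by (auto simp: decode_def shift_def subtree_coords_def fun_eq_iff image_subset_iff)

section \<open>Independence of disjoint blocks of coordinates\<close>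

locale gw_base =
  fixes \<mu> :: "nat pmf"
begin

abbreviation "base \<equiv> base_space \<mu>"
abbreviation "offspring_space \<equiv> PiM UNIV (\<lambda>_::nat list. measure_pmf \<mu>)"
abbreviation "weight_space \<equiv> PiM UNIV (\<lambda>_::nat list \<times> nat list. exp_law)"

sublocale exp: prob_space exp_law by (rule prob_space_exp_law)
sublocale offspring: prob_space offspring_space
  by (intro prob_space_PiM measure_pmf.prob_space_axioms)
sublocale weight: prob_space weight_space
  by (intro prob_space_PiM prob_space_exp_law)
sublocale pair_prob_space offspring_space weight_space ..
sublocale base: prob_space base
  unfolding base_space_def by (rule prob_space_axioms)

lemma space_base [simp]: "space base = UNIV"
  by (auto simp: base_space_def space_pair_measure space_PiM PiE_def)

lemma sets_base: "sets base = sets (PiM UNIV (\<lambda>_::nat list. count_space (UNIV :: nat set)) \<Otimes>\<^sub>M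
    PiM UNIV (\<lambda>_::nat list \<times> nat list. (borel :: real measure)))"
  unfolding base_space_def
  by (intro sets_pair_measure_cong sets_PiM_cong) auto

lemma measurable_offspring [measurable]: "(\<lambda>\<omega>. fst \<omega> v) \<in> measurable base (count_space UNIV)"
  by (subst measurable_cong_sets[OF sets_base refl]) simp

lemma measurable_weight [measurable]: "(\<lambda>\<omega>. snd \<omega> e) \<in> borel_measurable base"
  by (subst measurable_cong_sets[OF sets_base refl]) simp

lemma measurable_into_base:
  assumes "\<And>v. (\<lambda>x. fst (f x) v) \<in> measurable M (count_space UNIV)"
    and "\<And>e. (\<lambda>x. snd (f x) e) \<in> borel_measurable M"
  shows "f \<in> measurable M base"
proof -
  have "(\<lambda>x. (fst (f x), snd (f x))) \<in> measurable M base"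
    unfolding measurable_cong_sets[OF refl sets_base]
    by (intro measurable_Pair measurable_PiM_single' assms) auto
  then show ?thesis by simp
qed

lemma distr_offspring: "distr base (measure_pmf \<mu>) (\<lambda>\<omega>. fst \<omega> v) = measure_pmf \<mu>"
proof -
  have "distr base (measure_pmf \<mu>) (\<lambda>\<omega>. fst \<omega> v)
      = distr (distr base offspring_space fst) (measure_pmf \<mu>) (\<lambda>Z. Z v)"
    by (subst distr_distr) (auto simp: base_space_def comp_def)
  also have "distr base offspring_space fst = offspring_space"
    unfolding base_space_def by (rule weight.distr_pair_fst)
  also have "distr offspring_space (measure_pmf \<mu>) (\<lambda>Z. Z v) = measure_pmf \<mu>"
    by (rule distr_PiM_component) (auto intro: measure_pmf.prob_space_axioms)
  finally show ?thesis .
qed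

lemma distr_weight: "distr base exp_law (\<lambda>\<omega>. snd \<omega> e) = exp_law"
proof -
  have "distr base exp_law (\<lambda>\<omega>. snd \<omega> e) = distr (distr base weight_space snd) exp_law (\<lambda>W. W e)"
    by (subst distr_distr) (auto simp: base_space_def comp_def)
  also have "distr base weight_space snd = weight_space"
  proof (rule measure_eqI)
    fix A assume "A \<in> sets (distr base weight_space snd)"
    then have A: "A \<in> sets weight_space" by simp
    have "emeasure (distr base weight_space snd) A =
        emeasure (offspring_space \<Otimes>\<^sub>M weight_space) (snd -` A \<inter> space (offspring_space \<Otimes>\<^sub>M weight_space))"
      unfolding base_space_def using A by (intro emeasure_distr) auto
    also have "snd -` A \<inter> space (offspring_space \<Otimes>\<^sub>M weight_space) = space offspring_space \<times> A"
      using sets.sets_into_space[OF A] by (auto simp: space_pair_measure)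
    finally show "emeasure (distr base weight_space snd) A = emeasure weight_space A"
      using A by (simp add: weight.emeasure_pair_measure_Times offspring.emeasure_space_1)
  qed simp
  also have "distr weight_space exp_law (\<lambda>W. W e) = exp_law"
    by (rule distr_PiM_component) (auto intro: prob_space_exp_law)
  finally show ?thesis .
qed

lemma measurable_shift [measurable]: "shift v \<in> measurable base base"
  by (rule measurable_into_base) (simp_all add: shift_def)

text \<open>Reindexing a product of identical laws along an injection preserves it. Hence the branch
  at any label has the law of the whole configuration.\<close>

lemma distr_shift: "distr base base (shift v) = base"
proof -
  have 1: "distr offspring_space offspring_space (\<lambda>Z u. Z (u @ v)) = offspring_space"
    using distr_PiM_reindex[of UNIV "\<lambda>_. measure_pmf \<mu>" "\<lambda>u. u @ v" UNIV]
    by (simp add: measure_pmf.prob_space_axioms inj_def restrict_UNIV)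
  have 2: "distr weight_space weight_space (\<lambda>W e. W (shift_edge v e)) = weight_space"
    using distr_PiM_reindex[of UNIV "\<lambda>_. exp_law" "shift_edge v" UNIV]
    by (simp add: prob_space_exp_law inj_shift_edge restrict_UNIV)
  have "offspring_space \<Otimes>\<^sub>M weight_space =
      distr offspring_space offspring_space (\<lambda>Z u. Z (u @ v)) \<Otimes>\<^sub>M
      distr weight_space weight_space (\<lambda>W e. W (shift_edge v e))"
    by (simp only: 1 2)
  also have "\<dots> = distr (offspring_space \<Otimes>\<^sub>M weight_space) (offspring_space \<Otimes>\<^sub>M weight_space)
      (\<lambda>(Z, W). (\<lambda>u. Z (u @ v), \<lambda>e. W (shift_edge v e)))"
  proof (rule pair_measure_distr)
    show "sigma_finite_measure (distr weight_space weight_space (\<lambda>W e. W (shift_edge v e)))"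
      unfolding 2 by (rule weight.sigma_finite_measure_axioms)
  qed (auto intro!: measurable_PiM_single')
  finally have "distr (offspring_space \<Otimes>\<^sub>M weight_space) (offspring_space \<Otimes>\<^sub>M weight_space)
      (\<lambda>(Z, W). (\<lambda>u. Z (u @ v), \<lambda>e. W (shift_edge v e))) = offspring_space \<Otimes>\<^sub>M weight_space" ..
  moreover have "(\<lambda>(Z, W). (\<lambda>u. Z (u @ v), \<lambda>e. W (shift_edge v e))) = shift v"
    by (auto simp: shift_def fun_eq_iff)
  ultimately show ?thesis unfolding base_space_def by simp
qed

lemma measurable_coord [measurable]: "coord i \<in> borel_measurable base"
proof (cases i)
  case (Inl v)
  have "(\<lambda>\<omega>. real (fst \<omega> v)) \<in> borel_measurable base" by measurable
  then show ?thesis using Inl by (simp add: fun_eq_iff cong: measurable_cong)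
next
  case (Inr e)
  have "(\<lambda>\<omega>. snd \<omega> e) \<in> borel_measurable base" by measurable
  then show ?thesis using Inr by (simp add: fun_eq_iff cong: measurable_cong)
qed

text \<open>A finite cylinder over the sum type splits into an offspring cylinder and a weight
  cylinder, and each has product measure.\<close>

lemma indep_coord: "base.indep_vars (\<lambda>_. borel) coord UNIV"
proof -
  have cyl: "emeasure base {\<omega>. \<forall>j\<in>J. coord j \<omega> \<in> B j} =
      (\<Prod>v\<in>Inl -` J. emeasure (measure_pmf \<mu>) {n. real n \<in> B (Inl v)}) *
      (\<Prod>e\<in>Inr -` J. emeasure exp_law (B (Inr e)))"
    if J: "finite J" and B: "\<And>j. j \<in> J \<Longrightarrow> B j \<in> sets borel" for J and B :: "_ \<Rightarrow> real set"
  proof -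
    let ?Z = "{Z. \<forall>v\<in>Inl -` J. Z v \<in> {n. real n \<in> B (Inl v)}}"
    let ?W = "{W. \<forall>e\<in>Inr -` J. W e \<in> B (Inr e)}"
    have fin: "finite (Inl -` J)" "finite (Inr -` J)"
      using J by (auto intro: finite_vimageI)
    have "(\<forall>j\<in>J. coord j \<omega> \<in> B j) \<longleftrightarrow> fst \<omega> \<in> ?Z \<and> snd \<omega> \<in> ?W"
      for \<omega> :: config
    proof
      assume *: "fst \<omega> \<in> ?Z \<and> snd \<omega> \<in> ?W"
      show "\<forall>j\<in>J. coord j \<omega> \<in> B j"
      proof
        fix j assume "j \<in> J"
        with * show "coord j \<omega> \<in> B j" by (cases j) auto
      qed
    next
      assume *: "\<forall>j\<in>J. coord j \<omega> \<in> B j"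
      have "real (fst \<omega> v) \<in> B (Inl v)" if "Inl v \<in> J" for v
        using bspec[OF * that] by simp
      moreover have "snd \<omega> e \<in> B (Inr e)" if "Inr e \<in> J" for e
        using bspec[OF * that] by simp
      ultimately show "fst \<omega> \<in> ?Z \<and> snd \<omega> \<in> ?W" by auto
    qed
    then have "{\<omega>. \<forall>j\<in>J. coord j \<omega> \<in> B j} = ?Z \<times> ?W" by auto
    moreover have "?Z \<in> sets offspring_space"
    proof -
      have "{Z \<in> space offspring_space. \<forall>v\<in>Inl -` J. Z v \<in> {n. real n \<in> B (Inl v)}} \<in> sets offspring_space"
        using fin(1) by measurable
      then show ?thesis by (simp add: space_PiM)
    qed
    moreover have "?W \<in> sets weight_space"
    proof -
      have "{W \<in> space weight_space. \<forall>e\<in>Inr -` J. W e \<in> B (Inr e)} \<in> sets weight_space"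
        using fin(2) B by (intro sets.sets_Collect_finite_All) (auto intro!: measurable_sets_Collect[OF measurable_component_singleton])
      then show ?thesis by (simp add: space_PiM)
    qed
    ultimately have "emeasure base {\<omega>. \<forall>j\<in>J. coord j \<omega> \<in> B j} =
        emeasure offspring_space ?Z * emeasure weight_space ?W"
      by (simp add: base_space_def weight.emeasure_pair_measure_Times)
    also have "emeasure offspring_space ?Z = (\<Prod>v\<in>Inl -` J. emeasure (measure_pmf \<mu>) {n. real n \<in> B (Inl v)})"
      by (rule emeasure_PiM_cylinder) (auto simp: fin intro: measure_pmf.prob_space_axioms)
    also have "emeasure weight_space ?W = (\<Prod>e\<in>Inr -` J. emeasure exp_law (B (Inr e)))"
      by (rule emeasure_PiM_cylinder) (auto simp: fin B intro: prob_space_exp_law)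
    finally show ?thesis .
  qed
  show ?thesis
    unfolding base.indep_vars_def2 base.indep_sets_def
  proof (intro conjI ballI allI impI)
    fix J :: "(nat list + nat list \<times> nat list) set" and A
    assume J: "J \<subseteq> UNIV" "J \<noteq> {}" "finite J"
      and "A \<in> Pi J (\<lambda>i. {coord i -` B \<inter> space base |B. B \<in> sets borel})"
    then have "\<forall>j\<in>J. \<exists>B. A j = coord j -` B \<and> B \<in> sets borel" by auto
    then obtain B where B: "\<And>j. j \<in> J \<Longrightarrow> A j = coord j -` B j" "\<And>j. j \<in> J \<Longrightarrow> B j \<in> sets borel"
      by metis
    define f where "f j = (case j of Inl v \<Rightarrow> emeasure (measure_pmf \<mu>) {n. real n \<in> B (Inl v)}
      | Inr e \<Rightarrow> emeasure exp_law (B (Inr e)))" for j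
    have split: "(\<Prod>v\<in>Inl -` I. f (Inl v)) * (\<Prod>e\<in>Inr -` I. f (Inr e)) = (\<Prod>j\<in>I. f j)"
      if I: "I \<subseteq> J" for I
    proof -
      have "finite I" using I J(3) finite_subset by blast
      have I_eq: "I = Inl ` (Inl -` I) \<union> Inr ` (Inr -` I)"
      proof (intro set_eqI iffI)
        fix j assume "j \<in> I"
        then show "j \<in> Inl ` (Inl -` I) \<union> Inr ` (Inr -` I)" by (cases j) auto
      qed auto
      have "(\<Prod>j\<in>I. f j) = (\<Prod>j\<in>Inl ` (Inl -` I). f j) * (\<Prod>j\<in>Inr ` (Inr -` I). f j)"
        by (subst (1) I_eq, rule prod.union_disjoint) (use \<open>finite I\<close> in \<open>auto intro: finite_vimageI\<close>)
      moreover have "(\<Prod>j\<in>Inl ` (Inl -` I). f j) = (\<Prod>v\<in>Inl -` I. f (Inl v))"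
        by (subst prod.reindex) (auto simp: comp_def)
      moreover have "(\<Prod>j\<in>Inr ` (Inr -` I). f j) = (\<Prod>e\<in>Inr -` I. f (Inr e))"
        by (subst prod.reindex) (auto simp: comp_def)
      ultimately show ?thesis by metis
    qed
    have em: "emeasure base {\<omega>. \<forall>j\<in>I. coord j \<omega> \<in> B j} = (\<Prod>j\<in>I. f j)" if "I \<subseteq> J" for I
      using cyl[of I B] B(2) that finite_subset[OF that J(3)] split[OF that] by (auto simp: f_def)
    have "emeasure base (\<Inter>j\<in>J. A j) = (\<Prod>j\<in>J. emeasure base (A j))"
    proof -
      have "(\<Inter>j\<in>J. A j) = {\<omega>. \<forall>j\<in>J. coord j \<omega> \<in> B j}" using B by auto
      moreover have "emeasure base (A j) = f j" if "j \<in> J" for j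
        using em[of "{j}"] B(1)[OF that] that by (simp add: vimage_def)
      ultimately show ?thesis using em[of J] by simp
    qed
    then show "base.prob (\<Inter>j\<in>J. A j) = (\<Prod>j\<in>J. base.prob (A j))"
      by (simp add: base.emeasure_eq_measure prod_ennreal prod_nonneg)
  qed (use measurable_sets[OF measurable_coord] in \<open>auto simp del: coord.simps\<close>)
qed

lemma distr_restrict_pair:
  assumes "A \<inter> B = {}"
    and f: "f \<in> measurable (PiM A (\<lambda>_. borel)) S" and g: "g \<in> measurable (PiM B (\<lambda>_. borel)) T"
  shows "distr base (S \<Otimes>\<^sub>M T) (\<lambda>\<omega>. (f (\<lambda>i\<in>A. coord i \<omega>), g (\<lambda>i\<in>B. coord i \<omega>))) =
    distr base S (\<lambda>\<omega>. f (\<lambda>i\<in>A. coord i \<omega>)) \<Otimes>\<^sub>M distr base T (\<lambda>\<omega>. g (\<lambda>i\<in>B. coord i \<omega>))"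
proof -
  let ?A = "PiM A (\<lambda>_. borel :: real measure)" and ?B = "PiM B (\<lambda>_. borel :: real measure)"
  have [measurable]: "(\<lambda>\<omega>. \<lambda>i\<in>A. coord i \<omega>) \<in> measurable base ?A"
    "(\<lambda>\<omega>. \<lambda>i\<in>B. coord i \<omega>) \<in> measurable base ?B"
    by (intro measurable_restrict measurable_coord)+
  note [measurable] = f g
  have "base.indep_var ?A (\<lambda>\<omega>. \<lambda>i\<in>A. coord i \<omega>) ?B (\<lambda>\<omega>. \<lambda>i\<in>B. coord i \<omega>)"
    using base.indep_var_restrict[OF indep_coord assms(1)] by simp
  then have eq: "distr base ?A (\<lambda>\<omega>. \<lambda>i\<in>A. coord i \<omega>) \<Otimes>\<^sub>M distr base ?B (\<lambda>\<omega>. \<lambda>i\<in>B. coord i \<omega>) =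
      distr base (?A \<Otimes>\<^sub>M ?B) (\<lambda>\<omega>. (\<lambda>i\<in>A. coord i \<omega>, \<lambda>i\<in>B. coord i \<omega>))"
    by (simp add: base.indep_var_distribution_eq)
  have "distr base S (\<lambda>\<omega>. f (\<lambda>i\<in>A. coord i \<omega>)) \<Otimes>\<^sub>M distr base T (\<lambda>\<omega>. g (\<lambda>i\<in>B. coord i \<omega>)) =
      distr (distr base ?A (\<lambda>\<omega>. \<lambda>i\<in>A. coord i \<omega>)) S f \<Otimes>\<^sub>M distr (distr base ?B (\<lambda>\<omega>. \<lambda>i\<in>B. coord i \<omega>)) T g"
    by (simp add: distr_distr comp_def)
  also have "\<dots> = distr (distr base ?A (\<lambda>\<omega>. \<lambda>i\<in>A. coord i \<omega>) \<Otimes>\<^sub>M distr base ?B (\<lambda>\<omega>. \<lambda>i\<in>B. coord i \<omega>))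
      (S \<Otimes>\<^sub>M T) (\<lambda>(x, y). (f x, g y))"
  proof (rule pair_measure_distr)
    have "prob_space (distr (distr base ?B (\<lambda>\<omega>. \<lambda>i\<in>B. coord i \<omega>)) T g)"
      by (intro prob_space.prob_space_distr base.prob_space_distr) simp_all
    then show "sigma_finite_measure (distr (distr base ?B (\<lambda>\<omega>. \<lambda>i\<in>B. coord i \<omega>)) T g)"
      by (intro finite_measure.sigma_finite_measure) (simp add: prob_space.finite_measure)
  qed simp_all
  also have "\<dots> = distr base (S \<Otimes>\<^sub>M T) (\<lambda>\<omega>. (f (\<lambda>i\<in>A. coord i \<omega>), g (\<lambda>i\<in>B. coord i \<omega>)))"
    unfolding eq by (subst distr_distr) (auto simp: comp_def)
  finally show ?thesis by simp
qed

lemma measurable_decode: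
  assumes "subtree_coords v \<subseteq> K"
  shows "decode v \<in> measurable (PiM K (\<lambda>_. borel)) base"
proof (rule measurable_into_base)
  have K: "Inl (u @ v) \<in> K" "Inr (shift_edge v e) \<in> K" for u e
    using assms by (auto simp: subtree_coords_def)
  have "(\<lambda>r::real. nat \<lfloor>r\<rfloor>) \<in> measurable borel (count_space UNIV)" by measurable
  from measurable_compose[OF measurable_component_singleton[OF K(1)] this]
  show "(\<lambda>x. fst (decode v x) u) \<in> measurable (PiM K (\<lambda>_. borel)) (count_space UNIV)" for u
    by (simp add: decode_def)
  show "(\<lambda>x. snd (decode v x) e) \<in> borel_measurable (PiM K (\<lambda>_. borel))" for e
    using measurable_component_singleton[OF K(2)] by (simp add: decode_def)
qed

abbreviation "unit_law \<equiv> base \<Otimes>\<^sub>M exp_law"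
abbreviation "units_law \<equiv> PiM UNIV (\<lambda>_::nat. base \<Otimes>\<^sub>M exp_law)"

sublocale units: pair_prob_space base exp_law ..

lemma distr_unit:
  assumes "Inr e \<notin> subtree_coords b"
  shows "distr base unit_law (\<lambda>\<omega>. (shift b \<omega>, snd \<omega> e)) = unit_law"
proof -
  have "distr base unit_law (\<lambda>\<omega>. (decode b (\<lambda>i\<in>subtree_coords b. coord i \<omega>), (\<lambda>i\<in>{Inr e}. coord i \<omega>) (Inr e)))
      = distr base base (\<lambda>\<omega>. decode b (\<lambda>i\<in>subtree_coords b. coord i \<omega>)) \<Otimes>\<^sub>M
        distr base exp_law (\<lambda>\<omega>. (\<lambda>i\<in>{Inr e}. coord i \<omega>) (Inr e))"
    using assms by (intro distr_restrict_pair measurable_decode) auto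
  then show ?thesis
    by (simp add: decode_coord distr_shift distr_weight)
qed

text \<open>A unit is a branch together with the weight of an edge leading into it. Infinitely many
  are provided, so that a random number of them can be used, governed by the independent offspring
  number at \<open>s\<close>.\<close>

lemma distr_units:
  fixes b :: "nat \<Rightarrow> nat list" and e :: "nat \<Rightarrow> nat list \<times> nat list"
  assumes disj: "disjoint_family (\<lambda>j. insert (Inr (e j)) (subtree_coords (b j)))"
    and e: "\<And>j. Inr (e j) \<notin> subtree_coords (b j)" and s: "\<And>j. Inl s \<notin> subtree_coords (b j)"
  shows "distr base (measure_pmf \<mu> \<Otimes>\<^sub>M units_law) (\<lambda>\<omega>. (fst \<omega> s, \<lambda>j. (shift (b j) \<omega>, snd \<omega> (e j))))
    = measure_pmf \<mu> \<Otimes>\<^sub>M units_law"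
proof -
  let ?K = "\<lambda>j. insert (Inr (e j)) (subtree_coords (b j))"
  have g: "(\<lambda>y. (decode (b j) y, y (Inr (e j)))) \<in> measurable (PiM K (\<lambda>_. borel)) unit_law"
    if "?K j \<subseteq> K" for j K
    using that by (intro measurable_Pair measurable_decode) (auto intro: measurable_component_singleton)
  have "base.indep_vars (\<lambda>j. PiM (?K j) (\<lambda>_. borel)) (\<lambda>j \<omega>. \<lambda>i\<in>?K j. coord i \<omega>) UNIV"
    by (rule base.indep_vars_restrict[OF indep_coord]) (use disj in auto)
  then have "base.indep_vars (\<lambda>_. unit_law)
      (\<lambda>j \<omega>. (\<lambda>y. (decode (b j) y, y (Inr (e j)))) (\<lambda>i\<in>?K j. coord i \<omega>)) UNIV"
    by (rule base.indep_vars_compose2) (rule g, simp)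
  moreover have "(\<lambda>y. (decode (b j) y, y (Inr (e j)))) (\<lambda>i\<in>?K j. coord i \<omega>) = (shift (b j) \<omega>, snd \<omega> (e j))"
    for j \<omega>
    using decode_coord[of "b j" "?K j" \<omega>] by auto
  ultimately have ind: "base.indep_vars (\<lambda>_. unit_law) (\<lambda>j \<omega>. (shift (b j) \<omega>, snd \<omega> (e j))) UNIV"
    by simp
  have "distr base units_law (\<lambda>\<omega>. \<lambda>j\<in>UNIV. (shift (b j) \<omega>, snd \<omega> (e j)))
      = (PiM UNIV (\<lambda>j. distr base unit_law (\<lambda>\<omega>. (shift (b j) \<omega>, snd \<omega> (e j)))))"
  proof (rule iffD1[OF base.indep_vars_iff_distr_eq_PiM ind])
    show "(\<lambda>\<omega>. (shift (b i) \<omega>, snd \<omega> (e i))) \<in> measurable base unit_law" for i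
      by (intro measurable_Pair measurable_shift) simp
  qed simp
  then have units: "distr base units_law (\<lambda>\<omega> j. (shift (b j) \<omega>, snd \<omega> (e j))) = units_law"
    by (simp add: distr_unit[OF e] restrict_UNIV)
  let ?B = "\<Union>j. ?K j"
  let ?g = "\<lambda>y j. (decode (b j) y, y (Inr (e j)))"
  have [measurable]: "?g \<in> measurable (PiM ?B (\<lambda>_. borel)) units_law"
    by (rule measurable_PiM_single') (auto simp: space_pair_measure intro: g)
  have dist: "distr base (measure_pmf \<mu> \<Otimes>\<^sub>M units_law)
      (\<lambda>\<omega>. (nat \<lfloor>(\<lambda>i\<in>{Inl s}. coord i \<omega>) (Inl s)\<rfloor>, ?g (\<lambda>i\<in>?B. coord i \<omega>)))
    = distr base (measure_pmf \<mu>) (\<lambda>\<omega>. nat \<lfloor>(\<lambda>i\<in>{Inl s}. coord i \<omega>) (Inl s)\<rfloor>)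
      \<Otimes>\<^sub>M distr base units_law (\<lambda>\<omega>. ?g (\<lambda>i\<in>?B. coord i \<omega>))"
  proof (rule distr_restrict_pair)
    have "(\<lambda>y. y (Inl s)) \<in> measurable
        (PiM {Inl s :: nat list + nat list \<times> nat list} (\<lambda>_. borel :: real measure)) borel"
      by (rule measurable_component_singleton) simp
    moreover have "(\<lambda>r::real. nat \<lfloor>r\<rfloor>) \<in> measurable borel (measure_pmf \<mu>)" by simp
    ultimately show "(\<lambda>y. nat \<lfloor>y (Inl s)\<rfloor>) \<in> measurable
        (PiM {Inl s :: nat list + nat list \<times> nat list} (\<lambda>_. borel :: real measure)) (measure_pmf \<mu>)"
      by (rule measurable_compose)
  qed (use s in auto)
  have gB: "?g (\<lambda>i\<in>?B. coord i \<omega>) = (\<lambda>j. (shift (b j) \<omega>, snd \<omega> (e j)))" for \<omega>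
  proof
    fix j
    show "?g (\<lambda>i\<in>?B. coord i \<omega>) j = (shift (b j) \<omega>, snd \<omega> (e j))"
      using decode_coord[of "b j" ?B \<omega>] by auto
  qed
  from dist show ?thesis
    unfolding gB by (simp add: units distr_offspring)
qed

lemma subtree_coords_suffix:
  "Inl u \<in> subtree_coords v \<Longrightarrow> suffix v u" "Inr e \<in> subtree_coords v \<Longrightarrow> suffix v (fst e)"
  by (auto simp: subtree_coords_def suffix_def shift_edge_def split: if_splits)

text \<open>Unit \<open>0\<close> is the edge from \<open>[s]\<close> to the root followed by the branch of the sibling \<open>[t]\<close>, unit \<open>i + 1\<close> the edge
  from \<open>[s]\<close> to its \<open>i\<close>-th child followed by the branch of that child.  Joining the branches \<open>[s]\<close> and \<open>[t]\<close>
  directly in this way gives \<open>[s]\<close> a number \<open>Z + 1\<close> of exchangeable neighbours.\<close>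
definition unit_root :: "nat \<Rightarrow> nat \<Rightarrow> nat \<Rightarrow> nat list" where
  "unit_root s t j = (case j of 0 \<Rightarrow> [t] | Suc i \<Rightarrow> [i, s])"

definition unit_edge :: "nat \<Rightarrow> nat \<Rightarrow> nat list \<times> nat list" where
  "unit_edge s j = (case j of 0 \<Rightarrow> ([s], []) | Suc i \<Rightarrow> ([s], [i, s]))"

text \<open>The branch roots are pairwise incomparable labels and \<open>[s]\<close> lies in none of
  the branches, while all unit edges start at \<open>[s]\<close>; so the coordinate sets are
  disjoint.\<close>

lemma distr_neighbourhood:
  assumes "s \<noteq> t"
  shows "distr base (measure_pmf \<mu> \<Otimes>\<^sub>M units_law)
      (\<lambda>\<omega>. (fst \<omega> [s], \<lambda>j. (shift (unit_root s t j) \<omega>, snd \<omega> (unit_edge s j)))) = measure_pmf \<mu> \<Otimes>\<^sub>M units_law"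
proof (rule distr_units)
  have root: "\<not> suffix (unit_root s t j) [s]" for j
    using assms by (auto simp: unit_root_def suffix_def split: nat.splits)
  have edge: "fst (unit_edge s j) = [s]" for j
    by (simp add: unit_edge_def split: nat.splits)
  show "Inr (unit_edge s j) \<notin> subtree_coords (unit_root s t j)" for j
    using root edge subtree_coords_suffix(2) by metis
  show "Inl [s] \<notin> subtree_coords (unit_root s t j)" for j
    using root subtree_coords_suffix(1) by metis
  show "disjoint_family (\<lambda>j. insert (Inr (unit_edge s j)) (subtree_coords (unit_root s t j)))"
    unfolding disjoint_family_on_def
  proof (intro ballI impI)
    fix i j :: nat assume ij: "i \<noteq> j"
    have incomp: "\<not> (suffix (unit_root s t i) u \<and> suffix (unit_root s t j) u)" for u
      using ij assms by (auto simp: unit_root_def suffix_def split: nat.splits)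
    have "x \<notin> subtree_coords (unit_root s t i) \<or> x \<notin> subtree_coords (unit_root s t j)" for x
      using incomp subtree_coords_suffix by (cases x) metis+
    moreover have "unit_edge s i \<noteq> unit_edge s j"
      using ij by (auto simp: unit_edge_def split: nat.splits)
    moreover have "Inr (unit_edge s i) \<notin> subtree_coords (unit_root s t j)" for i j
      using root edge subtree_coords_suffix(2) by metis
    ultimately show "insert (Inr (unit_edge s i)) (subtree_coords (unit_root s t i)) \<inter>
        insert (Inr (unit_edge s j)) (subtree_coords (unit_root s t j)) = {}"
      by auto
  qed
qed

end

text \<open>Fubini with all coordinates but \<open>i\<close> frozen. It shows that ties are null by
  resampling a single coordinate.\<close>

lemma AE_PiM_fun_upd:
  fixes M :: "'i \<Rightarrow> 'a measure"
  assumes M: "\<And>i. prob_space (M i)"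
    and Q: "{x \<in> space (PiM UNIV M). Q x} \<in> sets (PiM UNIV M)"
    and AE: "\<And>X. AE w in M i. Q (X(i := w))"
  shows "AE x in PiM UNIV M. Q x"
proof -
  let ?R = "PiM (UNIV - {i}) M"
  interpret M: prob_space "M i" by (rule M)
  interpret R: prob_space ?R by (intro prob_space_PiM M)
  interpret pair_sigma_finite "M i" ?R ..
  have eq: "distr (M i \<Otimes>\<^sub>M ?R) (PiM UNIV M) (\<lambda>(w, X). X(i := w)) = PiM UNIV M"
    using distr_pair_PiM_eq_PiM[of "UNIV - {i}" M i] M by (simp add: insert_absorb)
  have upd: "(\<lambda>(w, X). X(i := w)) \<in> measurable (M i \<Otimes>\<^sub>M ?R) (PiM UNIV M)"
  proof -
    have "(\<lambda>z. (\<lambda>(f, y). f(i := y)) (case z of (w, X) \<Rightarrow> (X, w))) \<in> measurable (M i \<Otimes>\<^sub>M ?R) (PiM (insert i (UNIV - {i})) M)"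
      by (rule measurable_compose[OF measurable_pair_swap' measurable_add_dim])
    then show ?thesis by (simp add: insert_absorb case_prod_beta')
  qed
  have "AE z in M i \<Otimes>\<^sub>M ?R. Q ((snd z)(i := fst z))"
  proof (subst AE_pair_iff[symmetric])
    have "{z \<in> space (M i \<Otimes>\<^sub>M ?R). Q ((\<lambda>(w, X). X(i := w)) z)} \<in> sets (M i \<Otimes>\<^sub>M ?R)"
      by (rule measurable_sets_Collect[OF upd Q])
    then show S: "{z \<in> space (M i \<Otimes>\<^sub>M ?R). Q ((snd z)(i := fst z))} \<in> sets (M i \<Otimes>\<^sub>M ?R)"
      by (simp add: case_prod_beta)
    show "AE w in M i. AE X in ?R. Q (X(i := w))"
      by (subst AE_commute) (use S AE in auto)
  qed
  then show ?thesis
    by (subst eq[symmetric], subst AE_distr_iff[OF upd Q]) (simp add: case_prod_beta)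
qed

text \<open>Ties are null, so almost surely exactly one index of \<open>J\<close> is the minimiser.
  Transposing coordinates makes all indices equally likely, also on the symmetric event that every
  \<open>x i\<close> lies in \<open>B\<close>.\<close>

lemma measure_strict_min:
  fixes f :: "'a \<Rightarrow> ennreal" and L :: "'a measure"
  assumes L: "prob_space L" "space L = UNIV" and f [measurable]: "f \<in> borel_measurable L"
    and B [measurable]: "B \<in> sets L" and atomless: "\<And>t. AE x in L. f x \<noteq> t"
    and J: "finite J" "j \<in> J"
  shows "measure (PiM UNIV (\<lambda>_::nat. L)) {x. \<forall>i\<in>J. x i \<in> B \<and> (i \<noteq> j \<longrightarrow> f (x j) < f (x i))} =
      measure L B ^ card J / card J"
    "measure (PiM UNIV (\<lambda>_::nat. L)) {x. \<forall>i\<in>J. x i \<in> B \<and> (i \<noteq> j \<longrightarrow> f (x j) \<le> f (x i))} =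
      measure L B ^ card J / card J"
proof -
  let ?P = "PiM UNIV (\<lambda>_::nat. L)"
  interpret L: prob_space L by (rule L)
  interpret P: prob_space ?P by (intro prob_space_PiM L)
  have spP: "space ?P = UNIV" using L(2) by (simp add: space_PiM)
  define A where "A j = {x. \<forall>i\<in>J. x i \<in> B \<and> (i \<noteq> j \<longrightarrow> f (x j) < f (x i))}" for j
  define A' where "A' j = {x. \<forall>i\<in>J. x i \<in> B \<and> (i \<noteq> j \<longrightarrow> f (x j) \<le> f (x i))}" for j
  have A: "A j \<in> sets ?P" for j
  proof -
    have "{x \<in> space ?P. \<forall>i\<in>J. x i \<in> B \<and> (i \<noteq> j \<longrightarrow> f (x j) < f (x i))} \<in> sets ?P"
      using J(1) by measurable
    then show ?thesis by (simp add: A_def spP)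
  qed
  have A': "A' j \<in> sets ?P" for j
  proof -
    have "{x \<in> space ?P. \<forall>i\<in>J. x i \<in> B \<and> (i \<noteq> j \<longrightarrow> f (x j) \<le> f (x i))} \<in> sets ?P"
    proof (intro sets.sets_Collect_finite_All sets.sets_Collect_conj sets.sets_Collect_imp J(1))
      show "{x \<in> space ?P. f (x j) \<le> f (x i)} \<in> sets ?P" for i
        by (rule borel_measurable_le) measurable
    qed measurable
    then show ?thesis by (simp add: A'_def spP)
  qed
  have neq: "AE x in ?P. f (x i) \<noteq> f (x k)" if "i \<noteq> k" for i k
  proof (rule AE_PiM_fun_upd[where i = i])
    show "{x \<in> space ?P. f (x i) \<noteq> f (x k)} \<in> sets ?P"
      by (rule borel_measurable_neq) measurable
    show "AE w in L. f ((X(i := w)) i) \<noteq> f ((X(i := w)) k)" for X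
      using that atomless[of "f (X k)"] by simp
  qed (rule L)
  have neq_all: "AE x in ?P. \<forall>i\<in>J. \<forall>k\<in>J. i \<noteq> k \<longrightarrow> f (x i) \<noteq> f (x k)"
    using J(1) neq by (intro AE_finite_allI) auto
  have sym: "P.prob (A k) = P.prob (A j)" if k: "k \<in> J" for k
  proof -
    let ?\<tau> = "Transposition.transpose j k"
    have J': "?\<tau> i \<in> J \<longleftrightarrow> i \<in> J" for i
      using k J(2) by (auto simp: Transposition.transpose_def)
    have m: "(\<lambda>x i. x (?\<tau> i)) \<in> measurable ?P ?P"
      by (rule measurable_PiM_single') (auto simp: L(2))
    have "distr ?P ?P (\<lambda>x i. x (?\<tau> i)) = ?P"
      using distr_PiM_reindex[of UNIV "\<lambda>_. L" ?\<tau> UNIV] L by (simp add: restrict_UNIV)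
    then have "P.prob (A j) = measure (distr ?P ?P (\<lambda>x i. x (?\<tau> i))) (A j)" by simp
    also have "\<dots> = P.prob ((\<lambda>x i. x (?\<tau> i)) -` A j \<inter> space ?P)"
      by (rule measure_distr[OF m A])
    also have "(\<lambda>x i. x (?\<tau> i)) -` A j \<inter> space ?P = A k"
    proof -
      have "(\<forall>i\<in>J. x (?\<tau> i) \<in> B \<and> (i \<noteq> j \<longrightarrow> f (x (?\<tau> j)) < f (x (?\<tau> i)))) \<longleftrightarrow>
          (\<forall>i\<in>J. x i \<in> B \<and> (i \<noteq> k \<longrightarrow> f (x k) < f (x i)))" (is "?l \<longleftrightarrow> ?r") for x
      proof
        assume l: ?l
        show ?r
        proof
          fix i assume "i \<in> J"
          then have "?\<tau> i \<in> J" using J' by simp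
          from bspec[OF l this] show "x i \<in> B \<and> (i \<noteq> k \<longrightarrow> f (x k) < f (x i))"
            by (auto simp: Transposition.transpose_eq_iff)
        qed
      next
        assume r: ?r
        show ?l
        proof
          fix i assume "i \<in> J"
          then have "?\<tau> i \<in> J" using J' by simp
          from bspec[OF r this] show "x (?\<tau> i) \<in> B \<and> (i \<noteq> j \<longrightarrow> f (x (?\<tau> j)) < f (x (?\<tau> i)))"
            by (auto simp: Transposition.transpose_eq_iff)
        qed
      qed
      then show ?thesis by (auto simp: A_def spP)
    qed
    finally show ?thesis ..
  qed
  have "disjoint_family_on A J"
    unfolding disjoint_family_on_def A_def by (force dest: less_asym)
  then have "P.prob (\<Union>k\<in>J. A k) = (\<Sum>k\<in>J. P.prob (A k))"
    using A J(1) by (intro P.finite_measure_finite_Union) auto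
  also have "\<dots> = card J * P.prob (A j)"
    using sym by simp
  also have "P.prob (\<Union>k\<in>J. A k) = P.prob {x. \<forall>i\<in>J. x i \<in> B}"
  proof (rule measure_eq_AE)
    show "AE x in ?P. x \<in> (\<Union>k\<in>J. A k) \<longleftrightarrow> x \<in> {x. \<forall>i\<in>J. x i \<in> B}"
      using neq_all
    proof eventually_elim
      case (elim x)
      have "x \<in> (\<Union>k\<in>J. A k)" if x: "\<forall>i\<in>J. x i \<in> B"
      proof -
        obtain k where k: "k \<in> J" "f (x k) = (INF i\<in>J. f (x i))"
          using INF_attained[of J "\<lambda>i. f (x i)"] J by blast
        have "f (x k) < f (x i)" if "i \<in> J" "i \<noteq> k" for i
        proof -
          have "f (x k) \<le> f (x i)" using k that by (auto intro: INF_lower)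
          moreover have "f (x k) \<noteq> f (x i)" using elim k that by auto
          ultimately show ?thesis by simp
        qed
        then have "x \<in> A k" using x by (auto simp: A_def)
        then show ?thesis using k by blast
      qed
      then show ?case using J by (auto simp: A_def)
    qed
    show "(\<Union>k\<in>J. A k) \<in> sets ?P" using A J(1) by auto
    have "{x \<in> space ?P. \<forall>i\<in>J. x i \<in> B} \<in> sets ?P" using J(1) by measurable
    then show "{x. \<forall>i\<in>J. x i \<in> B} \<in> sets ?P" by (simp add: spP)
  qed
  also have "P.prob {x. \<forall>i\<in>J. x i \<in> B} = L.prob B ^ card J"
  proof -
    have "emeasure ?P {x. \<forall>i\<in>J. x i \<in> B} = (\<Prod>i\<in>J. emeasure L B)"
      by (rule emeasure_PiM_cylinder) (use L J in auto)
    then show ?thesis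
      by (simp add: P.emeasure_eq_measure L.emeasure_eq_measure ennreal_power)
  qed
  finally have *: "P.prob (A j) = L.prob B ^ card J / card J"
    using J by (auto simp: field_simps card_eq_0_iff)
  then show "P.prob {x. \<forall>i\<in>J. x i \<in> B \<and> (i \<noteq> j \<longrightarrow> f (x j) < f (x i))} = L.prob B ^ card J / card J"
    by (simp add: A_def)
  have "P.prob (A' j) = P.prob (A j)"
  proof (rule measure_eq_AE)
    show "AE x in ?P. x \<in> A' j \<longleftrightarrow> x \<in> A j"
      using neq_all by eventually_elim (use J in \<open>auto simp: A_def A'_def order_less_le\<close>)
  qed (use A A' in auto)
  with * show "P.prob {x. \<forall>i\<in>J. x i \<in> B \<and> (i \<noteq> j \<longrightarrow> f (x j) \<le> f (x i))} = L.prob B ^ card J / card J"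
    by (simp add: A'_def)
qed

section \<open>Functionals of a single branch\<close>

abbreviation child_nbrs :: "config \<Rightarrow> nat list \<Rightarrow> nat list \<Rightarrow> nat list set" where
  "child_nbrs \<omega> x v \<equiv> (\<lambda>i. i # x) ` {..<fst \<omega> x}"

text \<open>The branch of \<open>v\<close> hangs off its parent \<open>tl v\<close>.  For the root, \<open>tl [] = []\<close> and the unused weight of
  the pair \<open>([], [])\<close> plays the part of the edge to the parent, so that the branches of all vertices,
  including the root, have the same law.\<close>
definition branch_cost :: "nat \<Rightarrow> nat list \<Rightarrow> config \<Rightarrow> ennreal" where
  "branch_cost k v \<omega> = detour (child_nbrs \<omega>) (snd \<omega>) k v (tl v)"

definition branch_lim :: "nat list \<Rightarrow> config \<Rightarrow> ennreal" where
  "branch_lim v \<omega> = detour_lim (child_nbrs \<omega>) (snd \<omega>) v (tl v)"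

definition exit_cost :: "(nat list \<Rightarrow> config \<Rightarrow> ennreal) \<Rightarrow> nat list \<Rightarrow> config \<Rightarrow> ennreal" where
  "exit_cost d v \<omega> = (INF i\<in>{..<fst \<omega> v}. ennreal (snd \<omega> (v, i # v)) + d (i # v) \<omega>)"

text \<open>Positivity is asked of the descendants only and not of the starting vertex, so that rays
  from \<open>v\<close> are decided by the branches of its children.\<close>

fun ray :: "nat \<Rightarrow> nat list \<Rightarrow> config \<Rightarrow> bool" where
  "ray 0 v \<omega> \<longleftrightarrow> True"
| "ray (Suc n) v \<omega> \<longleftrightarrow> (\<exists>i<fst \<omega> v. 0 < branch_lim (i # v) \<omega> \<and> ray n (i # v) \<omega>)"

text \<open>At such a \<open>v\<close> the edge to the child \<open>1 # v\<close> is unused: the child leaves downwards at no extra cost,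
  and \<open>v\<close> itself prefers \<open>0 # v\<close>.\<close>
definition cut_vertex :: "nat list \<Rightarrow> config \<Rightarrow> bool" where
  "cut_vertex v \<omega> \<longleftrightarrow> 2 \<le> fst \<omega> v \<and> branch_lim (0 # v) \<omega> = 0 \<and> branch_lim (1 # v) \<omega> = 0 \<and>
     ennreal (snd \<omega> (v, 0 # v)) < ennreal (snd \<omega> (v, 1 # v))"

fun no_cut :: "nat \<Rightarrow> nat list \<Rightarrow> config \<Rightarrow> bool" where
  "no_cut 0 v \<omega> \<longleftrightarrow> True"
| "no_cut (Suc n) v \<omega> \<longleftrightarrow> \<not> cut_vertex v \<omega> \<and> (\<forall>i<fst \<omega> v. no_cut n (i # v) \<omega>)"

lemma branch_cost_0: "branch_cost 0 v \<omega> = 0"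
  by (simp add: branch_cost_def)

lemma branch_cost_Suc:
  "branch_cost (Suc k) v \<omega> = exit_cost (branch_cost k) v \<omega> - ennreal (snd \<omega> (v, tl v))"
  by (simp add: branch_cost_def exit_cost_def image_image)

lemma branch_lim_rec: "branch_lim v \<omega> = exit_cost branch_lim v \<omega> - ennreal (snd \<omega> (v, tl v))"
  unfolding branch_lim_def by (subst detour_lim_rec) (simp_all add: exit_cost_def image_image branch_lim_def)

lemma branch_lim_SUP: "branch_lim v \<omega> = (SUP k. branch_cost k v \<omega>)"
  by (simp add: branch_lim_def detour_lim_def branch_cost_def)

lemma branch_cost_mono: "k \<le> l \<Longrightarrow> branch_cost k v \<omega> \<le> branch_cost l v \<omega>"
  by (simp add: branch_cost_def detour_mono)

lemma shift_fst: "fst (shift v \<omega>) u = fst \<omega> (u @ v)"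
  by (simp add: shift_def)

lemma shift_snd:
  "snd (shift v \<omega>) (u, i # u) = snd \<omega> (u @ v, i # u @ v)"
  "snd (shift v \<omega>) (u, tl u) = snd \<omega> (u @ v, tl (u @ v))"
  by (auto simp: shift_def shift_edge_def)

lemma branch_cost_shift: "branch_cost k u (shift v \<omega>) = branch_cost k (u @ v) \<omega>"
  by (induction k arbitrary: u) (simp_all add: branch_cost_0 branch_cost_Suc exit_cost_def shift_fst shift_snd)

lemma branch_lim_shift: "branch_lim u (shift v \<omega>) = branch_lim (u @ v) \<omega>"
  by (simp add: branch_lim_SUP branch_cost_shift)

lemma ray_shift: "ray n u (shift v \<omega>) \<longleftrightarrow> ray n (u @ v) \<omega>"
  by (induction n arbitrary: u) (simp_all add: shift_fst branch_lim_shift)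

lemma cut_vertex_shift: "cut_vertex u (shift v \<omega>) \<longleftrightarrow> cut_vertex (u @ v) \<omega>"
  by (simp add: cut_vertex_def shift_fst shift_snd branch_lim_shift)

lemma no_cut_shift: "no_cut n u (shift v \<omega>) \<longleftrightarrow> no_cut n (u @ v) \<omega>"
  by (induction n arbitrary: u) (simp_all add: shift_fst cut_vertex_shift)

lemma ray_Suc_imp: "ray (Suc n) v \<omega> \<Longrightarrow> ray n v \<omega>"
proof (induction n arbitrary: v)
  case (Suc n)
  from Suc.prems obtain i where "i < fst \<omega> v" "0 < branch_lim (i # v) \<omega>" "ray (Suc n) (i # v) \<omega>"
    unfolding ray.simps(2)[of "Suc n"] by blast
  then show ?case using Suc.IH unfolding ray.simps(2) by blast
qed simp

lemma ray_mono: "m \<le> n \<Longrightarrow> ray n v \<omega> \<Longrightarrow> ray m v \<omega>"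
proof (induction n rule: dec_induct)
  case (step n)
  then show ?case using ray_Suc_imp[of n v \<omega>] by (simp del: ray.simps)
qed

text \<open>Koenig's lemma: among finitely many children, one must carry rays of every
  length.\<close>

lemma ray_all_iff:
  "(\<forall>n. ray n v \<omega>) \<longleftrightarrow> (\<exists>i<fst \<omega> v. 0 < branch_lim (i # v) \<omega> \<and> (\<forall>n. ray n (i # v) \<omega>))"
proof
  assume *: "\<forall>n. ray n v \<omega>"
  show "\<exists>i<fst \<omega> v. 0 < branch_lim (i # v) \<omega> \<and> (\<forall>n. ray n (i # v) \<omega>)"
  proof (rule ccontr)
    assume "\<not> ?thesis"
    then have "\<forall>i\<in>{..<fst \<omega> v}. \<exists>n. \<not> (0 < branch_lim (i # v) \<omega> \<and> ray n (i # v) \<omega>)" by auto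
    then obtain N where N: "\<And>i. i < fst \<omega> v \<Longrightarrow> \<not> (0 < branch_lim (i # v) \<omega> \<and> ray (N i) (i # v) \<omega>)"
      by (metis lessThan_iff)
    define M where "M = Max (insert 0 (N ` {..<fst \<omega> v}))"
    have "N i \<le> M" if "i < fst \<omega> v" for i unfolding M_def using that by (intro Max_ge) auto
    moreover have "ray (Suc M) v \<omega>" using * by blast
    ultimately show False using N ray_mono unfolding ray.simps(2) by metis
  qed
next
  assume "\<exists>i<fst \<omega> v. 0 < branch_lim (i # v) \<omega> \<and> (\<forall>n. ray n (i # v) \<omega>)"
  then have "ray (Suc n) v \<omega>" for n unfolding ray.simps(2) by blast
  then show "\<forall>n. ray n v \<omega>" using ray_Suc_imp by metis
qed

text \<open>For measurability: an infimum over a random index set becomes one over a fixed index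
  set, countable in all uses.\<close>

lemma INF_restrict: "(INF y\<in>A. f y) = (INF y. if y \<in> A then f y else (\<top> :: ennreal))"
proof (rule antisym)
  show "(INF y\<in>A. f y) \<le> (INF y. if y \<in> A then f y else \<top>)"
    by (rule INF_greatest) (auto intro: INF_lower)
  show "(INF y. if y \<in> A then f y else \<top>) \<le> (INF y\<in>A. f y)"
  proof (rule INF_greatest)
    fix y assume "y \<in> A"
    then show "(INF y. if y \<in> A then f y else \<top>) \<le> f y"
      using INF_lower[of y UNIV "\<lambda>y. if y \<in> A then f y else \<top>"] by simp
  qed
qed

section \<open>Measurability and independence of branch functionals\<close>

context gw_base
begin

lemma measurable_exit_cost:
  assumes [measurable]: "\<And>u. d u \<in> borel_measurable base"
  shows "exit_cost d v \<in> borel_measurable base"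
proof -
  have "(\<lambda>\<omega>. INF i. if i \<in> {..<fst \<omega> v} then ennreal (snd \<omega> (v, i # v)) + d (i # v) \<omega> else \<top>)
      \<in> borel_measurable base"
    unfolding lessThan_iff by measurable
  then show ?thesis
    unfolding exit_cost_def[abs_def] by (simp only: INF_restrict[symmetric])
qed

lemma measurable_branch_cost [measurable]: "branch_cost k v \<in> borel_measurable base"
proof (induction k arbitrary: v)
  case 0
  then show ?case by (simp add: branch_cost_0[abs_def])
next
  case (Suc k)
  note [measurable] = measurable_exit_cost[of "branch_cost k", OF Suc.IH]
  show ?case unfolding branch_cost_Suc[abs_def] by measurable
qed

lemma measurable_branch_lim [measurable]: "branch_lim v \<in> borel_measurable base"
  unfolding branch_lim_SUP[abs_def] by measurable

lemmas measurable_exit_lim [measurable] = measurable_exit_cost[of branch_lim, OF measurable_branch_lim]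

lemma measurable_ray [measurable]: "Measurable.pred base (ray n v)"
proof (induction n arbitrary: v)
  case (Suc n)
  note [measurable] = Suc.IH
  have "Measurable.pred base (\<lambda>\<omega>. \<exists>i. i < fst \<omega> v \<and> 0 < branch_lim (i # v) \<omega> \<and> ray n (i # v) \<omega>)"
    by measurable
  then show ?case by (simp cong: measurable_cong)
next
  case 0
  have "ray 0 v = (\<lambda>_. True)" by (simp add: fun_eq_iff)
  then show ?case by simp
qed

lemma measurable_cut_vertex [measurable]: "Measurable.pred base (cut_vertex v)"
  unfolding cut_vertex_def[abs_def] by measurable

lemma measurable_no_cut [measurable]: "Measurable.pred base (no_cut n v)"
proof (induction n arbitrary: v)
  case (Suc n)
  note [measurable] = Suc.IH
  have "Measurable.pred base (\<lambda>\<omega>. \<not> cut_vertex v \<omega> \<and> (\<forall>i. i < fst \<omega> v \<longrightarrow> no_cut n (i # v) \<omega>))"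
    by measurable
  then show ?case by (simp cong: measurable_cong)
next
  case 0
  have "no_cut 0 v = (\<lambda>_. True)" by (simp add: fun_eq_iff)
  then show ?case by simp
qed

lemma AE_shift:
  assumes "AE \<omega> in base. P \<omega>"
  shows "AE \<omega> in base. P (shift v \<omega>)"
  by (rule AE_distrD[OF measurable_shift]) (simp only: distr_shift assms)

lemma prob_shift:
  assumes "Measurable.pred base P"
  shows "base.prob {\<omega>. P (shift v \<omega>)} = base.prob {\<omega>. P \<omega>}"
proof -
  have S: "{\<omega>. P \<omega>} \<in> sets base" using assms by (simp add: pred_def)
  have "base.prob {\<omega>. P \<omega>} = measure (distr base base (shift v)) {\<omega>. P \<omega>}"
    by (simp add: distr_shift)
  also have "\<dots> = base.prob {\<omega>. P (shift v \<omega>)}"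
    by (subst measure_distr[OF measurable_shift S]) (simp add: vimage_def)
  finally show ?thesis ..
qed

text \<open>The labels \<open>[s]\<close> and \<open>[t]\<close> carry branches however many
  children the root has, and their coordinate sets are disjoint.\<close>

lemma prob_shift_pair:
  assumes "s \<noteq> t" "Measurable.pred base P" "Measurable.pred base Q"
  shows "base.prob {\<omega>. P (shift [s] \<omega>) \<and> Q (shift [t] \<omega>)} = base.prob {\<omega>. P \<omega>} * base.prob {\<omega>. Q \<omega>}"
proof -
  have disj: "subtree_coords [s] \<inter> subtree_coords [t] = {}"
  proof -
    have "\<not> (suffix [s] u \<and> suffix [t] u)" for u
      using assms(1) by (auto simp: suffix_def)
    then have "x \<notin> subtree_coords [s] \<or> x \<notin> subtree_coords [t]" for x
      using subtree_coords_suffix by (cases x) metis+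
    then show ?thesis by blast
  qed
  have "distr base (base \<Otimes>\<^sub>M base) (\<lambda>\<omega>. (decode [s] (\<lambda>i\<in>subtree_coords [s]. coord i \<omega>),
      decode [t] (\<lambda>i\<in>subtree_coords [t]. coord i \<omega>))) =
    distr base base (\<lambda>\<omega>. decode [s] (\<lambda>i\<in>subtree_coords [s]. coord i \<omega>)) \<Otimes>\<^sub>M
    distr base base (\<lambda>\<omega>. decode [t] (\<lambda>i\<in>subtree_coords [t]. coord i \<omega>))"
    by (intro distr_restrict_pair disj measurable_decode) auto
  then have eq: "distr base (base \<Otimes>\<^sub>M base) (\<lambda>\<omega>. (shift [s] \<omega>, shift [t] \<omega>)) = base \<Otimes>\<^sub>M base"
    by (simp add: decode_coord distr_shift)
  have P: "{\<omega>. P \<omega>} \<in> sets base" and Q: "{\<omega>. Q \<omega>} \<in> sets base"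
    using assms by (simp_all add: pred_def)
  have "emeasure base {\<omega>. P \<omega>} * emeasure base {\<omega>. Q \<omega>} = emeasure (base \<Otimes>\<^sub>M base) ({\<omega>. P \<omega>} \<times> {\<omega>. Q \<omega>})"
    using P Q by (simp add: base.emeasure_pair_measure_Times)
  also have "\<dots> = emeasure (distr base (base \<Otimes>\<^sub>M base) (\<lambda>\<omega>. (shift [s] \<omega>, shift [t] \<omega>))) ({\<omega>. P \<omega>} \<times> {\<omega>. Q \<omega>})"
    by (simp add: eq)
  also have "\<dots> = emeasure base {\<omega>. P (shift [s] \<omega>) \<and> Q (shift [t] \<omega>)}"
    using P Q by (subst emeasure_distr) (auto simp: vimage_def intro!: arg_cong[where f = "emeasure base"])
  finally show ?thesis
    by (simp add: base.emeasure_eq_measure ennreal_mult[symmetric] del: ennreal_mult')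
qed

lemma prob_neighbourhood:
  assumes "s \<noteq> t" and Q: "\<And>k. {x. Q k x} \<in> sets units_law"
  shows "base.prob {\<omega>. Q (fst \<omega> [s]) (\<lambda>j. (shift (unit_root s t j) \<omega>, snd \<omega> (unit_edge s j)))} =
    measure_pmf.expectation \<mu> (\<lambda>k. measure units_law {x. Q k x})"
proof -
  interpret U: prob_space units_law
    by (intro prob_space_PiM units.prob_space_axioms)
  let ?X = "\<lambda>\<omega>. (fst \<omega> [s], \<lambda>j. (shift (unit_root s t j) \<omega>, snd \<omega> (unit_edge s j)))"
  have X: "?X \<in> measurable base (measure_pmf \<mu> \<Otimes>\<^sub>M units_law)"
    by (intro measurable_Pair measurable_PiM_single' measurable_shift) (auto simp: space_pair_measure)
  let ?A = "{(k, x). Q k x}"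
  have "?A = (\<Union>k. {k} \<times> {x. Q k x})" by auto
  also have "\<dots> \<in> sets (measure_pmf \<mu> \<Otimes>\<^sub>M units_law)"
    using Q by (intro sets.countable_UN' pair_measureI) auto
  finally have A: "?A \<in> sets (measure_pmf \<mu> \<Otimes>\<^sub>M units_law)" .
  have "emeasure base {\<omega>. Q (fst \<omega> [s]) (\<lambda>j. (shift (unit_root s t j) \<omega>, snd \<omega> (unit_edge s j)))} =
      emeasure (distr base (measure_pmf \<mu> \<Otimes>\<^sub>M units_law) ?X) ?A"
    by (subst emeasure_distr[OF X A]) (simp add: vimage_def)
  also have "\<dots> = emeasure (measure_pmf \<mu> \<Otimes>\<^sub>M units_law) ?A"
    using distr_neighbourhood[OF assms(1)] by simp
  also have "\<dots> = (\<integral>\<^sup>+ k. emeasure units_law {x. Q k x} \<partial>measure_pmf \<mu>)"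
    by (subst U.emeasure_pair_measure_alt[OF A]) (simp add: vimage_def)
  also have "\<dots> = (\<integral>\<^sup>+ k. ennreal (measure units_law {x. Q k x}) \<partial>measure_pmf \<mu>)"
    by (simp add: U.emeasure_eq_measure)
  also have "\<dots> = ennreal (measure_pmf.expectation \<mu> (\<lambda>k. measure units_law {x. Q k x}))"
    by (intro nn_integral_eq_integral measure_pmf.integrable_const_bound[where B = 1]) auto
  finally show ?thesis
    by (simp add: base.emeasure_eq_measure integral_nonneg_AE)
qed

text \<open>The weight is independent of the branch and has no atoms. An infinite value of
  \<open>g\<close> would absorb the weight and create an atom, which is why truncated costs are
  treated before the limit.\<close>

lemma unit_sum_atomless:
  assumes [measurable]: "g \<in> borel_measurable base" and fin: "AE \<beta> in base. g \<beta> < \<top>"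
  shows "AE u in unit_law. ennreal (snd u) + g (fst u) \<noteq> t"
proof (rule units.AE_pair_measure)
  have "{u \<in> space unit_law. ennreal (snd u) + g (fst u) \<noteq> t} \<in> sets unit_law"
    by (rule borel_measurable_neq) measurable
  then show "{u \<in> space unit_law. ennreal (snd u) + g (fst u) \<noteq> t} \<in> sets unit_law" .
  show "AE \<beta> in base. AE w in exp_law. ennreal (snd (\<beta>, w)) + g (fst (\<beta>, w)) \<noteq> t"
    using fin
  proof eventually_elim
    case (elim \<beta>)
    then show ?case using AE_exp_law_add_neq by simp
  qed
qed

end

section \<open>The recursive distributional equations\<close>

text \<open>Divided by \<open>2 * (1 - h) * (k + 1)\<close>, this compares averages: that of
  \<open>1, h, ..., h^k\<close> with that of \<open>1, h\<close>. The terms decrease, so averaging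
  over more of them gives less.\<close>

lemma geometric_mean_bound:
  fixes h :: real
  assumes "0 \<le> h" "h < 1"
  shows "1 \<le> k \<Longrightarrow> 2 * (1 - h ^ (k + 1)) \<le> (1 - h\<^sup>2) * real (k + 1)"
    and "2 \<le> k \<Longrightarrow> 2 * (1 - h ^ (k + 1)) < (1 - h\<^sup>2) * real (k + 1)"
proof -
  define a where "a k = (1 - h\<^sup>2) * real (k + 1) - 2 * (1 - h ^ (k + 1))" for k
  have step: "a k < a (Suc k)" if "1 \<le> k" for k
  proof -
    have "h ^ (k + 1) \<le> h\<^sup>2" using that assms by (intro power_decreasing) auto
    moreover have "0 < (1 - h) * (1 + 2 * h)" using assms by simp
    then have "2 * h\<^sup>2 < 1 + h" by (simp add: algebra_simps power2_eq_square)
    \<comment> \<open>This product is the increment \<open>a (Suc k) - a k\<close>.\<close>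
    ultimately have "0 < (1 - h) * (1 + h - 2 * h ^ (k + 1))" using assms by (intro mult_pos_pos) auto
    then show ?thesis by (simp add: a_def algebra_simps power2_eq_square)
  qed
  have 1: "a 1 = 0" by (simp add: a_def power2_eq_square)
  have "0 \<le> a k" if "1 \<le> k" for k
    using that
  proof (induction k rule: dec_induct)
    case (step k)
    then show ?case using \<open>\<And>k. 1 \<le> k \<Longrightarrow> a k < a (Suc k)\<close>[of k] by simp
  qed (use 1 in simp)
  note nonneg = this
  show "1 \<le> k \<Longrightarrow> 2 * (1 - h ^ (k + 1)) \<le> (1 - h\<^sup>2) * real (k + 1)"
    using nonneg[of k] by (simp add: a_def)
  assume k: "2 \<le> k"
  then obtain j where j: "k = Suc j" "1 \<le> j" by (cases k) auto
  then have "0 \<le> a j" "a j < a (Suc j)" using nonneg step by blast+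
  then have "0 < a k" using j by simp
  then show "2 * (1 - h ^ (k + 1)) < (1 - h\<^sup>2) * real (k + 1)" by (simp add: a_def)
qed

section \<open>Analytic inequalities for the offspring law\<close>

locale supercritical_gw = gw_base +
  assumes integrable_offspring: "integrable (measure_pmf \<mu>) real"
    and mean: "1 < measure_pmf.expectation \<mu> real"
    and no_death: "pmf \<mu> 0 = 0"
begin

lemma AE_offspring_pos: "AE k in measure_pmf \<mu>. 1 \<le> k"
  using no_death by (auto simp: AE_measure_pmf_iff set_pmf_iff Suc_le_eq intro: gr0I)

text \<open>A mean above 1 without mass at 0 forces mass at some \<open>k >= 2\<close>, where the
  strict inequality counts.\<close>

lemma expectation_pos:
  fixes f :: "nat \<Rightarrow> real"
  assumes C: "\<And>k. \<bar>f k\<bar> \<le> C" and f1: "\<And>k. 1 \<le> k \<Longrightarrow> 0 \<le> f k" and f2: "\<And>k. 2 \<le> k \<Longrightarrow> 0 < f k"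
  shows "0 < measure_pmf.expectation \<mu> f"
proof -
  have "\<exists>k\<in>set_pmf \<mu>. 2 \<le> k"
  proof (rule ccontr)
    assume *: "\<not> ?thesis"
    have "AE k in measure_pmf \<mu>. real k = 1"
      using AE_offspring_pos * by (auto simp: AE_measure_pmf_iff) fastforce
    then have "measure_pmf.expectation \<mu> real = measure_pmf.expectation \<mu> (\<lambda>_. 1)"
      by (intro integral_cong_AE) auto
    then show False using mean by simp
  qed
  then obtain k where k: "2 \<le> k" "0 < pmf \<mu> k" by (auto simp: pmf_positive)
  have "0 < f k * pmf \<mu> k" using f2 k by simp
  also have "\<dots> = measure_pmf.expectation \<mu> (\<lambda>j. f k * indicator {k} j)"
    by (simp add: measure_pmf_single)
  also have "\<dots> \<le> measure_pmf.expectation \<mu> f"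
  proof (rule integral_mono_AE)
    show "integrable (measure_pmf \<mu>) f"
      using C by (intro measure_pmf.integrable_const_bound[where B = C]) auto
    show "AE j in measure_pmf \<mu>. f k * indicator {k} j \<le> f j"
      using AE_offspring_pos by eventually_elim (auto simp: indicator_def f1)
    show "integrable (measure_pmf \<mu>) (\<lambda>j. f k * indicator {k} j)"
      by (intro measure_pmf.integrable_const_bound[where B = "\<bar>f k\<bar>"]) (auto simp: indicator_def)
  qed
  finally show ?thesis .
qed

text \<open>Among \<open>Z + 1\<close> i.i.d. units this is the probability that a given one is the
  cheapest and all of them lie in an event of probability \<open>h\<close>.\<close>

definition psi :: "real \<Rightarrow> real" where
  "psi h = measure_pmf.expectation \<mu> (\<lambda>k. h ^ (k + 1) / real (k + 1))"

lemma integrable_power: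
  assumes "0 \<le> h" "h \<le> 1"
  shows "integrable (measure_pmf \<mu>) (\<lambda>k. h ^ k)"
    "integrable (measure_pmf \<mu>) (\<lambda>k. h ^ (k + 1) / real (k + 1))"
proof -
  show "integrable (measure_pmf \<mu>) (\<lambda>k. h ^ k)"
    using assms by (intro measure_pmf.integrable_const_bound[where B = 1]) (auto simp: power_le_one)
  have "\<bar>h ^ (k + 1) / real (k + 1)\<bar> \<le> 1" for k
  proof -
    have "h ^ (k + 1) \<le> real (k + 1)"
      using power_le_one[OF assms, of "k + 1"] by linarith
    then show ?thesis using assms(1) by (simp add: divide_le_eq)
  qed
  then show "integrable (measure_pmf \<mu>) (\<lambda>k. h ^ (k + 1) / real (k + 1))"
    by (intro measure_pmf.integrable_const_bound[where B = 1]) auto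
qed

text \<open>The comparison of averages, integrated over \<open>Z\<close>. Offspring number 1 gives
  equality, so the strictness comes from \<open>Z >= 2\<close>.\<close>

lemma psi_strict:
  assumes h: "0 \<le> h" "h < 1"
  shows "h\<^sup>2 - 2 * psi h < 1 - 2 * psi 1"
proof -
  define f where "f k = (1 - h\<^sup>2) - 2 * (1 / real (k + 1) - h ^ (k + 1) / real (k + 1))" for k
  have f_eq: "f k = ((1 - h\<^sup>2) * real (k + 1) - 2 * (1 - h ^ (k + 1))) / real (k + 1)" for k
    by (simp add: f_def field_simps)
  have "0 < measure_pmf.expectation \<mu> f"
  proof (rule expectation_pos[of f 3])
    show "0 \<le> f k" if "1 \<le> k" for k
      unfolding f_eq using geometric_mean_bound(1)[OF h that] by simp
    show "0 < f k" if "2 \<le> k" for k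
      unfolding f_eq using geometric_mean_bound(2)[OF h that] by (intro divide_pos_pos) auto
    show "\<bar>f k\<bar> \<le> 3" for k
    proof -
      have p: "0 \<le> h ^ (k + 1)" "h ^ (k + 1) \<le> 1"
        using h power_le_one[of h "k + 1"] by auto
      have "0 \<le> (1 - h ^ (k + 1)) / real (k + 1)" using p by simp
      moreover have "(1 - h ^ (k + 1)) / real (k + 1) \<le> 1" using p by (simp add: divide_le_eq)
      moreover have "f k = 1 - h\<^sup>2 - 2 * ((1 - h ^ (k + 1)) / real (k + 1))"
        by (simp add: f_def diff_divide_distrib)
      moreover have "0 \<le> h\<^sup>2" "h\<^sup>2 \<le> 1" using h by (auto intro: power_le_one)
      ultimately show ?thesis by linarith
    qed
  qed
  also have "measure_pmf.expectation \<mu> f = (1 - h\<^sup>2) - 2 * (psi 1 - psi h)"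
  proof -
    have "measure_pmf.expectation \<mu> (\<lambda>k. c - 2 * (p k - r k)) =
        c - 2 * (measure_pmf.expectation \<mu> p - measure_pmf.expectation \<mu> r)"
      if "integrable (measure_pmf \<mu>) p" "integrable (measure_pmf \<mu>) r" for c :: real and p r
      using that by simp
    from this[OF integrable_power(2)[of 1] integrable_power(2)[of h]] show ?thesis
      unfolding f_def psi_def using h by simp
  qed
  finally show ?thesis by simp
qed

lemma psi_1_less: "0 < 1 - 2 * psi 1"
  using psi_strict[of 0] by (simp add: psi_def)

text \<open>For \<open>0 < q < 1\<close> the difference \<open>q - q^k\<close> is nonnegative when
  \<open>k >= 1\<close> and positive when \<open>k >= 2\<close>, so its mean would be
  positive.\<close>

lemma zero_one:
  fixes q :: real
  assumes q: "0 \<le> q" "q < 1" "q \<le> measure_pmf.expectation \<mu> (\<lambda>k. q ^ k)"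
  shows "q = 0"
proof (rule ccontr)
  assume "q \<noteq> 0"
  then have q0: "0 < q" using q(1) by simp
  have "0 < measure_pmf.expectation \<mu> (\<lambda>k. q - q ^ k)"
  proof (rule expectation_pos[of _ 1])
    show "\<bar>q - q ^ k\<bar> \<le> 1" for k
    proof -
      have "0 \<le> q ^ k" "q ^ k \<le> 1" using q by (simp_all add: power_le_one)
      then show ?thesis using q(1,2) by (intro abs_leI; linarith)
    qed
    show "0 \<le> q - q ^ k" if "1 \<le> k" for k
      using power_decreasing[OF that, of q] q by simp
    show "0 < q - q ^ k" if "2 \<le> k" for k
      using power_strict_decreasing[of 1 k q] q q0 that by simp
  qed
  also have "\<dots> = q - measure_pmf.expectation \<mu> (\<lambda>k. q ^ k)"
    using integrable_power(1)[of q] q by simp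
  finally show False using q by simp
qed

lemma AE_all_offspring_pos: "AE \<omega> in base. \<forall>v. 1 \<le> fst \<omega> v"
proof (subst AE_all_countable, intro allI)
  fix v
  have "AE k in distr base (measure_pmf \<mu>) (\<lambda>\<omega>. fst \<omega> v). 1 \<le> k"
    unfolding distr_offspring by (rule AE_offspring_pos)
  then show "AE \<omega> in base. 1 \<le> fst \<omega> v" by (rule AE_distrD[rotated]) simp
qed

lemma AE_all_weight_pos: "AE \<omega> in base. \<forall>e. 0 < snd \<omega> e"
proof (subst AE_all_countable, intro allI)
  fix e
  have "AE w in distr base exp_law (\<lambda>\<omega>. snd \<omega> e). 0 < w"
    unfolding distr_weight by (rule AE_exp_law_pos)
  then show "AE \<omega> in base. 0 < snd \<omega> e" by (rule AE_distrD[rotated]) simp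
qed

lemma branch_cost_finite: "\<forall>v. 1 \<le> fst \<omega> v \<Longrightarrow> branch_cost k v \<omega> < \<top>"
proof (induction k arbitrary: v)
  case (Suc k)
  have "exit_cost (branch_cost k) v \<omega> \<le> ennreal (snd \<omega> (v, 0 # v)) + branch_cost k (0 # v) \<omega>"
    unfolding exit_cost_def using Suc.prems by (intro INF_lower) (simp add: Suc_le_eq)
  also have "\<dots> < \<top>" using Suc by simp
  finally show ?case unfolding branch_cost_Suc by (simp add: diff_less_top_ennreal)
qed (simp add: branch_cost_0)

lemma AE_branch_cost_finite: "AE \<omega> in base. branch_cost k v \<omega> < \<top>"
  using AE_all_offspring_pos by eventually_elim (rule branch_cost_finite)

section \<open>Joining two branches: cost 0 has positive probability\<close>

abbreviation "unit_at s t \<omega> j \<equiv> (shift (unit_root s t j) \<omega>, snd \<omega> (unit_edge s j))"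
abbreviation "unit_cost g u \<equiv> ennreal (snd u) + g (fst u)"

lemma space_unit: "space unit_law = UNIV"
  by (simp add: space_pair_measure)

lemma space_units: "space units_law = UNIV"
  by (simp add: space_PiM space_unit PiE_def)

lemma sets_first:
  assumes [measurable]: "g \<in> borel_measurable base" "B \<in> sets unit_law"
  shows "{x. \<forall>i\<in>{..k}. x i \<in> B \<and> (i \<noteq> 0 \<longrightarrow> unit_cost g (x 0) < unit_cost g (x i))} \<in> sets units_law"
    "{x. \<forall>i\<in>{..k}. x i \<in> B \<and> (i \<noteq> 0 \<longrightarrow> unit_cost g (x 0) \<le> unit_cost g (x i))} \<in> sets units_law"
proof -
  have "{x \<in> space units_law. \<forall>i\<in>{..k}. x i \<in> B \<and> (i \<noteq> 0 \<longrightarrow> unit_cost g (x 0) < unit_cost g (x i))} \<in> sets units_law"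
    by measurable
  then show "{x. \<forall>i\<in>{..k}. x i \<in> B \<and> (i \<noteq> 0 \<longrightarrow> unit_cost g (x 0) < unit_cost g (x i))} \<in> sets units_law"
    by (simp add: space_units)
  have "{x \<in> space units_law. \<forall>i\<in>{..k}. x i \<in> B \<and> (i \<noteq> 0 \<longrightarrow> unit_cost g (x 0) \<le> unit_cost g (x i))} \<in> sets units_law"
  proof (intro sets.sets_Collect_finite_All sets.sets_Collect_conj sets.sets_Collect_imp finite_atMost)
    show "{x \<in> space units_law. unit_cost g (x 0) \<le> unit_cost g (x i)} \<in> sets units_law" for i
      by (rule borel_measurable_le) measurable
  qed measurable
  then show "{x. \<forall>i\<in>{..k}. x i \<in> B \<and> (i \<noteq> 0 \<longrightarrow> unit_cost g (x 0) \<le> unit_cost g (x i))} \<in> sets units_law"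
    by (simp add: space_units)
qed

lemma prob_first:
  assumes "s \<noteq> t" and g: "g \<in> borel_measurable base" "AE \<beta> in base. g \<beta> < \<top>" and B: "B \<in> sets unit_law"
  shows "base.prob {\<omega>. \<forall>i\<in>{..fst \<omega> [s]}. unit_at s t \<omega> i \<in> B \<and>
      (i \<noteq> 0 \<longrightarrow> unit_cost g (unit_at s t \<omega> 0) < unit_cost g (unit_at s t \<omega> i))} = psi (measure unit_law B)"
    "base.prob {\<omega>. \<forall>i\<in>{..fst \<omega> [s]}. unit_at s t \<omega> i \<in> B \<and>
      (i \<noteq> 0 \<longrightarrow> unit_cost g (unit_at s t \<omega> 0) \<le> unit_cost g (unit_at s t \<omega> i))} = psi (measure unit_law B)"
proof -
  have [measurable]: "unit_cost g \<in> borel_measurable unit_law" using g(1) by measurable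
  note min = measure_strict_min[OF units.prob_space_axioms space_unit \<open>unit_cost g \<in> _\<close> B
      unit_sum_atomless[OF g], where j = 0]
  show "base.prob {\<omega>. \<forall>i\<in>{..fst \<omega> [s]}. unit_at s t \<omega> i \<in> B \<and>
      (i \<noteq> 0 \<longrightarrow> unit_cost g (unit_at s t \<omega> 0) < unit_cost g (unit_at s t \<omega> i))} = psi (measure unit_law B)"
    unfolding psi_def
    by (subst prob_neighbourhood[OF assms(1) sets_first(1)[OF g(1) B]])
      (intro Bochner_Integration.integral_cong refl, subst min(1), auto)
  show "base.prob {\<omega>. \<forall>i\<in>{..fst \<omega> [s]}. unit_at s t \<omega> i \<in> B \<and>
      (i \<noteq> 0 \<longrightarrow> unit_cost g (unit_at s t \<omega> 0) \<le> unit_cost g (unit_at s t \<omega> i))} = psi (measure unit_law B)"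
    unfolding psi_def
    by (subst prob_neighbourhood[OF assms(1) sets_first(2)[OF g(1) B]])
      (intro Bochner_Integration.integral_cong refl, subst min(2), auto)
qed

lemma sets_neighbourhood:
  assumes Q: "\<And>k. {x. Q k x} \<in> sets units_law"
  shows "{\<omega>. Q (fst \<omega> [s]) (unit_at s t \<omega>)} \<in> sets base"
proof -
  have X: "unit_at s t \<in> measurable base units_law"
    by (intro measurable_Pair measurable_PiM_single' measurable_shift) (auto simp: space_pair_measure)
  have "unit_at s t -` {x. Q k x} \<inter> space base \<in> sets base" for k
    by (rule measurable_sets[OF X Q])
  then have [measurable]: "Measurable.pred base (\<lambda>\<omega>. Q k (unit_at s t \<omega>))" for k
    by (simp add: pred_def vimage_def)
  have "Measurable.pred base (\<lambda>\<omega>. \<exists>k. fst \<omega> [s] = k \<and> Q k (unit_at s t \<omega>))" by measurable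
  then show ?thesis by (simp add: pred_def)
qed

lemma exit_cost_units:
  assumes "\<And>v \<omega>. g (shift v \<omega>) = d v \<omega>"
  shows "exit_cost d [s] \<omega> = (INF i\<in>{..<fst \<omega> [s]}. unit_cost g (unit_at s t \<omega> (Suc i)))"
  by (simp add: exit_cost_def unit_root_def unit_edge_def assms)

text \<open>Reading the edge from \<open>[s]\<close> to the root as an edge to \<open>[t]\<close>
  gives \<open>[s]\<close> one neighbour besides its children, exchangeable with them. If that exit
  beats the infimum over the children, it is the cheapest of all units; no event is attached to the
  branches, so \<open>B\<close> is everything.\<close>

lemma prob_into_branch_le:
  assumes "s \<noteq> t" and d: "\<And>v. d v \<in> borel_measurable base" "AE \<beta> in base. d [] \<beta> < \<top>"
    and sh: "\<And>v \<omega>. d [] (shift v \<omega>) = d v \<omega>"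
  shows "base.prob {\<omega>. ennreal (snd \<omega> ([s], [])) + d [t] \<omega> < exit_cost d [s] \<omega>} \<le> psi 1"
    "base.prob {\<omega>. ennreal (snd \<omega> ([s], [])) + d [t] \<omega> \<le> exit_cost d [s] \<omega>} \<le> psi 1"
proof -
  note ex = exit_cost_units[of "d []" d s _ t, OF sh]
  have L1: "measure unit_law UNIV = 1" using units.prob_space by (simp add: space_unit)
  have U: "UNIV \<in> sets unit_law" using sets.top[of unit_law] by (simp add: space_unit)
  have m: "{\<omega>. \<forall>i\<in>{..fst \<omega> [s]}. unit_at s t \<omega> i \<in> UNIV \<and>
      (i \<noteq> 0 \<longrightarrow> unit_cost (d []) (unit_at s t \<omega> 0) < unit_cost (d []) (unit_at s t \<omega> i))} \<in> sets base"
    "{\<omega>. \<forall>i\<in>{..fst \<omega> [s]}. unit_at s t \<omega> i \<in> UNIV \<and>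
      (i \<noteq> 0 \<longrightarrow> unit_cost (d []) (unit_at s t \<omega> 0) \<le> unit_cost (d []) (unit_at s t \<omega> i))} \<in> sets base"
    using sets_neighbourhood[OF sets_first(1)[OF d(1)[of "[]"] U], where s = s and t = t]
      sets_neighbourhood[OF sets_first(2)[OF d(1)[of "[]"] U], where s = s and t = t] by simp_all
  have "base.prob {\<omega>. ennreal (snd \<omega> ([s], [])) + d [t] \<omega> < exit_cost d [s] \<omega>} \<le>
    base.prob {\<omega>. \<forall>i\<in>{..fst \<omega> [s]}. unit_at s t \<omega> i \<in> UNIV \<and>
      (i \<noteq> 0 \<longrightarrow> unit_cost (d []) (unit_at s t \<omega> 0) < unit_cost (d []) (unit_at s t \<omega> i))}"
  proof (rule base.finite_measure_mono[OF _ m(1)], intro subsetI CollectI ballI conjI UNIV_I impI)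
    fix \<omega> :: config and i
    assume "\<omega> \<in> {\<omega>. ennreal (snd \<omega> ([s], [])) + d [t] \<omega> < exit_cost d [s] \<omega>}"
      and i: "i \<in> {..fst \<omega> [s]}" "i \<noteq> 0"
    then have lt: "ennreal (snd \<omega> ([s], [])) + d [t] \<omega> < exit_cost d [s] \<omega>" by simp
    from i obtain k where k: "i = Suc k" "k < fst \<omega> [s]" by (cases i) auto
    have "exit_cost d [s] \<omega> \<le> unit_cost (d []) (unit_at s t \<omega> i)"
      unfolding ex k(1) using k(2) by (intro INF_lower) auto
    with lt show "unit_cost (d []) (unit_at s t \<omega> 0) < unit_cost (d []) (unit_at s t \<omega> i)"
      by (simp add: unit_root_def unit_edge_def sh)
  qed
  also have "\<dots> = psi 1" using prob_first(1)[OF assms(1) d(1) d(2) U] L1 by simp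
  finally show "base.prob {\<omega>. ennreal (snd \<omega> ([s], [])) + d [t] \<omega> < exit_cost d [s] \<omega>} \<le> psi 1" .
  have "base.prob {\<omega>. ennreal (snd \<omega> ([s], [])) + d [t] \<omega> \<le> exit_cost d [s] \<omega>} \<le>
    base.prob {\<omega>. \<forall>i\<in>{..fst \<omega> [s]}. unit_at s t \<omega> i \<in> UNIV \<and>
      (i \<noteq> 0 \<longrightarrow> unit_cost (d []) (unit_at s t \<omega> 0) \<le> unit_cost (d []) (unit_at s t \<omega> i))}"
  proof (rule base.finite_measure_mono[OF _ m(2)], intro subsetI CollectI ballI conjI UNIV_I impI)
    fix \<omega> :: config and i
    assume "\<omega> \<in> {\<omega>. ennreal (snd \<omega> ([s], [])) + d [t] \<omega> \<le> exit_cost d [s] \<omega>}"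
      and i: "i \<in> {..fst \<omega> [s]}" "i \<noteq> 0"
    then have lt: "ennreal (snd \<omega> ([s], [])) + d [t] \<omega> \<le> exit_cost d [s] \<omega>" by simp
    from i obtain k where k: "i = Suc k" "k < fst \<omega> [s]" by (cases i) auto
    have "exit_cost d [s] \<omega> \<le> unit_cost (d []) (unit_at s t \<omega> i)"
      unfolding ex k(1) using k(2) by (intro INF_lower) auto
    with lt show "unit_cost (d []) (unit_at s t \<omega> 0) \<le> unit_cost (d []) (unit_at s t \<omega> i)"
      by (simp add: unit_root_def unit_edge_def sh)
  qed
  also have "\<dots> = psi 1" using prob_first(2)[OF assms(1) d(1) d(2) U] L1 by simp
  finally show "base.prob {\<omega>. ennreal (snd \<omega> ([s], [])) + d [t] \<omega> \<le> exit_cost d [s] \<omega>} \<le> psi 1" .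
qed


text \<open>Join two independent branches by an edge: each endpoint exits through that edge with probability at most
  \<open>psi 1\<close> by exchangeability, and if neither does then both branches have cost \<open>0\<close>.\<close>
lemma prob_branch_cost_zero: "1 - 2 * psi 1 \<le> (base.prob {\<omega>. branch_cost n [] \<omega> = 0})\<^sup>2"
proof (cases n)
  case 0
  have "0 \<le> psi 1" unfolding psi_def by (intro integral_nonneg_AE) auto
  then show ?thesis using 0 base.prob_space by (simp add: branch_cost_0)
next
  case (Suc m)
  let ?E0 = "{\<omega>. branch_cost n [0] \<omega> = 0 \<and> branch_cost n [1] \<omega> = 0}"
  let ?E1 = "{\<omega>. ennreal (snd \<omega> ([0], [])) + branch_cost m [1] \<omega> < exit_cost (branch_cost m) [0] \<omega>}"
  \<comment> \<open>The weak inequality, against the strict one in \<open>?E1\<close>, breaks the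
    symmetry: with two strict ones, the complement would allow two equal positive costs.\<close>
  let ?E2 = "{\<omega>. ennreal (snd \<omega> ([1], [])) + branch_cost m [0] \<omega> \<le> exit_cost (branch_cost m) [1] \<omega>}"
  note [measurable] = measurable_exit_cost[of "branch_cost m", OF measurable_branch_cost]
  have E0: "?E0 \<in> sets base"
  proof -
    have "{\<omega> \<in> space base. branch_cost n [0] \<omega> = 0 \<and> branch_cost n [1] \<omega> = 0} \<in> sets base" by measurable
    then show ?thesis by simp
  qed
  have E1: "?E1 \<in> sets base"
  proof -
    have "{\<omega> \<in> space base. ennreal (snd \<omega> ([0], [])) + branch_cost m [1] \<omega> < exit_cost (branch_cost m) [0] \<omega>} \<in> sets base"
      by measurable
    then show ?thesis by simp
  qed
  have E2: "?E2 \<in> sets base"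
  proof -
    have "{\<omega> \<in> space base. ennreal (snd \<omega> ([1], [])) + branch_cost m [0] \<omega> \<le> exit_cost (branch_cost m) [1] \<omega>} \<in> sets base"
      by (rule borel_measurable_le) measurable
    then show ?thesis by simp
  qed
  have "\<omega> \<in> ?E0" if "\<omega> \<notin> ?E1" "\<omega> \<notin> ?E2" for \<omega>
  proof -
    let ?w0 = "ennreal (snd \<omega> ([0], []))" and ?w1 = "ennreal (snd \<omega> ([1], []))"
    let ?D0 = "exit_cost (branch_cost m) [0] \<omega>" and ?D1 = "exit_cost (branch_cost m) [1] \<omega>"
    have d: "branch_cost n [0] \<omega> = ?D0 - ?w0" "branch_cost n [1] \<omega> = ?D1 - ?w1"
      by (simp_all add: Suc branch_cost_Suc)
    \<comment> \<open>The exits are compared at level \<open>m\<close> but the branch costs live at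
      level \<open>n = Suc m\<close>; monotonicity in the level bridges the two.\<close>
    have mono: "branch_cost m v \<omega> \<le> branch_cost n v \<omega>" for v
      using branch_cost_mono[of m n v \<omega>] Suc by simp
    have "?D0 \<le> ?w0 + branch_cost m [1] \<omega>" using that(1) by simp
    also have "\<dots> \<le> ?w0 + (?D1 - ?w1)" unfolding d(2)[symmetric] by (intro add_left_mono mono)
    finally have 1: "?D0 \<le> ?w0 + (?D1 - ?w1)" .
    have "?D1 < ?w1 + branch_cost m [0] \<omega>" using that(2) by simp
    also have "\<dots> \<le> ?w1 + (?D0 - ?w0)" unfolding d(1)[symmetric] by (intro add_left_mono mono)
    finally have 2: "?D1 < ?w1 + (?D0 - ?w0)" .
    have le: "?D0 - ?w0 \<le> ?D1 - ?w1" using 1 by (simp add: ennreal_minus_le_iff add.commute)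
    have "?D1 - ?w1 = 0"
    proof (rule ccontr)
      assume "?D1 - ?w1 \<noteq> 0"
      then have "?w1 \<le> ?D1" by (metis diff_eq_0_ennreal ennreal_less_top le_less_trans nle_le)
      then have "?D1 = ?w1 + (?D1 - ?w1)" by (simp add: add_diff_inverse_ennreal)
      also have "\<dots> \<ge> ?w1 + (?D0 - ?w0)" by (intro add_left_mono le)
      finally show False using 2 by simp
    qed
    with le have "branch_cost n [0] \<omega> = 0" "branch_cost n [1] \<omega> = 0" unfolding d by simp_all
    then show ?thesis by simp
  qed
  then have "?E0 \<union> ?E1 \<union> ?E2 = space base" by auto
  then have "1 = base.prob (?E0 \<union> ?E1 \<union> ?E2)" using base.prob_space by simp
  also have "\<dots> \<le> base.prob ?E0 + base.prob ?E1 + base.prob ?E2"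
    using measure_Un_le[of "?E0 \<union> ?E1" base ?E2] measure_Un_le[of ?E0 base ?E1] E0 E1 E2
    by simp
  also have "base.prob ?E1 \<le> psi 1"
    by (rule prob_into_branch_le) (simp_all add: AE_branch_cost_finite branch_cost_shift)
  also have "base.prob ?E2 \<le> psi 1"
    by (rule prob_into_branch_le) (simp_all add: AE_branch_cost_finite branch_cost_shift)
  also have "base.prob ?E0 = (base.prob {\<omega>. branch_cost n [] \<omega> = 0})\<^sup>2"
    using prob_shift_pair[of 0 1 "\<lambda>\<omega>. branch_cost n [] \<omega> = 0" "\<lambda>\<omega>. branch_cost n [] \<omega> = 0"]
    by (simp add: branch_cost_shift power2_eq_square)
  finally show ?thesis by simp
qed

definition cut_prob :: real where
  "cut_prob = base.prob {\<omega>. branch_lim [] \<omega> = 0}"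

text \<open>The truncated bound is uniform in the level, and the events decrease to vanishing of the
  supremum.\<close>

lemma cut_prob_ge: "1 - 2 * psi 1 \<le> cut_prob\<^sup>2"
proof -
  let ?A = "\<lambda>n. {\<omega>. branch_cost n [] \<omega> = 0}"
  have A: "?A n \<in> sets base" for n
  proof -
    have "{\<omega> \<in> space base. branch_cost n [] \<omega> = 0} \<in> sets base" by measurable
    then show ?thesis by simp
  qed
  have "decseq ?A"
  proof (rule decseq_SucI, safe)
    fix n and \<omega> :: config assume "branch_cost (Suc n) [] \<omega> = 0"
    then show "branch_cost n [] \<omega> = 0" using branch_cost_mono[of n "Suc n" "[]" \<omega>] by simp
  qed
  then have "(\<lambda>n. base.prob (?A n)) \<longlonglongrightarrow> base.prob (\<Inter>n. ?A n)"
    using A by (intro base.finite_Lim_measure_decseq) auto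
  moreover have "(\<Inter>n. ?A n) = {\<omega>. branch_lim [] \<omega> = 0}"
    by (auto simp: branch_lim_SUP SUP_eq_iff)
  ultimately have "(\<lambda>n. (base.prob (?A n))\<^sup>2) \<longlonglongrightarrow> cut_prob\<^sup>2"
    by (auto simp: cut_prob_def intro: tendsto_power)
  then show ?thesis
    by (rule LIMSEQ_le_const) (use prob_branch_cost_zero in blast)
qed

lemma cut_prob_pos: "0 < cut_prob"
proof -
  have "0 \<le> cut_prob" by (simp add: cut_prob_def)
  moreover have "cut_prob \<noteq> 0" using cut_prob_ge psi_1_less by auto
  ultimately show ?thesis by simp
qed

section \<open>Finiteness of the limiting costs\<close>

lemma measure_unit_fst:
  assumes "Measurable.pred base P"
  shows "measure unit_law {u. P (fst u)} = base.prob {\<omega>. P \<omega>}" "{u. P (fst u)} \<in> sets unit_law"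
proof -
  have P: "{\<omega>. P \<omega>} \<in> sets base" using assms by (simp add: pred_def)
  have U: "UNIV \<in> sets exp_law" by simp
  have eq: "{u. P (fst u)} = {\<omega>. P \<omega>} \<times> (UNIV :: real set)" by auto
  show "{u. P (fst u)} \<in> sets unit_law" unfolding eq using P U by (rule pair_measureI)
  have "emeasure unit_law {u. P (fst u)} = emeasure base {\<omega>. P \<omega>} * emeasure exp_law UNIV"
    unfolding eq by (rule exp.emeasure_pair_measure_Times[OF P U])
  also have "emeasure exp_law UNIV = 1" using exp.emeasure_space_1 by simp
  finally show "measure unit_law {u. P (fst u)} = base.prob {\<omega>. P \<omega>}"
    by (simp add: measure_def)
qed

lemma prob_all_children:
  assumes P: "Measurable.pred base P"
  shows "base.prob {\<omega>. \<forall>i<fst \<omega> [0]. P (shift [i, 0] \<omega>)} =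
    measure_pmf.expectation \<mu> (\<lambda>k. base.prob {\<omega>. P \<omega>} ^ k)"
proof -
  interpret U: prob_space units_law
    by (intro prob_space_PiM units.prob_space_axioms)
  let ?B = "{u. P (fst u)}"
  let ?Q = "\<lambda>k x. \<forall>i\<in>Suc ` {..<k}. x i \<in> ?B"
  have B: "?B \<in> sets unit_law" by (rule measure_unit_fst(2)[OF P])
  have S: "{x. ?Q k x} \<in> sets units_law" for k
  proof -
    have "{x \<in> space units_law. \<forall>i\<in>Suc ` {..<k}. x i \<in> ?B} \<in> sets units_law" using B by measurable
    then show ?thesis by (simp add: space_units)
  qed
  have "measure units_law {x. ?Q k x} = base.prob {\<omega>. P \<omega>} ^ k" for k
  proof -
    have "emeasure units_law {x. ?Q k x} = (\<Prod>i\<in>Suc ` {..<k}. emeasure unit_law ?B)"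
      by (rule emeasure_PiM_cylinder[OF units.prob_space_axioms space_unit]) (use B in auto)
    then have "measure units_law {x. ?Q k x} = measure unit_law ?B ^ k"
      by (simp add: card_image U.emeasure_eq_measure units.emeasure_eq_measure ennreal_power)
    then show ?thesis by (simp add: measure_unit_fst[OF P])
  qed
  moreover have "{\<omega>. \<forall>i<fst \<omega> [0]. P (shift [i, 0] \<omega>)} = {\<omega>. ?Q (fst \<omega> [0]) (unit_at 0 1 \<omega>)}"
    by (auto simp: unit_root_def)
  ultimately show ?thesis
    using prob_neighbourhood[of 0 1 ?Q, OF _ S] by simp
qed

text \<open>Subtracting a finite weight cannot remove an infinite value, so the cost of a branch is
  infinite exactly when the costs of all its child branches are. Thus \<open>q\<close> is a fixed
  point of the generating function, and the positive probability of cost 0 keeps it below 1.\<close>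

lemma AE_branch_lim_finite: "AE \<omega> in base. \<forall>v. branch_lim v \<omega> < \<top>"
proof -
  define q where "q = base.prob {\<omega>. branch_lim [] \<omega> = \<top>}"
  have P: "Measurable.pred base (\<lambda>\<omega>. branch_lim [] \<omega> = \<top>)" by measurable
  moreover have "Measurable.pred base (\<lambda>\<omega>. branch_lim [] \<omega> = 0)" by measurable
  ultimately have sets: "{\<omega>. branch_lim [] \<omega> = \<top>} \<in> sets base" "{\<omega>. branch_lim [] \<omega> = 0} \<in> sets base"
    by (simp_all add: pred_def)
  have "q = base.prob {\<omega>. branch_lim [0] \<omega> = \<top>}"
    using prob_shift[OF P, of "[0]"] by (simp add: q_def branch_lim_shift)
  also have "{\<omega>. branch_lim [0] \<omega> = \<top>} = {\<omega>. \<forall>i<fst \<omega> [0]. branch_lim [] (shift [i, 0] \<omega>) = \<top>}"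
    by (subst branch_lim_rec) (auto simp: exit_cost_def branch_lim_shift INF_top_conv)
  also have "base.prob \<dots> = measure_pmf.expectation \<mu> (\<lambda>k. q ^ k)"
    unfolding q_def by (rule prob_all_children[OF P])
  finally have "q = measure_pmf.expectation \<mu> (\<lambda>k. q ^ k)" .
  moreover have "q + cut_prob \<le> 1"
  proof -
    have "q + cut_prob = base.prob ({\<omega>. branch_lim [] \<omega> = \<top>} \<union> {\<omega>. branch_lim [] \<omega> = 0})"
      unfolding q_def cut_prob_def by (rule base.finite_measure_Union[symmetric, OF sets]) auto
    then show ?thesis by simp
  qed
  ultimately have "q = 0"
    using zero_one[of q] cut_prob_pos by (simp add: q_def)
  then have "AE \<omega> in base. \<not> branch_lim [] \<omega> = \<top>"
    using base.prob_eq_0[OF sets(1)] by (simp add: q_def)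
  then have "AE \<omega> in base. branch_lim v \<omega> < \<top>" for v
    using AE_shift[of "\<lambda>\<omega>. \<not> branch_lim [] \<omega> = \<top>" v] by (simp add: branch_lim_shift less_top)
  then show ?thesis by (simp add: AE_all_countable)
qed


section \<open>Absence of infinite rays of positive cost\<close>

definition inf_ray :: "nat list \<Rightarrow> config \<Rightarrow> bool" where
  "inf_ray v \<omega> \<longleftrightarrow> (\<forall>n. ray n v \<omega>)"

lemma inf_ray_iff: "inf_ray v \<omega> \<longleftrightarrow> (\<exists>i<fst \<omega> v. 0 < branch_lim (i # v) \<omega> \<and> inf_ray (i # v) \<omega>)"
  unfolding inf_ray_def by (rule ray_all_iff)

lemma inf_ray_shift: "inf_ray u (shift v \<omega>) \<longleftrightarrow> inf_ray (u @ v) \<omega>"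
  by (simp add: inf_ray_def ray_shift)

lemma measurable_inf_ray [measurable]: "Measurable.pred base (inf_ray v)"
  unfolding inf_ray_def[abs_def] by measurable

text \<open>What is excluded is a ray that still has positive cost on entering \<open>v\<close> from
  its parent. Hence \<open>inf_ray\<close> fails at a vertex exactly when all its children are
  clean.\<close>

definition clean :: "nat list \<Rightarrow> config \<Rightarrow> bool" where
  "clean v \<omega> \<longleftrightarrow> \<not> (0 < branch_lim v \<omega> \<and> inf_ray v \<omega>)"

lemma clean_shift: "clean u (shift v \<omega>) \<longleftrightarrow> clean (u @ v) \<omega>"
  by (simp add: clean_def branch_lim_shift inf_ray_shift)

lemma measurable_clean [measurable]: "Measurable.pred base (clean v)"
  unfolding clean_def[abs_def] by measurable

abbreviation into_branch :: "nat \<Rightarrow> nat \<Rightarrow> config set" where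
  "into_branch s t \<equiv> {\<omega>. ennreal (snd \<omega> ([s], [])) + branch_lim [t] \<omega> < exit_cost branch_lim [s] \<omega> \<and>
     \<not> inf_ray [s] \<omega> \<and> clean [t] \<omega>}"

lemma sets_into_branch: "into_branch s t \<in> sets base"
proof -
  have "{\<omega> \<in> space base. ennreal (snd \<omega> ([s], [])) + branch_lim [t] \<omega> < exit_cost branch_lim [s] \<omega> \<and>
     \<not> inf_ray [s] \<omega> \<and> clean [t] \<omega>} \<in> sets base" by measurable
  then show ?thesis by simp
qed

text \<open>If all units are clean and unit 0 is strictly the cheapest, then \<open>[s]\<close>
  exits into \<open>[t]\<close>, and its clean children leave no infinite ray from
  \<open>[s]\<close>. A lower bound is what the second run of the joining argument needs.\<close>

lemma prob_into_branch_clean_ge: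
  assumes "s \<noteq> t"
  shows "psi (base.prob {\<omega>. clean [] \<omega>}) \<le> base.prob (into_branch s t)"
proof -
  let ?B = "{u. clean [] (fst u)}"
  have fin: "AE \<beta> in base. branch_lim [] \<beta> < \<top>"
    using AE_branch_lim_finite by eventually_elim simp
  have B: "?B \<in> sets unit_law" "measure unit_law ?B = base.prob {\<omega>. clean [] \<omega>}"
    using measure_unit_fst[OF measurable_clean] by simp_all
  have "psi (base.prob {\<omega>. clean [] \<omega>}) = base.prob {\<omega>. \<forall>i\<in>{..fst \<omega> [s]}. unit_at s t \<omega> i \<in> ?B \<and>
      (i \<noteq> 0 \<longrightarrow> unit_cost (branch_lim []) (unit_at s t \<omega> 0) < unit_cost (branch_lim []) (unit_at s t \<omega> i))}"
    using prob_first(1)[OF assms measurable_branch_lim fin B(1)] B(2) by simp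
  also have "\<dots> \<le> base.prob (into_branch s t)"
  proof (rule base.finite_measure_mono_AE[OF _ sets_into_branch])
    show "AE \<omega> in base. \<omega> \<in> {\<omega>. \<forall>i\<in>{..fst \<omega> [s]}. unit_at s t \<omega> i \<in> ?B \<and>
      (i \<noteq> 0 \<longrightarrow> unit_cost (branch_lim []) (unit_at s t \<omega> 0) < unit_cost (branch_lim []) (unit_at s t \<omega> i))}
      \<longrightarrow> \<omega> \<in> into_branch s t"
      using AE_all_offspring_pos
    proof (eventually_elim, intro impI CollectI)
      fix \<omega> :: config
      assume pos: "\<forall>v. 1 \<le> fst \<omega> v"
        and "\<omega> \<in> {\<omega>. \<forall>i\<in>{..fst \<omega> [s]}. unit_at s t \<omega> i \<in> ?B \<and>
      (i \<noteq> 0 \<longrightarrow> unit_cost (branch_lim []) (unit_at s t \<omega> 0) < unit_cost (branch_lim []) (unit_at s t \<omega> i))}"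
      then have good: "\<And>i. i \<le> fst \<omega> [s] \<Longrightarrow> unit_at s t \<omega> i \<in> ?B"
        and less: "\<And>i. i < fst \<omega> [s] \<Longrightarrow>
          unit_cost (branch_lim []) (unit_at s t \<omega> 0) < unit_cost (branch_lim []) (unit_at s t \<omega> (Suc i))"
        by auto
      \<comment> \<open>A child exists, so the infimum is attained and the comparison with it stays
        strict.\<close>
      have "0 \<in> {..<fst \<omega> [s]}" using pos[rule_format, of "[s]"] by simp
      then have "{..<fst \<omega> [s]} \<noteq> {}" by blast
      then obtain i where i: "i \<in> {..<fst \<omega> [s]}"
        "unit_cost (branch_lim []) (unit_at s t \<omega> (Suc i)) = exit_cost branch_lim [s] \<omega>"
        using INF_attained[of "{..<fst \<omega> [s]}" "\<lambda>i. unit_cost (branch_lim []) (unit_at s t \<omega> (Suc i))"]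
          exit_cost_units[of "branch_lim []" branch_lim s \<omega> t]
        by (auto simp: branch_lim_shift)
      have "ennreal (snd \<omega> ([s], [])) + branch_lim [t] \<omega> < exit_cost branch_lim [s] \<omega>"
        using less[of i] i by (simp add: unit_root_def unit_edge_def branch_lim_shift)
      moreover have "clean [t] \<omega>"
        using good[of 0] by (simp add: unit_root_def clean_shift)
      moreover have "clean [i, s] \<omega>" if "i < fst \<omega> [s]" for i
        using good[of "Suc i"] that by (simp add: unit_root_def clean_shift)
      then have "\<not> inf_ray [s] \<omega>"
        unfolding inf_ray_iff[of "[s]"] clean_def by blast
      ultimately show "ennreal (snd \<omega> ([s], [])) + branch_lim [t] \<omega> < exit_cost branch_lim [s] \<omega> \<and>
        \<not> inf_ray [s] \<omega> \<and> clean [t] \<omega>" by blast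
    qed
  qed
  finally show ?thesis .
qed

text \<open>The same splitting, restricted to the event that both endpoints are clean, gives
  \<open>h\<^sup>2 - 2 * psi h \<ge> cut_prob\<^sup>2 \<ge> 1 - 2 * psi 1\<close>, which forces \<open>h = 1\<close>.\<close>
lemma AE_clean: "AE \<omega> in base. \<forall>v. clean v \<omega>"
proof -
  define h where "h = base.prob {\<omega>. clean [] \<omega>}"
  let ?E0 = "{\<omega>. branch_lim [0] \<omega> = 0 \<and> branch_lim [1] \<omega> = 0}"
  let ?H = "{\<omega>. clean [0] \<omega> \<and> clean [1] \<omega>}"
  have E0: "?E0 \<in> sets base"
  proof -
    have "{\<omega> \<in> space base. branch_lim [0] \<omega> = 0 \<and> branch_lim [1] \<omega> = 0} \<in> sets base" by measurable
    then show ?thesis by simp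
  qed
  have H: "?H \<in> sets base"
  proof -
    have "{\<omega> \<in> space base. clean [0] \<omega> \<and> clean [1] \<omega>} \<in> sets base" by measurable
    then show ?thesis by simp
  qed
  \<comment> \<open>This strict order makes the two exit events exclude each other and the event
    that both costs vanish. On all three events both branches are clean.\<close>
  have lt: "branch_lim [t] \<omega> < branch_lim [s] \<omega>" if "\<omega> \<in> into_branch s t" for s t \<omega>
  proof -
    have "ennreal (snd \<omega> ([s], [])) + branch_lim [t] \<omega> < exit_cost branch_lim [s] \<omega>" using that by simp
    then have "branch_lim [t] \<omega> < exit_cost branch_lim [s] \<omega> - ennreal (snd \<omega> ([s], []))"
      by (simp add: less_diff_eq_ennreal add.commute)
    also have "\<dots> = branch_lim [s] \<omega>" using branch_lim_rec[of "[s]" \<omega>] by simp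
    finally show ?thesis .
  qed
  have "cut_prob\<^sup>2 + 2 * psi h \<le> base.prob ?E0 + base.prob (into_branch 0 1) + base.prob (into_branch 1 0)"
    using prob_into_branch_clean_ge[of 0 1] prob_into_branch_clean_ge[of 1 0]
      prob_shift_pair[of 0 1 "\<lambda>\<omega>. branch_lim [] \<omega> = 0" "\<lambda>\<omega>. branch_lim [] \<omega> = 0"]
    by (simp add: branch_lim_shift power2_eq_square h_def cut_prob_def)
  also have "\<dots> = base.prob (?E0 \<union> into_branch 0 1 \<union> into_branch 1 0)"
  proof -
    have "False" if "\<omega> \<in> ?E0" "\<omega> \<in> into_branch 0 1" for \<omega>
      using lt[OF that(2)] that(1) by simp
    moreover have "False" if "\<omega> \<in> ?E0" "\<omega> \<in> into_branch 1 0" for \<omega>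
      using lt[OF that(2)] that(1) by simp
    moreover have "False" if "\<omega> \<in> into_branch 0 1" "\<omega> \<in> into_branch 1 0" for \<omega>
      using less_asym[OF lt[OF that(1)] lt[OF that(2)]] .
    ultimately have disj: "?E0 \<inter> into_branch 0 1 = {}" "(?E0 \<union> into_branch 0 1) \<inter> into_branch 1 0 = {}"
      by blast+
    show ?thesis
      unfolding base.finite_measure_Union[OF sets.Un[OF E0 sets_into_branch] sets_into_branch disj(2)]
        base.finite_measure_Union[OF E0 sets_into_branch disj(1)] ..
  qed
  also have "\<dots> \<le> base.prob ?H"
    by (rule base.finite_measure_mono[OF _ H]) (auto simp: clean_def)
  also have "\<dots> = h\<^sup>2"
    using prob_shift_pair[of 0 1 "clean []" "clean []"]
    by (simp add: clean_shift power2_eq_square h_def)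
  finally have "1 - 2 * psi 1 \<le> h\<^sup>2 - 2 * psi h" using cut_prob_ge by simp
  then have "\<not> h < 1" using psi_strict[of h] by (auto simp: h_def)
  then have "h = 1" unfolding h_def using base.prob_le_1 by (simp add: order_antisym_conv not_less)
  moreover have "{\<omega>. clean [] \<omega>} \<in> sets base" using measurable_clean by (simp add: pred_def)
  ultimately have "AE \<omega> in base. clean [] \<omega>"
    using base.prob_eq_1[of "{\<omega>. clean [] \<omega>}"] by (simp add: h_def)
  then have "AE \<omega> in base. clean v \<omega>" for v
    using AE_shift[of "clean []" v] by (simp add: clean_shift)
  then show ?thesis by (simp add: AE_all_countable)
qed

text \<open>Units 1 and 2 are the first two children of \<open>[0]\<close>. Both costs vanish with
  probability \<open>cut_prob^2\<close>, the edge to the first child is the lighter one in half of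
  these cases by symmetry, and \<open>Z >= 2\<close> has positive probability.\<close>

lemma prob_cut_vertex_pos: "0 < base.prob {\<omega>. cut_vertex [0] \<omega>}"
proof -
  let ?B = "{u. branch_lim [] (fst u) = 0}"
  let ?R = "\<lambda>x. \<forall>i\<in>{1, 2::nat}. x i \<in> ?B \<and> (i \<noteq> 1 \<longrightarrow> ennreal (snd (x 1)) < ennreal (snd (x i)))"
  let ?Q = "\<lambda>k x. (2::nat) \<le> k \<and> ?R x"
  have pred: "Measurable.pred base (\<lambda>\<omega>. branch_lim [] \<omega> = 0)" by measurable
  note B = measure_unit_fst[OF pred]
  have f: "(\<lambda>u. ennreal (snd u)) \<in> borel_measurable unit_law" by measurable
  have atomless: "AE u in unit_law. ennreal (snd u) \<noteq> t" for t
    using unit_sum_atomless[of "\<lambda>_. 0" t] by simp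
  have R: "measure units_law {x. ?R x} = cut_prob\<^sup>2 / 2"
    using measure_strict_min(1)[OF units.prob_space_axioms space_unit f B(2) atomless, of "{1, 2}" 1] B(1)
    by (simp add: cut_prob_def power2_eq_square)
  have "{x \<in> space units_law. ?R x} \<in> sets units_law" using f B(2) by measurable
  then have sets_R: "{x. ?R x} \<in> sets units_law" by (simp add: space_units)
  have "{x. ?Q k x} = (if 2 \<le> k then {x. ?R x} else {})" for k by auto
  then have S: "{x. ?Q k x} \<in> sets units_law"
    and M: "measure units_law {x. ?Q k x} = (if 2 \<le> k then cut_prob\<^sup>2 / 2 else 0)" for k
    using sets_R R by simp_all
  have "0 < measure_pmf.expectation \<mu> (\<lambda>k. if 2 \<le> k then cut_prob\<^sup>2 / 2 else 0)"
    using cut_prob_pos by (intro expectation_pos[where C = "cut_prob\<^sup>2"]) auto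
  also have "\<dots> = measure_pmf.expectation \<mu> (\<lambda>k. measure units_law {x. ?Q k x})"
    unfolding M ..
  also have "\<dots> = base.prob {\<omega>. ?Q (fst \<omega> [0]) (unit_at 0 1 \<omega>)}"
    by (rule prob_neighbourhood[of 0 1 ?Q, OF _ S, symmetric]) simp
  also have "{\<omega>. ?Q (fst \<omega> [0]) (unit_at 0 1 \<omega>)} = {\<omega>. cut_vertex [0] \<omega>}"
    by (auto simp: cut_vertex_def unit_root_def unit_edge_def branch_lim_shift numeral_2_eq_2)
  finally show ?thesis .
qed

text \<open>Having no cut vertex at or below a vertex is inherited by all its children, whence
  \<open>q <= E(q^Z)\<close>; a cut vertex at the start has positive probability, whence
  \<open>q < 1\<close>.\<close>

lemma AE_cut_below: "AE \<omega> in base. \<forall>v. \<exists>n. \<not> no_cut n v \<omega>"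
proof -
  let ?P = "\<lambda>v \<omega>. \<forall>n. no_cut n v \<omega>"
  define q where "q = base.prob {\<omega>. ?P [] \<omega>}"
  have P [measurable]: "Measurable.pred base (?P v)" for v by measurable
  have q: "q = base.prob {\<omega>. ?P [0] \<omega>}"
    using prob_shift[OF P[of "[]"], of "[0]"] by (simp add: q_def no_cut_shift)
  have S1: "{\<omega>. \<forall>i<fst \<omega> [0]. ?P [] (shift [i, 0] \<omega>)} \<in> sets base"
  proof -
    have "{\<omega> \<in> space base. \<forall>i. i < fst \<omega> [0] \<longrightarrow> ?P [i, 0] \<omega>} \<in> sets base" by measurable
    then show ?thesis by (simp add: no_cut_shift)
  qed
  have S2: "{\<omega>. \<not> cut_vertex [0] \<omega>} \<in> sets base" "{\<omega>. cut_vertex [0] \<omega>} \<in> sets base"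
  proof -
    have "{\<omega> \<in> space base. \<not> cut_vertex [0] \<omega>} \<in> sets base" "{\<omega> \<in> space base. cut_vertex [0] \<omega>} \<in> sets base"
      by measurable
    then show "{\<omega>. \<not> cut_vertex [0] \<omega>} \<in> sets base" "{\<omega>. cut_vertex [0] \<omega>} \<in> sets base" by simp_all
  qed
  have "q \<le> base.prob {\<omega>. \<forall>i<fst \<omega> [0]. ?P [] (shift [i, 0] \<omega>)}"
    unfolding q
  proof (rule base.finite_measure_mono[OF _ S1], intro subsetI CollectI allI impI)
    fix \<omega> :: config and i n
    assume "\<omega> \<in> {\<omega>. ?P [0] \<omega>}" "i < fst \<omega> [0]"
    then have "no_cut (Suc n) [0] \<omega>" by blast
    then show "no_cut n [] (shift [i, 0] \<omega>)" using \<open>i < fst \<omega> [0]\<close> by (simp add: no_cut_shift)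
  qed
  also have "\<dots> = measure_pmf.expectation \<mu> (\<lambda>k. q ^ k)"
    unfolding q_def by (rule prob_all_children[OF P])
  finally have "q \<le> measure_pmf.expectation \<mu> (\<lambda>k. q ^ k)" .
  moreover have "q < 1"
  proof -
    have "q \<le> base.prob {\<omega>. \<not> cut_vertex [0] \<omega>}"
      unfolding q
    proof (rule base.finite_measure_mono[OF _ S2(1)], intro subsetI CollectI)
      fix \<omega> :: config assume "\<omega> \<in> {\<omega>. ?P [0] \<omega>}"
      then have "no_cut (Suc 0) [0] \<omega>" by blast
      then show "\<not> cut_vertex [0] \<omega>" by simp
    qed
    also have "\<dots> = 1 - base.prob {\<omega>. cut_vertex [0] \<omega>}"
      using base.prob_compl[OF S2(2)] by (simp add: Compl_eq_Diff_UNIV[symmetric] Collect_neg_eq)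
    finally show ?thesis using prob_cut_vertex_pos by simp
  qed
  ultimately have "q = 0" using zero_one[of q] by (simp add: q_def)
  moreover have "{\<omega>. ?P [] \<omega>} \<in> sets base" using P[of "[]"] by (simp add: pred_def)
  ultimately have "AE \<omega> in base. \<not> ?P [] \<omega>"
    using base.prob_eq_0[of "{\<omega>. ?P [] \<omega>}"] by (simp add: q_def)
  then have "AE \<omega> in base. \<not> ?P v \<omega>" for v
    using AE_shift[of "\<lambda>\<omega>. \<not> ?P [] \<omega>" v] by (simp add: no_cut_shift)
  then show ?thesis by (simp add: AE_all_countable)
qed

end

section \<open>The limit forest\<close>

lemma Cons_in_tverts: "i # v \<in> tverts aug Z \<longleftrightarrow> v \<in> tverts aug Z \<and> i < nchildren aug Z v"
  by (auto elim: tverts.cases intro: tverts.child)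

lemma labelled_tree_tverts: "labelled_tree (tverts aug Z)"
proof
  show "[] \<in> tverts aug Z" by (rule tverts.root)
  show "tl v \<in> tverts aug Z" if "v \<in> tverts aug Z" for v
    using that by cases (simp_all add: tverts.root)
  show "finite {i. i # v \<in> tverts aug Z}" for v
    by (rule finite_subset[of _ "{..<nchildren aug Z v}"]) (auto simp: Cons_in_tverts)
qed

abbreviation tree_lim :: "bool \<Rightarrow> nat list \<Rightarrow> nat list \<Rightarrow> config \<Rightarrow> ennreal" where
  "tree_lim aug x v \<omega> \<equiv> detour_lim (nbrs (tverts aug (fst \<omega>))) (snd \<omega>) x v"

lemma nbrs_tverts:
  assumes "y \<in> tverts aug (fst \<omega>)" "y \<noteq> []"
  shows "nbrs (tverts aug (fst \<omega>)) y (tl y) = child_nbrs \<omega> y v"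
proof -
  interpret labelled_tree "tverts aug (fst \<omega>)" by (rule labelled_tree_tverts)
  have n: "nchildren aug (fst \<omega>) y = fst \<omega> y" using assms(2) by (simp add: nchildren_def)
  show ?thesis
  proof (intro set_eqI iffI)
    fix z assume "z \<in> nbrs (tverts aug (fst \<omega>)) y (tl y)"
    then have z: "adj y z" "z \<noteq> tl y" by (auto simp: nbrs_def)
    from z(1) show "z \<in> child_nbrs \<omega> y v"
      by (cases rule: adj_cases) (use z adj_in[OF z(1)] n in \<open>auto simp: Cons_in_tverts\<close>)
  next
    fix z assume "z \<in> child_nbrs \<omega> y v"
    then obtain i where i: "z = i # y" "i < fst \<omega> y" by auto
    then have "z \<in> tverts aug (fst \<omega>)" using n assms(1) by (simp add: Cons_in_tverts)
    moreover have "z \<noteq> tl y" using i by (auto dest: arg_cong[of _ _ length])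
    ultimately show "z \<in> nbrs (tverts aug (fst \<omega>)) y (tl y)"
      using i assms(1) by (auto simp: nbrs_def tree_adj_def)
  qed
qed

text \<open>The extra child of the augmented tree sits at the root, which the branch of
  \<open>y\<close> never reaches, so the results on branches serve both trees.\<close>

lemma tree_lim_down:
  assumes "y \<in> tverts aug (fst \<omega>)" "y \<noteq> []"
  shows "tree_lim aug y (tl y) \<omega> = branch_lim y \<omega>"
proof -
  have "detour (nbrs (tverts aug (fst \<omega>))) (snd \<omega>) k y (tl y) = branch_cost k y \<omega>" for k
    using assms
  proof (induction k arbitrary: y)
    case (Suc k)
    have "i # y \<in> tverts aug (fst \<omega>)" if "i < fst \<omega> y" for i
      using Suc.prems that by (simp add: Cons_in_tverts nchildren_def)
    then have "detour (nbrs (tverts aug (fst \<omega>))) (snd \<omega>) k (i # y) y = branch_cost k (i # y) \<omega>"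
      if "i < fst \<omega> y" for i
      using Suc.IH[of "i # y"] that by simp
    then show ?case
      by (simp add: branch_cost_Suc exit_cost_def nbrs_tverts[OF Suc.prems] image_image)
  qed (simp add: branch_cost_0)
  then show ?thesis by (simp add: detour_lim_def branch_lim_SUP)
qed

context gw_base
begin

lemma measurable_in_tverts [measurable]: "Measurable.pred base (\<lambda>\<omega>. v \<in> tverts aug (fst \<omega>))"
proof (induction v)
  case Nil
  show ?case by (simp add: tverts.root)
next
  case (Cons i v)
  note [measurable] = Cons.IH
  show ?case unfolding Cons_in_tverts nchildren_def by measurable
qed

lemma measurable_tree_adj [measurable]: "Measurable.pred base (\<lambda>\<omega>. tree_adj (tverts aug (fst \<omega>)) u v)"
  unfolding tree_adj_def by measurable

lemma measurable_tree_detour: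
  "(\<lambda>\<omega>. detour (nbrs (tverts aug (fst \<omega>))) (snd \<omega>) k x v) \<in> borel_measurable base"
proof (induction k arbitrary: x v)
  case (Suc k)
  note [measurable] = Suc.IH
  let ?N = "\<lambda>\<omega>. nbrs (tverts aug (fst \<omega>)) x v"
  have "Measurable.pred base (\<lambda>\<omega>. tree_adj (tverts aug (fst \<omega>)) x y \<and> y \<noteq> v)" for y
    by measurable
  then have N: "Measurable.pred base (\<lambda>\<omega>. y \<in> ?N \<omega>)" for y
    by (simp add: nbrs_def)
  have f: "(\<lambda>\<omega>. ennreal (snd \<omega> (x, y)) + detour (nbrs (tverts aug (fst \<omega>))) (snd \<omega>) k y x)
      \<in> borel_measurable base" for y
    by measurable
  have "(\<lambda>\<omega>. if y \<in> ?N \<omega> then ennreal (snd \<omega> (x, y)) + detour (nbrs (tverts aug (fst \<omega>))) (snd \<omega>) k y x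
      else \<top>) \<in> borel_measurable base" for y
    by (rule measurable_If[OF f]) (use N[of y] in \<open>simp_all add: pred_def\<close>)
  then have "(\<lambda>\<omega>. INF y. if y \<in> ?N \<omega> then ennreal (snd \<omega> (x, y)) +
      detour (nbrs (tverts aug (fst \<omega>))) (snd \<omega>) k y x else \<top>) \<in> borel_measurable base"
    by (intro borel_measurable_INF) auto
  then have "(\<lambda>\<omega>. INF y\<in>?N \<omega>. ennreal (snd \<omega> (x, y)) +
      detour (nbrs (tverts aug (fst \<omega>))) (snd \<omega>) k y x) \<in> borel_measurable base"
    by (simp only: INF_restrict[symmetric])
  then show ?case unfolding detour.simps by (rule borel_measurable_minus_ennreal) measurable
qed simp

lemma measurable_tree_lim [measurable]: "tree_lim aug x v \<in> borel_measurable base"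
  unfolding detour_lim_def using measurable_tree_detour by measurable

text \<open>Resample the weight of \<open>(v, x)\<close> alone. Neither detour cost reads an edge
  leaving \<open>v\<close>, so this weight enters only as one summand on one side, and its
  continuous law misses the single value that would give equality.\<close>

lemma AE_no_tie:
  assumes "x \<noteq> x'"
  shows "AE \<omega> in base. tree_adj (tverts aug (fst \<omega>)) v x \<longrightarrow> tree_adj (tverts aug (fst \<omega>)) v x' \<longrightarrow>
    tree_lim aug x v \<omega> < \<top> \<longrightarrow>
    ennreal (snd \<omega> (v, x)) + tree_lim aug x v \<omega> \<noteq> ennreal (snd \<omega> (v, x')) + tree_lim aug x' v \<omega>"
    (is "AE \<omega> in base. ?P \<omega>")
proof -
  have P: "{\<omega> \<in> space base. ?P \<omega>} \<in> sets base"
  proof (intro sets.sets_Collect_imp)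
    show "{\<omega> \<in> space base. ennreal (snd \<omega> (v, x)) + tree_lim aug x v \<omega> \<noteq>
        ennreal (snd \<omega> (v, x')) + tree_lim aug x' v \<omega>} \<in> sets base"
      by (rule borel_measurable_neq) measurable
  qed measurable
  then have P': "{\<omega> \<in> space (offspring_space \<Otimes>\<^sub>M weight_space). ?P \<omega>} \<in> sets (offspring_space \<Otimes>\<^sub>M weight_space)"
    by (simp add: base_space_def)
  show ?thesis
    unfolding base_space_def
  proof (rule AE_pair_measure[OF P'], rule AE_I2)
    fix Z assume Z: "Z \<in> space offspring_space"
    show "AE W in weight_space. ?P (Z, W)"
    proof (rule AE_PiM_fun_upd[where i = "(v, x)"])
      show "{W \<in> space weight_space. ?P (Z, W)} \<in> sets weight_space"
      proof -
        have "{W \<in> space weight_space. ?P (Z, W)} =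
            Pair Z -` {\<omega> \<in> space (offspring_space \<Otimes>\<^sub>M weight_space). ?P \<omega>}"
          using Z by (auto simp: space_pair_measure)
        then show ?thesis using sets_Pair1[OF P'] by simp
      qed
      fix X :: "nat list \<times> nat list \<Rightarrow> real"
      let ?V = "tverts aug Z"
      interpret labelled_tree ?V by (rule labelled_tree_tverts)
      have same: "detour_lim (nbrs ?V) (X((v, x) := w)) y v = detour_lim (nbrs ?V) X y v"
        if "tree_adj ?V v y" for y w
      proof -
        have "v \<notin> branch_ball (nbrs ?V) k y v" for k
          using not_in_branch_ball that adj_sym by blast
        then show ?thesis unfolding detour_lim_def
          by (intro SUP_cong refl detour_cong) auto
      qed
      show "AE w in exp_law. ?P (Z, X((v, x) := w))"
      proof (cases "tree_adj ?V v x \<and> tree_adj ?V v x' \<and> detour_lim (nbrs ?V) X x v < \<top>")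
        case False
        then show ?thesis using same by (auto intro!: AE_I2)
      next
        case True
        then have "AE w in exp_law. ennreal w + detour_lim (nbrs ?V) X x v \<noteq>
            ennreal (X (v, x')) + detour_lim (nbrs ?V) X x' v"
          by (intro AE_exp_law_add_neq) simp
        then show ?thesis
          by eventually_elim (use True same assms in auto)
      qed
    qed (rule prob_space_exp_law)
  qed
qed

end

section \<open>Almost sure verification of the forest conditions\<close>

context supercritical_gw
begin

lemma AE_limit_forest:
  "AE \<omega> in base. \<exists>F. best_exit_forest (tverts aug (fst \<omega>)) (snd \<omega>) F"
proof -
  have ties: "AE \<omega> in base. \<forall>x x' v. x \<noteq> x' \<longrightarrow>
      tree_adj (tverts aug (fst \<omega>)) v x \<longrightarrow> tree_adj (tverts aug (fst \<omega>)) v x' \<longrightarrow>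
      tree_lim aug x v \<omega> < \<top> \<longrightarrow>
      ennreal (snd \<omega> (v, x)) + tree_lim aug x v \<omega> \<noteq> ennreal (snd \<omega> (v, x')) + tree_lim aug x' v \<omega>"
    using AE_no_tie by (simp add: AE_all_countable)
  show ?thesis
    using ties AE_all_offspring_pos AE_all_weight_pos AE_branch_lim_finite AE_clean AE_cut_below
  proof eventually_elim
    case (elim \<omega>)
    let ?V = "tverts aug (fst \<omega>)" and ?W = "snd \<omega>"
    interpret weighted_tree ?V ?W
      using labelled_tree_tverts elim(3)
      by (auto simp: weighted_tree_def weighted_tree_axioms_def intro: less_imp_le)
    note ties = elim(1) and pos = elim(2) and fin = elim(4) and clean = elim(5) and cut = elim(6)
    have nch: "nchildren aug (fst \<omega>) v = fst \<omega> v" if "v \<noteq> []" for v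
      using that by (simp add: nchildren_def)
    have first_child: "0 # v \<in> ?V" if "v \<in> ?V" for v
      using that pos[rule_format, of v] by (simp add: Cons_in_tverts nchildren_def)
    have down: "dl y (tl y) = branch_lim y \<omega>" if "y \<in> ?V" "y \<noteq> []" for y
      using tree_lim_down[OF that] .
    have "\<exists>a. best_exit v a" if v: "v \<in> ?V" for v
    proof -
      let ?f = "\<lambda>b. ennreal (?W (v, b)) + dl b v"
      have c: "adj v (0 # v)" using v first_child by (simp add: tree_adj_def)
      then have "{b. adj v b} \<noteq> {}" by blast
      then obtain a where a: "adj v a" "?f a = (INF b\<in>{b. adj v b}. ?f b)"
        using INF_attained[OF finite_adj, of v ?f] by auto
      have min: "?f a \<le> ?f b" if "adj v b" for b
        unfolding a(2) using that by (intro INF_lower) simp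
      \<comment> \<open>Finiteness has been shown only for branches seen from their parents; one
        child suffices to make the minimum over all exits finite.\<close>
      have "dl (0 # v) v < \<top>" using down[of "0 # v"] first_child[OF v] fin by simp
      then have "?f (0 # v) < \<top>" by simp
      with min[OF c] have top: "?f a < \<top>" by (rule le_less_trans)
      have "?f a < ?f b" if "adj v b" "b \<noteq> a" for b
        using min[OF that(1)] ties[rule_format, of a b v] that a(1) top by (simp add: order_less_le)
      then show ?thesis using a(1) top by (auto simp: best_exit_def)
    qed
    then obtain F where F: "\<And>v. v \<in> ?V \<Longrightarrow> best_exit v (F v)" by metis
    have "best_exit_forest ?V ?W F"
    proof
      show "best_exit v (F v)" if "v \<in> ?V" for v using F that .
    next
      fix p
      show "\<not> (\<forall>n. p n \<in> ?V \<and> p (Suc n) \<noteq> [] \<and> tl (p (Suc n)) = p n \<and> 0 < dl (p (Suc n)) (p n))"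
      proof
        assume p: "\<forall>n. p n \<in> ?V \<and> p (Suc n) \<noteq> [] \<and> tl (p (Suc n)) = p n \<and> 0 < dl (p (Suc n)) (p n)"
        have bl: "0 < branch_lim (p (Suc n)) \<omega>" for n
          using p[rule_format, of n] down[of "p (Suc n)"] p[rule_format, of "Suc n"] by simp
        \<comment> \<open>Starting at \<open>p 1\<close> avoids the root, where the augmented tree
          has one child more than \<open>ray\<close> counts.\<close>
        have "ray n (p (Suc m)) \<omega>" for n m
        proof (induction n arbitrary: m)
          case (Suc n)
          obtain i where i: "p (Suc (Suc m)) = i # p (Suc m)"
            using p[rule_format, of "Suc m"] by (metis list.collapse)
          have "i # p (Suc m) \<in> ?V" using p[rule_format, of "Suc (Suc m)"] i by simp
          then have "i < fst \<omega> (p (Suc m))"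
            using nch[of "p (Suc m)"] p[rule_format, of m] by (simp add: Cons_in_tverts)
          then show ?case using bl[of "Suc m"] Suc[of "Suc m"] i by auto
        qed simp
        then have "inf_ray (p 1) \<omega>" by (simp add: inf_ray_def)
        then show False using clean[rule_format, of "p 1"] bl[of 0] by (simp add: clean_def)
      qed
    next
      let ?Y = "{y \<in> ?V. y \<noteq> [] \<and> dl y (tl y) = 0 \<and> dl (tl y) y = 0}"
      have below: "\<exists>u. u \<in> ?V \<and> suffix v u \<and> cut_vertex u \<omega>"
        if "\<not> no_cut m v \<omega>" "v \<in> ?V" "v \<noteq> []" for m v
        using that
      proof (induction m arbitrary: v)
        case (Suc m)
        show ?case
        proof (cases "cut_vertex v \<omega>")
          case True
          then show ?thesis using Suc.prems by blast
        next
          case False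
          then obtain i where i: "i < fst \<omega> v" "\<not> no_cut m (i # v) \<omega>" using Suc.prems(1) by auto
          then have "i # v \<in> ?V" using Suc.prems nch[of v] by (simp add: Cons_in_tverts)
          then obtain u where u: "u \<in> ?V" "suffix (i # v) u" "cut_vertex u \<omega>"
            using Suc.IH[OF i(2)] by blast
          moreover have "suffix v u" using u(2) by (rule suffix_ConsD)
          ultimately show ?thesis by blast
        qed
      qed simp
      have "\<exists>y\<in>?Y. n < length y" for n
      proof -
        let ?v = "replicate (Suc n) (0::nat)"
        have "replicate k 0 \<in> ?V" for k
          by (induction k) (use first_child tverts.root in auto)
        then have v: "?v \<in> ?V" by blast
        obtain m where m: "\<not> no_cut m ?v \<omega>" using cut by blast
        have "?v \<noteq> []" by simp
        from below[OF m v this] obtain u where u: "u \<in> ?V" "suffix ?v u" "cut_vertex u \<omega>"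
          by blast
        have len: "Suc n \<le> length u" using u(2) suffix_length_le by fastforce
        then have ne: "u \<noteq> []" by auto
        have Z2: "2 \<le> fst \<omega> u" and b0: "branch_lim (0 # u) \<omega> = 0" and b1: "branch_lim (1 # u) \<omega> = 0"
          and lt: "ennreal (?W (u, 0 # u)) < ennreal (?W (u, 1 # u))"
          using u(3) by (auto simp: cut_vertex_def)
        have V: "0 # u \<in> ?V" "1 # u \<in> ?V"
          using u(1) Z2 nch[OF ne] by (auto simp: Cons_in_tverts)
        \<comment> \<open>The exit through \<open>0 # u\<close> is lighter than the edge to
          \<open>1 # u\<close> and has no further cost, so \<open>u\<close> avoids
          \<open>1 # u\<close> for free.\<close>
        have "dl u (1 # u) = 0"
        proof -
          have "0 # u \<in> N u (1 # u)" using V u(1) by (simp add: nbrs_def tree_adj_def)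
          then have "(INF y\<in>N u (1 # u). ennreal (?W (u, y)) + dl y u) \<le> ennreal (?W (u, 0 # u)) + dl (0 # u) u"
            by (rule INF_lower)
          also have "\<dots> = ennreal (?W (u, 0 # u))" using down[OF V(1)] b0 by simp
          finally show ?thesis
            by (subst detour_lim_rec[OF finite_nbrs])
              (use lt in \<open>auto intro!: diff_eq_0_ennreal le_less_trans[OF _ ennreal_less_top]\<close>)
        qed
        then have "1 # u \<in> ?Y" using V(2) down[OF V(2)] b1 by simp
        then show ?thesis using len by (intro bexI[of _ "1 # u"]) auto
      qed
      note long = this
      show "infinite ?Y"
      proof
        assume "finite ?Y"
        then have "finite (length ` ?Y)" by simp
        moreover obtain y where "y \<in> ?Y" "Max (length ` ?Y) < length y" using long by blast
        ultimately show False by (meson Max_ge imageI leD)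
      qed
    qed
    then show ?case by blast
  qed
qed

end

theorem mainTheorem6:
  fixes \<mu> :: "nat pmf" and ugw :: bool
  assumes "integrable (measure_pmf \<mu>) real"
    and "1 < measure_pmf.expectation \<mu> real"
    and "pmf \<mu> 0 = 0"
  shows "AE \<omega> in tree_law \<mu> ugw.
           (let V = tverts ugw (fst \<omega>); adj = tree_adj V; W = snd \<omega> in
            \<exists>F. wired_MSA_limit V adj W F \<and>
                infinite {C \<in> arb_components V F. infinite C} \<and>
                (\<forall>C \<in> arb_components V F. one_ended F C))"
proof -
  interpret supercritical_gw \<mu> by standard (fact assms)+
  have base: "AE \<omega> in base.
           (let V = tverts ugw (fst \<omega>); adj = tree_adj V; W = snd \<omega> in
            \<exists>F. wired_MSA_limit V adj W F \<and>
                infinite {C \<in> arb_components V F. infinite C} \<and>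
                (\<forall>C \<in> arb_components V F. one_ended F C))" (is "AE \<omega> in base. ?P \<omega>")
    using AE_limit_forest[of ugw]
  proof eventually_elim
    case (elim \<omega>)
    then obtain F where "best_exit_forest (tverts ugw (fst \<omega>)) (snd \<omega>) F" by blast
    from best_exit_forest.limit_forest[OF this] show ?case by (auto simp: Let_def)
  qed
  \<comment> \<open>The biased law has a density with respect to \<open>base\<close>, so almost sure
    statements about the augmented tree carry over.\<close>
  have "(\<lambda>\<omega>. ennreal ((1 / (real (fst \<omega> []) + 1)) / measure_pmf.expectation \<mu> (\<lambda>k. 1 / (real k + 1))))
      \<in> borel_measurable base" by measurable
  then have "AE \<omega> in density base
      (\<lambda>\<omega>. ennreal ((1 / (real (fst \<omega> []) + 1)) / measure_pmf.expectation \<mu> (\<lambda>k. 1 / (real k + 1)))). ?P \<omega>"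
    by (subst AE_density) (use base in auto)
  with base show ?thesis unfolding tree_law_def by (simp only: split: if_split) blast
qed

end
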